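(* Assume $\mu>0$, $K=L=0$, and that $h$ satisfies the assumption stated in the context. Let $d^*$ and $u^*$, along with constants $A^*$ and $B^*$, be the unique constants such that $g=g_{A^*,B^*}$ satisfies $g(d^* )=-k$, $g(u^* )=\ell$, $g'(d^* )=0$, $g'(u^* )=0$. Then the control band policy $\varphi^*=\{d^*,u^*\}$ is optimal among all feasible policies; that is, $\mathrm{AC}(x,\varphi^* )\le\mathrm{AC}(x,\varphi)$ for every feasible policy $\varphi$ and every initial inventory level $x\in\mathbb R$.
   Context: $\mu>0$, $\sigma>0$, $k>0$, $\ell>0$ are constants, the fixed costs are $K=L=0$, and $\lambda=2\mu/\sigma^2$. $W$ is an $\{\mathcal F_t\}$-standard Brownian motion on a filtered probability space and $X(t)=x+\mu t+\sigma W(t)$. Assumption on $h:\mathbb R\to[0,\infty)$: $h$ is continuous and convex; there is $a\in\mathbb R$ such that $h$ is $C^2$ on $\mathbb R\setminus\{a\}$ and $h(a)=0$; $h'(x)<0$ for $x<a$ and $h'(x)>0$ for $x>a$; and $\int_{-\infty}^a|h'(y)|e^{\lambda(y-a)}dy<\infty$. For $A,B,x\in\mathbb R$, $g_{A,B}(x)=A-Be^{-\lambda(x-a)}-\frac{\lambda}{\mu}\int_a^x h(y)e^{-\lambda(x-y)}\,dy$. It is a known fact, usable here, that constants $A^*,B^*,d^*,u^*$ with the listed properties exist and are unique, and that then $d^*<u^*$ and $g$ decreases on $(-\infty,d^* )$, increases on $(d^*,u^* )$ and decreases on $(u^*,\infty)$. Policies: a policy $\varphi=(Y_1,Y_2)$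 is a pair of $\{\mathcal F_t\}$-adapted processes with nondecreasing right-continuous paths having left limits, with convention $Y_i(0-)=0$. The inventory process is $Z(t)=X(t)+Y_1(t)-Y_2(t)$, $Z(0-)=x$. A policy is feasible if $\mathbb E_x[Y_i(t)]<\infty$ for $i=1,2$ and all $t\ge0$. With zero fixed costs, $$\mathrm{AC}(x,\varphi)=\limsup_{t\to\infty}\frac1t\,\mathbb E_x\Big[\int_0^t h(Z(s))\,ds+kY_1(t)+\ell Y_2(t)\Big],$$ where $\mathbb E_x$ is expectation given $Z(0-)=x$. Two-sided regulator: for a right-continuous path $w$ on $[0,\infty)$ with left limits and $w(0)\in[d,u]$, there is a unique triple $(y_1,y_2,z)$ of such paths with $z(t)=w(t)+y_1(t)-y_2(t)$, $z(t)\in[d,u]$ for all $t\ge0$, $y_1(0)=y_2(0)=0$, $y_1,y_2$ nondecreasing, $\int_0^\infty(z(t)-d)\,dy_1(t)=0$ and $\int_0^\infty(u-z(t))\,dy_2(t)=0$ (a known fact). Write $y_i=\Psi_i(w)$, $i=1,2$. Control band policy $\{d,u\}$, $d<u$: if $x\in[d,u]$, then $Y_1=\Psi_1(X)$ and $Y_2=\Psi_2(X)$. If $x\notin[d,u]$, the inventory jumps at time $0$ to the closest point of $[d,u]$ (the jump being counted in $Y_1$ if upward, in $Y_2$ if downward), and thereafter the two-sided regulator is applied to the Brownian motion restarted from that point. *)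

theory Defs
  imports "HOL-Probability.Probability"
begin

section \<open>Driving Brownian motion\<close>

text \<open>Time is the half-line \<open>t \<ge> 0\<close>. Processes are indexed by all of \<open>real\<close>, and what they do at
  negative times is irrelevant unless stated otherwise.\<close>

type_synonym 'w process = "real \<Rightarrow> 'w \<Rightarrow> real"

definition filtered_prob_space :: "'w measure \<Rightarrow> (real \<Rightarrow> 'w measure) \<Rightarrow> bool" where
  "filtered_prob_space M F \<longleftrightarrow>
     prob_space M \<and> filtration (space M) F \<and> (\<forall>t. subalgebra M (F t))"

definition adapted :: "(real \<Rightarrow> 'w measure) \<Rightarrow> 'w process \<Rightarrow> bool" where
  "adapted F Y \<longleftrightarrow> (\<forall>t\<ge>0. Y t \<in> borel_measurable (F t))"

definition std_brownian_motion ::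
    "'w measure \<Rightarrow> (real \<Rightarrow> 'w measure) \<Rightarrow> 'w process \<Rightarrow> bool" where
  "std_brownian_motion M F W \<longleftrightarrow>
     adapted F W \<and>
     (\<forall>\<omega>\<in>space M. W 0 \<omega> = 0 \<and> continuous_on {0..} (\<lambda>t. W t \<omega>)) \<and>
     (\<forall>s t. 0 \<le> s \<and> s < t \<longrightarrow>
        distributed M lborel (\<lambda>\<omega>. W t \<omega> - W s \<omega>) (\<lambda>y. ennreal (normal_density 0 (sqrt (t - s)) y)) \<and>
        prob_space.indep_set M (sets (F s))
          (sets (vimage_algebra (space M) (\<lambda>\<omega>. W t \<omega> - W s \<omega>) borel)))"

definition drifted_bm :: "real \<Rightarrow> real \<Rightarrow> 'w process \<Rightarrow> real \<Rightarrow> 'w process" where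
  "drifted_bm \<mu> \<sigma> W x = (\<lambda>t \<omega>. x + \<mu> * t + \<sigma> * W t \<omega>)"


section \<open>Policies and their long-run average cost\<close>

definition rcll :: "(real \<Rightarrow> real) \<Rightarrow> bool" where
  "rcll f \<longleftrightarrow> (\<forall>t\<ge>0. continuous (at_right t) f) \<and> (\<forall>t>0. \<exists>L. (f \<longlongrightarrow> L) (at_left t))"

text \<open>A policy is a pair \<open>(Y\<^sub>1, Y\<^sub>2)\<close>. The convention \<open>Y\<^sub>i(0-) = 0\<close> is encoded by letting paths vanish
  at negative times; monotonicity on all of \<open>real\<close> then also says that the jump \<open>Y\<^sub>i(0)\<close> at time \<open>0\<close>
  is nonnegative.\<close>

type_synonym 'w policy = "'w process \<times> 'w process"

definition control_process ::
    "'w measure \<Rightarrow> (real \<Rightarrow> 'w measure) \<Rightarrow> 'w process \<Rightarrow> bool" where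
  "control_process M F Y \<longleftrightarrow>
     adapted F Y \<and>
     (\<forall>\<omega>\<in>space M. (\<forall>t<0. Y t \<omega> = 0) \<and> mono (\<lambda>t. Y t \<omega>) \<and> rcll (\<lambda>t. Y t \<omega>))"

definition feasible :: "'w measure \<Rightarrow> (real \<Rightarrow> 'w measure) \<Rightarrow> 'w policy \<Rightarrow> bool" where
  "feasible M F \<phi> \<longleftrightarrow>
     control_process M F (fst \<phi>) \<and> control_process M F (snd \<phi>) \<and>
     (\<forall>t\<ge>0. integrable M (fst \<phi> t) \<and> integrable M (snd \<phi> t))"

definition inventory :: "real \<Rightarrow> real \<Rightarrow> 'w process \<Rightarrow> real \<Rightarrow> 'w policy \<Rightarrow> 'w process" where
  "inventory \<mu> \<sigma> W x \<phi> = (\<lambda>t \<omega>. drifted_bm \<mu> \<sigma> W x t \<omega> + fst \<phi> t \<omega> - snd \<phi> t \<omega>)"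

text \<open>All costs are nonnegative, so expectations and the limit superior over real \<open>t \<rightarrow> \<infinity>\<close> are taken
  in \<open>[0, \<infinity>]\<close>. The expectation \<open>E\<^sub>x\<close> is the one under \<open>M\<close>: the initial level \<open>x\<close> is deterministic and
  enters through the inventory process. There are no fixed costs.\<close>

definition average_cost ::
    "'w measure \<Rightarrow> 'w process \<Rightarrow> real \<Rightarrow> real \<Rightarrow> (real \<Rightarrow> real) \<Rightarrow> real \<Rightarrow> real \<Rightarrow>
     real \<Rightarrow> 'w policy \<Rightarrow> ennreal" where
  "average_cost M W \<mu> \<sigma> h k l x \<phi> =
     Limsup at_top (\<lambda>t.
       (\<integral>\<^sup>+\<omega>. ((\<integral>\<^sup>+s\<in>{0..t}. ennreal (h (inventory \<mu> \<sigma> W x \<phi> s \<omega>)) \<partial>lborel)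
              + ennreal (k * fst \<phi> t \<omega> + l * snd \<phi> t \<omega>)) \<partial>M)
       / ennreal t)"


section \<open>Two-sided regulator and control band policies\<close>

text \<open>The triple lives on \<open>[0, \<infinity>)\<close>; it is extended by \<open>0\<close> to negative times so that it is unique as
  a triple of functions on \<open>real\<close> and \<open>interval_measure\<close> is the Stieltjes measure \<open>dy\<^sub>i\<close>. The integrands
  in the complementarity conditions are nonnegative.\<close>

definition two_sided_regulator ::
    "real \<Rightarrow> real \<Rightarrow> (real \<Rightarrow> real) \<Rightarrow> (real \<Rightarrow> real) \<Rightarrow> (real \<Rightarrow> real) \<Rightarrow> (real \<Rightarrow> real) \<Rightarrow> bool" where
  "two_sided_regulator d u w y1 y2 z \<longleftrightarrow>
     rcll y1 \<and> rcll y2 \<and> rcll z \<and>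
     (\<forall>t\<ge>0. z t = w t + y1 t - y2 t \<and> z t \<in> {d..u}) \<and>
     y1 0 = 0 \<and> y2 0 = 0 \<and> mono y1 \<and> mono y2 \<and>
     (\<integral>\<^sup>+t\<in>{0..}. ennreal (z t - d) \<partial>interval_measure y1) = 0 \<and>
     (\<integral>\<^sup>+t\<in>{0..}. ennreal (u - z t) \<partial>interval_measure y2) = 0 \<and>
     (\<forall>t<0. y1 t = 0 \<and> y2 t = 0 \<and> z t = 0)"

definition regulator_map ::
    "real \<Rightarrow> real \<Rightarrow> (real \<Rightarrow> real) \<Rightarrow> (real \<Rightarrow> real) \<times> (real \<Rightarrow> real) \<times> (real \<Rightarrow> real)" where
  "regulator_map d u w = (THE (y1, y2, z). two_sided_regulator d u w y1 y2 z)"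

definition \<Psi>1 :: "real \<Rightarrow> real \<Rightarrow> (real \<Rightarrow> real) \<Rightarrow> real \<Rightarrow> real" where
  "\<Psi>1 d u w = fst (regulator_map d u w)"

definition \<Psi>2 :: "real \<Rightarrow> real \<Rightarrow> (real \<Rightarrow> real) \<Rightarrow> real \<Rightarrow> real" where
  "\<Psi>2 d u w = fst (snd (regulator_map d u w))"

text \<open>If \<open>x \<in> [d, u]\<close>, then \<open>c = x\<close>, both jump terms vanish, and the policy is \<open>(\<Psi>\<^sub>1(X), \<Psi>\<^sub>2(X))\<close>.\<close>

definition control_band_policy ::
    "real \<Rightarrow> real \<Rightarrow> 'w process \<Rightarrow> real \<Rightarrow> real \<Rightarrow> real \<Rightarrow> 'w policy" where
  "control_band_policy \<mu> \<sigma> W d u x =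
     (let c = closest_point {d..u} x in
       ((\<lambda>t \<omega>. if t < 0 then 0
               else max 0 (c - x) + \<Psi>1 d u (\<lambda>s. drifted_bm \<mu> \<sigma> W c s \<omega>) t),
        (\<lambda>t \<omega>. if t < 0 then 0
               else max 0 (x - c) + \<Psi>2 d u (\<lambda>s. drifted_bm \<mu> \<sigma> W c s \<omega>) t)))"


section \<open>Holding cost and the function \<open>g\<close>\<close>

definition decay_rate :: "real \<Rightarrow> real \<Rightarrow> real" where
  "decay_rate \<mu> \<sigma> = 2 * \<mu> / \<sigma>\<^sup>2"

definition holding_cost :: "real \<Rightarrow> real \<Rightarrow> (real \<Rightarrow> real) \<Rightarrow> real \<Rightarrow> bool" where
  "holding_cost \<mu> \<sigma> h a \<longleftrightarrow>
     (\<forall>x. 0 \<le> h x) \<and>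
     continuous_on UNIV h \<and> convex_on UNIV h \<and>
     h differentiable_on (- {a}) \<and> deriv h differentiable_on (- {a}) \<and>
     continuous_on (- {a}) (deriv (deriv h)) \<and>
     h a = 0 \<and>
     (\<forall>x<a. deriv h x < 0) \<and> (\<forall>x>a. deriv h x > 0) \<and>
     set_integrable lborel {..<a} (\<lambda>y. \<bar>deriv h y\<bar> * exp (decay_rate \<mu> \<sigma> * (y - a)))"

text \<open>The interval integral is oriented, so it also has the intended meaning for \<open>x < a\<close>.\<close>

definition g_AB ::
    "real \<Rightarrow> real \<Rightarrow> (real \<Rightarrow> real) \<Rightarrow> real \<Rightarrow> real \<Rightarrow> real \<Rightarrow> real \<Rightarrow> real" where
  "g_AB \<mu> \<sigma> h a A B x =
     A - B * exp (- decay_rate \<mu> \<sigma> * (x - a))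
       - decay_rate \<mu> \<sigma> / \<mu> *
         (LBINT y=ereal a..ereal x. h y * exp (- decay_rate \<mu> \<sigma> * (x - y)))"

end

theory Submission
  imports Defs
begin

text \<open>The proof compares every policy with the solution of the average cost optimality equations.
  Write \<open>[x]\<close> for the point of \<open>[d, u]\<close> closest to \<open>x\<close>, \<open>\<gamma> = \<mu> A\<close>, and let \<open>V\<close> be an
  antiderivative of \<open>x \<mapsto> g [x]\<close>. Since \<open>g' d = g' u = 0\<close>, \<open>V\<close> is twice continuously differentiable.
  Differentiating the formula for \<open>g\<close> gives \<open>\<sigma>\<^sup>2/2 V'' + \<mu> V' + h [x] = \<gamma>\<close>, where
  \<open>h [x] \<le> h x\<close> because \<open>d < a < u\<close>; moreover \<open>- k \<le> V' \<le> l\<close>, with equality on the left below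
  \<open>d\<close> and equality on the right above \<open>u\<close> (\<open>relative_value_exists\<close>).

  Time is discretised, and each step is treated by a second-order Taylor expansion. If the level \<open>Z\<close> is known at time \<open>s\<close> and is then moved by the Brownian increment alone over a
  step \<open>\<delta>\<close>, independence of the increment shows that \<open>E V\<close> changes by \<open>\<delta> (\<gamma> - E h [Z])\<close> up to
  \<open>O(\<delta> sqrt \<delta>)\<close> (\<open>one_step\<close>); over a horizon of length \<open>t\<close> the errors add up to \<open>O(t sqrt \<delta>)\<close>.

  For an arbitrary feasible policy, the controls exerted during a step cost at least the drop of
  \<open>V\<close> that they cause (\<open>V_push\<close>). Summing over the steps and letting \<open>\<delta> \<rightarrow> 0\<close> shows that the expected
  cost up to time \<open>t\<close> is at least \<open>\<gamma> t + V x - E V (Z t)\<close> (\<open>lower_bound\<close>). As \<open>V\<close> is bounded by a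
  multiple of \<open>1 + h\<close>, the last term can only matter if the holding cost itself grows with \<open>t\<close>, so
  the average cost is at least \<open>\<gamma>\<close> (\<open>average_cost_lower\<close>).

  For the control band policy, consider the chain that adds the Brownian increments on the grid of
  width \<open>2^{-n}\<close> and projects to \<open>[d, u]\<close> after each step. Its controls act outside \<open>(d, u)\<close>, where
  \<open>V\<close> is affine with slopes \<open>- k\<close> and \<open>l\<close>, so the inequality used above becomes an equality
  (\<open>V_clamp\<close>) and the expected cost of the chain is at most \<open>\<gamma> t\<close> plus a constant plus \<open>O(t sqrt \<delta>)\<close>
  (\<open>upper_sum\<close>). The cumulative controls of the chain are the smallest ones that keep the path in the
  band at the grid points; hence they increase with \<open>n\<close>, and their limits are the two components of
  the two-sided regulator (\<open>regulator_map_eq\<close>). Fatou's lemma transfers the bound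
  (\<open>expected_cost_le\<close>), which also makes the policy feasible; the regulator is measurable as a limit of
  the chains.\<close>

section \<open>Reflection in discrete time\<close>

text \<open>\<open>v\<close> is the uncontrolled path. The pair consists of the cumulative upward and downward pushes of
  the chain that adds the increments of \<open>v\<close> and is projected back to \<open>[d, u]\<close> after each one. It
  starts from \<open>(0, 0)\<close> because \<open>v 0\<close> lies in the band in all applications.\<close>

fun discrete_regulator :: "real \<Rightarrow> real \<Rightarrow> (nat \<Rightarrow> real) \<Rightarrow> nat \<Rightarrow> real \<times> real" where
  "discrete_regulator d u v 0 = (0, 0)"
| "discrete_regulator d u v (Suc i) =
     (let (p, q) = discrete_regulator d u v i in
       (max p (d - v (Suc i) + q), max q (v (Suc i) + p - u)))"

definition low :: "real \<Rightarrow> real \<Rightarrow> (nat \<Rightarrow> real) \<Rightarrow> nat \<Rightarrow> real" where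
  "low d u v i = fst (discrete_regulator d u v i)"

definition upp :: "real \<Rightarrow> real \<Rightarrow> (nat \<Rightarrow> real) \<Rightarrow> nat \<Rightarrow> real" where
  "upp d u v i = snd (discrete_regulator d u v i)"

lemma low_upp_0 [simp]: "low d u v 0 = 0" "upp d u v 0 = 0"
  by (simp_all add: low_def upp_def)

lemma low_Suc: "low d u v (Suc i) = max (low d u v i) (d - v (Suc i) + upp d u v i)"
  and upp_Suc: "upp d u v (Suc i) = max (upp d u v i) (v (Suc i) + low d u v i - u)"
  by (simp_all add: low_def upp_def split_beta Let_def)

text \<open>Reflecting the picture at the origin exchanges the barriers. Through this symmetry, arguments
  given below for the lower barrier also cover the upper one.\<close>

lemma low_mirror: "low (- u) (- d) (\<lambda>i. - v i) i = upp d u v i"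
  and upp_mirror: "upp (- u) (- d) (\<lambda>i. - v i) i = low d u v i"
proof (induction i)
  case (Suc i)
  { case 1 show ?case using Suc by (simp add: low_Suc upp_Suc) }
  { case 2 show ?case using Suc by (simp add: low_Suc upp_Suc) }
qed simp_all

lemma low_mono: "i \<le> j \<Longrightarrow> low d u v i \<le> low d u v j"
  by (rule lift_Suc_mono_le[of "low d u v"]) (auto simp: low_Suc)

lemma upp_mono: "i \<le> j \<Longrightarrow> upp d u v i \<le> upp d u v j"
  by (rule lift_Suc_mono_le[of "upp d u v"]) (auto simp: upp_Suc)

lemma low_nonneg: "0 \<le> low d u v i" and upp_nonneg: "0 \<le> upp d u v i"
  using low_mono[of 0 i] upp_mono[of 0 i] by auto

lemma discrete_regulator_tube:
  assumes "d \<le> u" "v 0 \<in> {d..u}"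
  shows "v i + low d u v i - upp d u v i \<in> {d..u}"
proof (induction i)
  case 0 then show ?case using assms by simp
next
  case (Suc i) then show ?case using assms(1) by (auto simp: low_Suc upp_Suc max_def)
qed

lemma discrete_regulator_clamp:
  assumes "d \<le> u"
  shows "v (Suc i) + low d u v (Suc i) - upp d u v (Suc i)
    = max d (min u (v (Suc i) + low d u v i - upp d u v i))"
  using assms by (auto simp: low_Suc upp_Suc max_def min_def)

text \<open>The recursion pushes only when it has to, so it never pushes more than a competitor that stays in the
  band. In the two constraints the opposing control is taken one step earlier. This is weaker than
  staying in the band, as the controls are nondecreasing, and it is exactly what the recursion
  consumes.\<close>

lemma discrete_regulator_minimal:
  assumes "0 \<le> P 0" "0 \<le> Q 0"
    and "\<And>i. P i \<le> P (Suc i)" "\<And>i. Q i \<le> Q (Suc i)"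
    and "\<And>i. d \<le> v (Suc i) + P (Suc i) - Q i"
    and "\<And>i. v (Suc i) + P i - Q (Suc i) \<le> u"
  shows "low d u v i \<le> P i \<and> upp d u v i \<le> Q i"
proof (induction i)
  case 0 then show ?case using assms by simp
next
  case (Suc i)
  then show ?case using assms(3-6)[of i] by (auto simp: low_Suc upp_Suc)
qed

text \<open>Complementarity in discrete time: \<open>low\<close> grows only by being raised to a value
  \<open>d - v r + upp r\<close>, which is the value that puts the level at \<open>d\<close> at time \<open>r\<close>.\<close>

lemma low_le_bound:
  assumes "i \<le> j" "low d u v i \<le> C"
    and "\<And>r. i < r \<Longrightarrow> r \<le> j \<Longrightarrow> d - v r + upp d u v r \<le> C"
  shows "low d u v j \<le> C"
  using assms
proof (induction j rule: dec_induct)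
  case (step n)
  have "d - v (Suc n) + upp d u v (Suc n) \<le> C" using step.prems(2)[of "Suc n"] step.hyps by simp
  moreover have "low d u v n \<le> C" using step by simp
  ultimately show ?case using upp_mono[of n "Suc n" d u v] by (simp add: low_Suc)
qed simp

text \<open>A chain that starts in the lower half of the band and whose input moves by at most a quarter of the
  band width cannot be pushed down: a push from below first lifts it to \<open>d\<close> only. Hence its upward
  pushes compensate at most the displacement of the input.\<close>

lemma discrete_regulator_increment_aux:
  assumes tube: "d \<le> v m + low d u v m - upp d u v m"
    and mid: "v m + low d u v m - upp d u v m \<le> (d + u) / 2"
    and e: "4 * e \<le> u - d" "m \<le> n" "\<And>j. m \<le> j \<Longrightarrow> j \<le> n \<Longrightarrow> \<bar>v j - v m\<bar> \<le> e"
  shows "low d u v n \<le> low d u v m + e \<and> upp d u v n = upp d u v m"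
  using e(2,3)
proof (induction n rule: dec_induct)
  case base
  show ?case using base[of m] by simp
next
  case (step n)
  have "\<bar>v (Suc n) - v m\<bar> \<le> e" using step by simp
  moreover have "low d u v n \<le> low d u v m + e \<and> upp d u v n = upp d u v m"
    using step by simp
  ultimately show ?case
    using tube mid e(1) low_mono[of m "Suc n" d u v] by (auto simp: low_Suc upp_Suc)
qed

text \<open>One of the two barriers is out of reach, namely the upper one from the lower half of the band and
  the lower one from the upper half. This bound does not depend on the number of steps, which makes
  the approximations of a continuous path equicontinuous.\<close>

lemma discrete_regulator_increment:
  assumes "d \<le> u" "v 0 \<in> {d..u}"
    and e: "4 * e \<le> u - d" "m \<le> n" "\<And>j. m \<le> j \<Longrightarrow> j \<le> n \<Longrightarrow> \<bar>v j - v m\<bar> \<le> e"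
  shows "low d u v n \<le> low d u v m + e" "upp d u v n \<le> upp d u v m + e"
proof -
  have e0: "0 \<le> e" using e(3)[of m] e(2) by simp
  let ?z = "v m + low d u v m - upp d u v m"
  have t: "?z \<in> {d..u}" by (rule discrete_regulator_tube) fact+
  show "low d u v n \<le> low d u v m + e" "upp d u v n \<le> upp d u v m + e"
  proof -
    have "low d u v n \<le> low d u v m + e \<and> upp d u v n \<le> upp d u v m + e"
    proof (cases "?z \<le> (d + u) / 2")
      case True
      then show ?thesis using discrete_regulator_increment_aux[of d v m u e n] t e e0 by auto
    next
      case False
      then show ?thesis
        using discrete_regulator_increment_aux[of "-u" "\<lambda>i. - v i" m "-d" e n] t e e0
        by (auto simp: low_mirror upp_mirror abs_minus_commute)
    qed
    then show "low d u v n \<le> low d u v m + e" "upp d u v n \<le> upp d u v m + e" by auto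
  qed
qed

section \<open>Two-sided reflection of a continuous path\<close>

text \<open>The index of the last point of the grid of width \<open>2^{-n}\<close> that is at most \<open>t\<close>.\<close>

definition grid_floor :: "nat \<Rightarrow> real \<Rightarrow> nat" where
  "grid_floor n t = nat \<lfloor>t * 2 ^ n\<rfloor>"

definition low_at :: "real \<Rightarrow> real \<Rightarrow> (real \<Rightarrow> real) \<Rightarrow> nat \<Rightarrow> real \<Rightarrow> real" where
  "low_at d u w n t = low d u (\<lambda>i. w (real i / 2 ^ n)) (grid_floor n t)"

definition upp_at :: "real \<Rightarrow> real \<Rightarrow> (real \<Rightarrow> real) \<Rightarrow> nat \<Rightarrow> real \<Rightarrow> real" where
  "upp_at d u w n t = upp d u (\<lambda>i. w (real i / 2 ^ n)) (grid_floor n t)"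

lemma upp_at_mirror: "upp_at d u w n t = low_at (- u) (- d) (\<lambda>s. - w s) n t"
  by (simp add: upp_at_def low_at_def low_mirror)

lemma grid_floor_le: "0 \<le> t \<Longrightarrow> real (grid_floor n t) / 2 ^ n \<le> t"
  by (simp add: grid_floor_def field_simps)

lemma grid_floor_less: "0 \<le> t \<Longrightarrow> t < real (grid_floor n t) / 2 ^ n + 1 / 2 ^ n"
  by (simp add: grid_floor_def field_simps) linarith

lemma grid_floor_mono: "s \<le> t \<Longrightarrow> grid_floor n s \<le> grid_floor n t"
  by (auto simp: grid_floor_def intro!: nat_mono floor_mono mult_right_mono)

lemma grid_floor_double: "0 \<le> t \<Longrightarrow> 2 * grid_floor n t \<le> grid_floor (Suc n) t"
proof -
  assume "0 \<le> t"
  have "2 * \<lfloor>t * 2 ^ n\<rfloor> \<le> \<lfloor>t * 2 ^ Suc n\<rfloor>"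
    by (simp add: le_floor_iff)
  with \<open>0 \<le> t\<close> show ?thesis by (simp add: grid_floor_def)
qed

lemma grid_floor_tendsto: "0 \<le> t \<Longrightarrow> (\<lambda>n. real (grid_floor n t) / 2 ^ n) \<longlonglongrightarrow> t"
proof (rule real_tendsto_sandwich[of "\<lambda>n. t - 1 / 2 ^ n" _ _ "\<lambda>_. t"])
  assume t: "0 \<le> t"
  show "\<forall>\<^sub>F n in sequentially. t - 1 / 2 ^ n \<le> real (grid_floor n t) / 2 ^ n"
    using grid_floor_less[OF t] by (auto intro!: always_eventually less_imp_le simp: algebra_simps)
  show "\<forall>\<^sub>F n in sequentially. real (grid_floor n t) / 2 ^ n \<le> t"
    using grid_floor_le[OF t] by auto
  have "(\<lambda>n. t - (1/2) ^ n) \<longlonglongrightarrow> t - 0" by (intro tendsto_intros LIMSEQ_realpow_zero) auto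
  then show "(\<lambda>n. t - 1 / 2 ^ n) \<longlonglongrightarrow> t" by (simp add: power_divide)
qed auto

text \<open>The finer chain, observed along the coarser grid, is one of the competitors in the minimality of the
  coarser chain.\<close>

lemma low_upp_refine:
  assumes "d \<le> u" "w 0 \<in> {d..u}"
  shows "low d u (\<lambda>i. w (real i / 2 ^ n)) i \<le> low d u (\<lambda>i. w (real i / 2 ^ Suc n)) (2 * i)"
    "upp d u (\<lambda>i. w (real i / 2 ^ n)) i \<le> upp d u (\<lambda>i. w (real i / 2 ^ Suc n)) (2 * i)"
proof -
  let ?v = "\<lambda>i. w (real i / 2 ^ Suc n)"
  let ?L = "low d u ?v" and ?U = "upp d u ?v"
  have "low d u (\<lambda>i. w (real i / 2 ^ n)) i \<le> ?L (2 * i) \<and>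
      upp d u (\<lambda>i. w (real i / 2 ^ n)) i \<le> ?U (2 * i)"
  proof (rule discrete_regulator_minimal[where P = "\<lambda>i. ?L (2 * i)" and Q = "\<lambda>i. ?U (2 * i)"])
    fix i
    have t: "?v (2 * Suc i) + ?L (2 * Suc i) - ?U (2 * Suc i) \<in> {d..u}"
      by (rule discrete_regulator_tube) (use assms in auto)
    have w: "?v (2 * Suc i) = w (real (Suc i) / 2 ^ n)"
      by (rule arg_cong[of _ _ w]) (simp add: field_simps)
    have U: "?U (2 * i) \<le> ?U (2 * Suc i)" and L: "?L (2 * i) \<le> ?L (2 * Suc i)"
      by (intro upp_mono low_mono; simp)+
    then show "?U (2 * i) \<le> ?U (2 * Suc i)" "?L (2 * i) \<le> ?L (2 * Suc i)" by auto
    show "d \<le> w (real (Suc i) / 2 ^ n) + ?L (2 * Suc i) - ?U (2 * i)"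
      using t U unfolding w by auto
    show "w (real (Suc i) / 2 ^ n) + ?L (2 * i) - ?U (2 * Suc i) \<le> u"
      using t L unfolding w by auto
  qed (auto simp: low_nonneg upp_nonneg)
  then show "low d u (\<lambda>i. w (real i / 2 ^ n)) i \<le> low d u ?v (2 * i)"
    "upp d u (\<lambda>i. w (real i / 2 ^ n)) i \<le> upp d u ?v (2 * i)" by auto
qed

locale regulator_path =
  fixes d u :: real and w :: "real \<Rightarrow> real"
  assumes du: "d < u" and w0: "w 0 \<in> {d..u}" and wcont: "continuous_on {0..} w"
begin

lemma mirror: "regulator_path (- u) (- d) (\<lambda>s. - w s)"
  using du w0 wcont by (auto simp: regulator_path_def intro: continuous_on_minus)

lemma low_at_incseq:
  assumes "0 \<le> t" shows "incseq (\<lambda>n. low_at d u w n t)"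
proof (rule incseq_SucI)
  fix n
  have "low_at d u w n t \<le> low d u (\<lambda>i. w (real i / 2 ^ Suc n)) (2 * grid_floor n t)"
    unfolding low_at_def by (rule low_upp_refine) (use du w0 in auto)
  also have "\<dots> \<le> low_at d u w (Suc n) t"
    unfolding low_at_def by (rule low_mono[OF grid_floor_double[OF assms]])
  finally show "low_at d u w n t \<le> low_at d u w (Suc n) t" .
qed

lemma low_at_mono: "s \<le> t \<Longrightarrow> low_at d u w n s \<le> low_at d u w n t"
  unfolding low_at_def by (rule low_mono[OF grid_floor_mono])

text \<open>For coarse grids the level at the two grid points below \<open>s\<close> and \<open>t\<close> can differ however close \<open>s\<close>
  and \<open>t\<close> are; hence the restriction to large \<open>n\<close>.\<close>

lemma low_at_equicontinuous:
  assumes e: "0 < e" and T: "0 \<le> T"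
  obtains \<eta> N where "\<eta> > 0"
    "\<And>n s t. n \<ge> N \<Longrightarrow> 0 \<le> s \<Longrightarrow> s \<le> t \<Longrightarrow> t \<le> T \<Longrightarrow> t \<le> s + \<eta> \<Longrightarrow> low_at d u w n t \<le> low_at d u w n s + e"
proof -
  \<comment> \<open>the cap is the quarter of the band width that the discrete increment bound needs\<close>
  define e' where "e' = min e ((u - d) / 4)"
  have e': "0 < e'" "4 * e' \<le> u - d" "e' \<le> e" using e du by (auto simp: e'_def min_def)
  have "uniformly_continuous_on {0..T} w"
    by (intro compact_uniformly_continuous continuous_on_subset[OF wcont]) auto
  then obtain \<eta> where \<eta>: "\<eta> > 0"
    "\<And>s t. s \<in> {0..T} \<Longrightarrow> t \<in> {0..T} \<Longrightarrow> dist t s < \<eta> \<Longrightarrow> dist (w t) (w s) < e'"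
    using e'(1) unfolding uniformly_continuous_on_def by metis
  obtain N where N: "(1/2) ^ N < \<eta> / 2" using real_arch_pow_inv[of "\<eta>/2" "1/2"] \<eta>(1) by auto
  show ?thesis
  proof (rule that[of "\<eta> / 2" N])
    show "\<eta> / 2 > 0" using \<eta> by simp
    fix n s t assume n: "n \<ge> N" and st: "0 \<le> s" "s \<le> t" "t \<le> T" "t \<le> s + \<eta> / 2"
    have "(1/2::real) ^ n \<le> (1/2) ^ N" using n by (intro power_decreasing) auto
    then have n2: "1 / 2 ^ n < \<eta> / 2" using N by (simp add: power_divide)
    have t0: "0 \<le> t" using st by simp
    have "low_at d u w n t \<le> low_at d u w n s + e'"
      unfolding low_at_def
    proof (rule discrete_regulator_increment)
      show "4 * e' \<le> u - d" "d \<le> u" using e' du by auto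
      show "w (real 0 / 2 ^ n) \<in> {d..u}" using w0 by simp
      show "grid_floor n s \<le> grid_floor n t" by (rule grid_floor_mono) fact
      fix j assume j: "grid_floor n s \<le> j" "j \<le> grid_floor n t"
      have "real (grid_floor n s) / 2 ^ n \<le> real j / 2 ^ n" "real j / 2 ^ n \<le> real (grid_floor n t) / 2 ^ n"
        using j by (auto intro!: divide_right_mono)
      then show "\<bar>w (real j / 2 ^ n) - w (real (grid_floor n s) / 2 ^ n)\<bar> \<le> e'"
        using \<eta>(2)[of "real (grid_floor n s) / 2 ^ n" "real j / 2 ^ n"]
          grid_floor_le[OF t0, of n] grid_floor_less[OF st(1), of n] st n2
        by (simp add: dist_real_def)
    qed
    then show "low_at d u w n t \<le> low_at d u w n s + e" using e' by simp
  qed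
qed

text \<open>\<open>[0, T]\<close> is cut into finitely many intervals on each of which the push is at most \<open>1\<close>.\<close>

lemma low_at_bounded:
  assumes T: "0 \<le> T" obtains C where "\<And>n. low_at d u w n T \<le> C"
proof -
  obtain \<eta> N where \<eta>: "\<eta> > 0" and
    incr: "\<And>n s t. n \<ge> N \<Longrightarrow> 0 \<le> s \<Longrightarrow> s \<le> t \<Longrightarrow> t \<le> T \<Longrightarrow> t \<le> s + \<eta> \<Longrightarrow> low_at d u w n t \<le> low_at d u w n s + 1"
    using low_at_equicontinuous[of 1 T] T by (metis zero_less_one)
  have b: "low_at d u w n (min T (real j * \<eta>)) \<le> real j" if "n \<ge> N" for n j
  proof (induction j)
    case 0 show ?case using T by (simp add: low_at_def grid_floor_def)
  next
    case (Suc j)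
    have "low_at d u w n (min T (real (Suc j) * \<eta>)) \<le> low_at d u w n (min T (real j * \<eta>)) + 1"
      using \<eta> T by (intro incr that) (auto simp: algebra_simps min_def)
    then show ?case using Suc by simp
  qed
  obtain j where "T / \<eta> \<le> real j" using real_arch_simple by blast
  then have "min T (real j * \<eta>) = T" using \<eta> by (simp add: field_simps min_def)
  with b[of _ j] have *: "low_at d u w n T \<le> real j" if "n \<ge> N" for n using that by simp
  have "low_at d u w n T \<le> real j" for n
    using *[of "max n N"] incseqD[OF low_at_incseq[OF T], of n "max n N"] by simp
  then show ?thesis using that by blast
qed

text \<open>The pushes and the level of the continuous-time regulator are obtained as limits of the discrete
  ones, so that continuity, complementarity and measurability can be read off from the approximations.\<close>

definition Low :: "real \<Rightarrow> real" where "Low t = (if t < 0 then 0 else lim (\<lambda>n. low_at d u w n t))"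
definition Upp :: "real \<Rightarrow> real" where "Upp t = (if t < 0 then 0 else lim (\<lambda>n. upp_at d u w n t))"
definition Lev :: "real \<Rightarrow> real" where "Lev t = (if t < 0 then 0 else w t + Low t - Upp t)"

lemma low_at_tendsto:
  assumes "0 \<le> t" shows "(\<lambda>n. low_at d u w n t) \<longlonglongrightarrow> Low t"
proof -
  obtain C where "\<And>n. low_at d u w n t \<le> C" using low_at_bounded[OF assms] by blast
  then obtain L where "(\<lambda>n. low_at d u w n t) \<longlonglongrightarrow> L"
    using incseq_convergent[OF low_at_incseq[OF assms]] by metis
  then show ?thesis using assms by (simp add: Low_def limI)
qed

end

lemma (in regulator_path) Upp_eq: "Upp = regulator_path.Low (- u) (- d) (\<lambda>s. - w s)"
  by (simp add: Upp_def regulator_path.Low_def[OF mirror] upp_at_mirror fun_eq_iff)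

lemma (in regulator_path) Low_eq: "Low = regulator_path.Upp (- u) (- d) (\<lambda>s. - w s)"
  using regulator_path.Upp_eq[OF mirror] by (simp add: Low_def regulator_path.Low_def)

context regulator_path begin

lemma upp_at_tendsto: "0 \<le> t \<Longrightarrow> (\<lambda>n. upp_at d u w n t) \<longlonglongrightarrow> Upp t"
  using regulator_path.low_at_tendsto[OF mirror, of t] by (simp add: Upp_eq upp_at_mirror)

lemma low_at_le_Low: "0 \<le> t \<Longrightarrow> low_at d u w n t \<le> Low t"
  using incseq_le[OF low_at_incseq low_at_tendsto] .

lemma upp_at_le_Upp: "0 \<le> t \<Longrightarrow> upp_at d u w n t \<le> Upp t"
  using regulator_path.low_at_le_Low[OF mirror, of t n] by (simp add: Upp_eq upp_at_mirror)

lemma Low_mono: "mono Low"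
proof (rule monoI)
  fix s t :: real assume "s \<le> t"
  have nn: "0 \<le> Low t" if "0 \<le> t" for t
    using low_at_le_Low[OF that, of 0] low_nonneg order_trans unfolding low_at_def by blast
  show "Low s \<le> Low t"
  proof (cases "0 \<le> s")
    case True
    show ?thesis
      by (rule LIMSEQ_le[OF low_at_tendsto low_at_tendsto]) (use True \<open>s \<le> t\<close> low_at_mono in auto)
  next
    case False
    then have "Low s = 0" by (simp add: Low_def)
    moreover have "0 \<le> Low t" using nn[of t] by (cases "t < 0") (auto simp: Low_def)
    ultimately show ?thesis by simp
  qed
qed

lemma Low_0: "Low 0 = 0"
  using LIMSEQ_unique[OF low_at_tendsto[of 0], of 0] by (simp add: low_at_def grid_floor_def)

lemma Low_increment:
  assumes e: "0 < e" and T: "0 \<le> T"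
  obtains \<eta> where "\<eta> > 0"
    "\<And>s t. 0 \<le> s \<Longrightarrow> s \<le> t \<Longrightarrow> t \<le> T \<Longrightarrow> t \<le> s + \<eta> \<Longrightarrow> Low t \<le> Low s + e"
proof -
  obtain \<eta> N where \<eta>: "\<eta> > 0" and
    incr: "\<And>n s t. n \<ge> N \<Longrightarrow> 0 \<le> s \<Longrightarrow> s \<le> t \<Longrightarrow> t \<le> T \<Longrightarrow> t \<le> s + \<eta> \<Longrightarrow> low_at d u w n t \<le> low_at d u w n s + e"
    using low_at_equicontinuous[OF e T] by metis
  show ?thesis
  proof (rule that[OF \<eta>])
    fix s t assume st: "0 \<le> s" "s \<le> t" "t \<le> T" "t \<le> s + \<eta>"
    show "Low t \<le> Low s + e"
    proof (rule LIMSEQ_le)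
      show "(\<lambda>n. low_at d u w n t) \<longlonglongrightarrow> Low t" using st by (intro low_at_tendsto) simp
      show "(\<lambda>n. low_at d u w n s + e) \<longlonglongrightarrow> Low s + e"
        using st by (intro tendsto_intros low_at_tendsto) simp
      show "\<exists>N. \<forall>n\<ge>N. low_at d u w n t \<le> low_at d u w n s + e" using incr st by blast
    qed
  qed
qed

lemma Low_cont: "continuous_on {0..} Low"
proof -
  have "isCont (\<lambda>t. Low (max 0 t)) t" for t
    unfolding continuous_at_eps_delta
  proof (intro allI impI)
    fix e :: real assume "0 < e"
    obtain \<eta> where \<eta>: "\<eta> > 0" and
      incr: "\<And>r s. 0 \<le> r \<Longrightarrow> r \<le> s \<Longrightarrow> s \<le> \<bar>t\<bar> + 1 \<Longrightarrow> s \<le> r + \<eta> \<Longrightarrow> Low s \<le> Low r + e / 2"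
      using Low_increment[of "e/2" "\<bar>t\<bar> + 1"] \<open>0 < e\<close> by auto
    have "dist (Low (max 0 s)) (Low (max 0 t)) < e" if "dist s t < min \<eta> 1" for s
    proof (cases "max 0 s \<le> max 0 t")
      case True
      have "Low (max 0 t) \<le> Low (max 0 s) + e / 2"
        using that True by (intro incr) (auto simp: dist_real_def)
      moreover have "Low (max 0 s) \<le> Low (max 0 t)" using monoD[OF Low_mono True] .
      ultimately show ?thesis using \<open>0 < e\<close> by (simp add: dist_real_def)
    next
      case False
      have "Low (max 0 s) \<le> Low (max 0 t) + e / 2"
        using that False by (intro incr) (auto simp: dist_real_def)
      moreover have "Low (max 0 t) \<le> Low (max 0 s)" using False by (intro monoD[OF Low_mono]) linarith
      ultimately show ?thesis using \<open>0 < e\<close> by (simp add: dist_real_def)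
    qed
    then show "\<exists>\<eta>>0. \<forall>s. dist s t < \<eta> \<longrightarrow> dist (Low (max 0 s)) (Low (max 0 t)) < e"
      using \<eta> by (intro exI[of _ "min \<eta> 1"]) auto
  qed
  then have "continuous_on {0..} (\<lambda>t. Low (max 0 t))"
    by (simp add: continuous_at_imp_continuous_on)
  then show ?thesis by (rule continuous_on_eq) (auto simp: max_def)
qed

lemma Upp_mono: "mono Upp" and Upp_0: "Upp 0 = 0" and Upp_cont: "continuous_on {0..} Upp"
  using regulator_path.Low_mono[OF mirror] regulator_path.Low_0[OF mirror]
    regulator_path.Low_cont[OF mirror] by (simp_all add: Upp_eq)

definition lev_at :: "nat \<Rightarrow> real \<Rightarrow> real" where
  "lev_at n t = w (real (grid_floor n t) / 2 ^ n) + low_at d u w n t - upp_at d u w n t"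

lemma lev_at_tendsto: assumes "0 \<le> t" shows "(\<lambda>n. lev_at n t) \<longlonglongrightarrow> Lev t"
proof -
  have "(\<lambda>n. w (real (grid_floor n t) / 2 ^ n)) \<longlonglongrightarrow> w t"
    by (rule continuous_on_tendsto_compose[OF wcont grid_floor_tendsto]) (use assms in auto)
  then have "(\<lambda>n. lev_at n t) \<longlonglongrightarrow> w t + Low t - Upp t" unfolding lev_at_def
    by (intro tendsto_intros low_at_tendsto upp_at_tendsto assms)
  then show ?thesis using assms by (simp add: Lev_def)
qed

lemma lev_at_range: "lev_at n t \<in> {d..u}"
  using discrete_regulator_tube[of d u "\<lambda>i. w (real i / 2 ^ n)" "grid_floor n t"] du w0
  by (simp add: lev_at_def low_at_def upp_at_def)

lemma Lev_range: assumes "0 \<le> t" shows "Lev t \<in> {d..u}"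
  using closed_sequentially[OF _ _ lev_at_tendsto[OF assms], of "{d..u}"] lev_at_range by auto

lemma Lev_cont: "continuous_on {0..} Lev"
proof -
  have "continuous_on {0..} (\<lambda>t. w t + Low t - Upp t)"
    by (intro continuous_intros wcont Low_cont Upp_cont)
  then show ?thesis by (rule continuous_on_eq) (auto simp: Lev_def)
qed

text \<open>If the level stays above \<open>d\<close> on the compact interval \<open>[s, t]\<close>, it stays above \<open>d + m\<close> for some
  \<open>m > 0\<close>. A value \<open>d - w r + upp r\<close> to which the discrete push could be raised is then at most
  \<open>Low t - m\<close>, so \<open>Low t \<le> max (Low s) (Low t - m)\<close>.\<close>

lemma Low_const:
  assumes st: "0 \<le> s" "s \<le> t" and z: "\<And>r. r \<in> {s..t} \<Longrightarrow> d < Lev r"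
  shows "Low t = Low s"
proof -
  obtain r0 where r0: "r0 \<in> {s..t}" "\<And>r. r \<in> {s..t} \<Longrightarrow> Lev r0 \<le> Lev r"
    using continuous_attains_inf[of "{s..t}" Lev] continuous_on_subset[OF Lev_cont] st by force
  define m where "m = Lev r0 - d"
  have m: "m > 0" using z[OF r0(1)] by (simp add: m_def)
  have "low_at d u w n t \<le> max (Low s) (Low t - m)" for n
    unfolding low_at_def
  proof (rule low_le_bound)
    show "grid_floor n s \<le> grid_floor n t" by (rule grid_floor_mono) fact
    show "low d u (\<lambda>i. w (real i / 2 ^ n)) (grid_floor n s) \<le> max (Low s) (Low t - m)"
      using low_at_le_Low[OF st(1), of n] by (simp add: low_at_def le_max_iff_disj)
    fix j assume j: "grid_floor n s < j" "j \<le> grid_floor n t"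
    let ?r = "real j / 2 ^ n"
    have gj: "grid_floor n ?r = j" by (simp add: grid_floor_def)
    have "real (grid_floor n s) / 2 ^ n + 1 / 2 ^ n \<le> ?r"
      using j by (simp add: add_divide_distrib[symmetric] divide_right_mono)
    moreover have "?r \<le> real (grid_floor n t) / 2 ^ n" using j by (simp add: divide_right_mono)
    ultimately have r: "s \<le> ?r" "?r \<le> t"
      using grid_floor_less[OF st(1), of n] grid_floor_le[of t n] st by linarith+
    have "upp d u (\<lambda>i. w (real i / 2 ^ n)) j \<le> Upp ?r"
      using upp_at_le_Upp[of ?r n] by (simp add: upp_at_def gj)
    moreover have "w ?r + Low ?r - Upp ?r \<ge> m + d"
      using r0(2)[of ?r] r st by (simp add: m_def Lev_def)
    moreover have "Low ?r \<le> Low t" using monoD[OF Low_mono r(2)] .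
    ultimately show "d - w ?r + upp d u (\<lambda>i. w (real i / 2 ^ n)) j \<le> max (Low s) (Low t - m)"
      by linarith
  qed
  then have "Low t \<le> max (Low s) (Low t - m)"
    by (intro LIMSEQ_le_const2[OF low_at_tendsto]) (use st in auto)
  then have "Low t \<le> Low s" using m by auto
  then show ?thesis using monoD[OF Low_mono st(2)] by simp
qed

end

section \<open>Complementarity and uniqueness of the regulator\<close>

lemma rcll_mono_right_cont:
  assumes "rcll y" "\<forall>t<0. y t = 0"
  shows "continuous (at_right a) (y :: real \<Rightarrow> real)"
proof (cases "a < 0")
  case True
  have "(y \<longlongrightarrow> 0) (at_right a)"
  proof (rule Lim_transform_eventually[OF tendsto_const])
    show "\<forall>\<^sub>F x in at_right a. 0 = y x"
      using assms(2) eventually_at_right_less[of a] True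
      by (intro eventually_at_rightI[of a 0]) auto
  qed
  then show ?thesis using assms(2) True by (simp add: continuous_within)
qed (use assms in \<open>auto simp: rcll_def\<close>)

lemma continuous_on_imp_rcll:
  assumes "continuous_on {0..} f" shows "rcll (f :: real \<Rightarrow> real)"
  unfolding rcll_def
proof (intro conjI allI impI)
  fix t :: real assume "0 \<le> t"
  then have "continuous (at t within {0..}) f" using assms by (simp add: continuous_on_eq_continuous_within)
  then show "continuous (at_right t) f" by (rule continuous_within_subset) (use \<open>0 \<le> t\<close> in auto)
next
  fix t :: real assume "0 < t"
  then have "isCont f t"
    by (intro continuous_on_interior[OF assms]) (simp add: interior_real_atLeast)
  then have "(f \<longlongrightarrow> f t) (at_left t)" by (metis continuous_at_imp_continuous_at_within continuous_within)
  then show "\<exists>L. (f \<longlongrightarrow> L) (at_left t)" ..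
qed

text \<open>A jump of \<open>y\<close> at \<open>s\<close> would be an atom of its Stieltjes measure.\<close>

lemma emeasure_interval_measure_left_jump:
  assumes mono: "mono y" and rc: "\<And>a. continuous (at_right a) (y :: real \<Rightarrow> real)"
    and z: "emeasure (interval_measure y) {s} = 0"
  shows "(y \<longlongrightarrow> y s) (at_left s)"
proof (rule tendsto_at_left_sequentially)
  show "s - 1 < s" by simp
  fix X assume X: "\<And>n. X n < s" "incseq X" "X \<longlonglongrightarrow> s"
  let ?F = "interval_measure y"
  have eq: "emeasure ?F {X n<..s} = ennreal (y s - y (X n))" for n
    using X(1)[of n] by (intro emeasure_interval_measure_Ioc rc) (auto dest: monoD[OF mono])
  have "(\<lambda>n. emeasure ?F {X n<..s}) \<longlonglongrightarrow> emeasure ?F (\<Inter>n. {X n <..s})"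
  proof (rule Lim_emeasure_decseq)
    show "decseq (\<lambda>n. {X n<..s})"
      unfolding decseq_def using incseqD[OF X(2)] by (metis greaterThanAtMost_iff order_le_less_trans subsetI)
  qed (auto simp: eq)
  also have "(\<Inter>n. {X n <..s}) = {s}"
  proof -
    have "X n < r" if "s \<le> r" for n r using X(1)[of n] that by simp
    moreover have "r = s" if "\<And>n. X n < r" "r \<le> s" for r
      using LIMSEQ_le_const2[OF X(3), of r] that by (meson order_antisym less_imp_le)
    ultimately show ?thesis by auto
  qed
  finally have "(\<lambda>n. ennreal (y s - y (X n))) \<longlonglongrightarrow> ennreal 0" using z by (simp add: eq)
  then have "(\<lambda>n. y s - y (X n)) \<longlonglongrightarrow> 0"
    by (subst (asm) tendsto_ennreal_iff) (auto simp: monoD[OF mono less_imp_le[OF X(1)]])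
  then have "(\<lambda>n. y s - (y s - y (X n))) \<longlonglongrightarrow> y s - 0" by (intro tendsto_intros)
  then show "(\<lambda>n. y (X n)) \<longlonglongrightarrow> y s" by simp
qed


lemma null_measure_of_nn_integral:
  fixes z y :: "real \<Rightarrow> real"
  assumes z: "(\<lambda>t. indicator {0..} t * z t) \<in> borel_measurable borel"
    and 0: "(\<integral>\<^sup>+t\<in>{0..}. ennreal (z t) \<partial>interval_measure y) = 0"
    and A: "A \<in> sets borel" "\<And>t. t \<in> A \<Longrightarrow> 0 \<le> t \<and> 0 < z t"
  shows "emeasure (interval_measure y) A = 0"
proof -
  have eq: "(\<lambda>t. ennreal (z t) * indicator {0..} t) = (\<lambda>t. ennreal (indicator {0..} t * z t))"
    by (auto simp: indicator_def)
  have "AE t in interval_measure y. ennreal (indicator {0..} t * z t) = 0"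
    using 0 z by (subst nn_integral_0_iff_AE[symmetric]) (simp_all add: eq)
  then have "AE t in interval_measure y. t \<notin> A"
  proof (rule eventually_mono)
    fix t assume "ennreal (indicator {0..} t * z t) = 0"
    then show "t \<notin> A" using A(2)[of t] by (auto simp: ennreal_eq_0_iff)
  qed
  then show ?thesis by (subst AE_iff_measurable[symmetric, of A _ "\<lambda>t. t \<notin> A"]) (use A in auto)
qed

text \<open>\<open>y\<close> increases only at times at which the gap \<open>z\<close> is zero. The lower control is complementary to
  the gap above \<open>d\<close>, and the upper control to the gap below \<open>u\<close>. A regulator among general
  right-continuous triples may jump, so intervals and single points are treated separately.\<close>

locale complementary =
  fixes y z :: "real \<Rightarrow> real"
  assumes y_mono: "mono y" and y_rcll: "rcll y" and y_neg: "\<And>t. t < 0 \<Longrightarrow> y t = 0"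
    and z_rcll: "rcll z"
    and z_meas: "(\<lambda>t. indicator {0..} t * z t) \<in> borel_measurable borel"
    and compl: "(\<integral>\<^sup>+t\<in>{0..}. ennreal (z t) \<partial>interval_measure y) = 0"
begin

lemma right_cont: "continuous (at_right a) y"
  using rcll_mono_right_cont[OF y_rcll] y_neg by blast

lemma const:
  assumes "0 \<le> s" "s \<le> t" "\<And>r. s < r \<Longrightarrow> r \<le> t \<Longrightarrow> 0 < z r"
  shows "y t = y s"
proof -
  have "emeasure (interval_measure y) {s<..t} = 0"
    by (rule null_measure_of_nn_integral[OF z_meas compl]) (use assms in auto)
  then have "ennreal (y t - y s) = 0"
    using emeasure_interval_measure_Ioc[of s t y] assms(2) right_cont by (simp add: monoD[OF y_mono])
  then show ?thesis using monoD[OF y_mono assms(2)] by (simp add: ennreal_eq_0_iff)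
qed

lemma no_jump:
  assumes "0 \<le> s" "0 < z s"
  shows "(y \<longlongrightarrow> y s) (at_left s)"
  by (intro emeasure_interval_measure_left_jump y_mono right_cont
        null_measure_of_nn_integral[OF z_meas compl]) (use assms in auto)

lemma const_right:
  assumes "0 \<le> s" "0 < z s"
  shows "\<forall>\<^sub>F t in at_right s. y t = y s"
proof -
  have "(z \<longlongrightarrow> z s) (at_right s)" using z_rcll assms by (auto simp: rcll_def continuous_within)
  then have "\<forall>\<^sub>F t in at_right s. 0 < z t" using assms(2) by (rule order_tendstoD)
  then obtain b where b: "b > s" "\<And>t. s < t \<Longrightarrow> t < b \<Longrightarrow> 0 < z t"
    by (auto simp: eventually_at_right_field)
  have "y t = y s" if "s < t" "t < b" for t using that b assms by (intro const) auto
  then show ?thesis using b by (auto simp: eventually_at_right_field)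
qed

end

text \<open>Suppose \<open>z t > z' t\<close>, and let \<open>s\<close> be the supremum of the earlier times at which \<open>z \<le> z'\<close>. After
  \<open>s\<close> one has \<open>z > z' \<ge> d\<close> and \<open>z' < z \<le> u\<close>, so neither \<open>y1\<close> nor \<open>y2'\<close> moves and \<open>z - z'\<close> cannot
  increase. Thus already \<open>z s > z' s\<close>, and for the same reason \<open>z - z'\<close> cannot have become positive
  by a jump at \<open>s\<close>.\<close>

lemma regulator_level_unique_aux:
  assumes A: "complementary y1 (\<lambda>t. z t - d)" and B: "complementary y2' (\<lambda>t. u - z' t)"
    and mono: "mono y1'" "mono y2"
    and eq: "\<And>t. 0 \<le> t \<Longrightarrow> z t - z' t = (y1 t - y2 t) - (y1' t - y2' t)"
    and r: "\<And>t. 0 \<le> t \<Longrightarrow> z t \<in> {d..u}" "\<And>t. 0 \<le> t \<Longrightarrow> z' t \<in> {d..u}"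
    and 0: "z 0 \<le> z' 0" and t: "0 \<le> t"
  shows "z t \<le> z' t"
proof (rule ccontr)
  interpret A: complementary y1 "\<lambda>t. z t - d" by fact
  interpret B: complementary y2' "\<lambda>t. u - z' t" by fact
  assume c: "\<not> z t \<le> z' t"
  define S where "S = {r. 0 \<le> r \<and> r \<le> t \<and> z r \<le> z' r}"
  define s where "s = Sup S"
  have S: "0 \<in> S" "bdd_above S" using 0 t by (auto simp: S_def intro!: bdd_aboveI[of _ t])
  have s: "0 \<le> s" using cSup_upper[OF S] by (simp add: s_def)
  have "Sup S \<le> t" by (rule cSup_least) (use S in \<open>auto simp: S_def\<close>)
  then have "s \<le> t" by (simp add: s_def)
  note s = s this
  have after: "z' r < z r" if "s < r" "r \<le> t" for r
  proof (rule ccontr)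
    assume "\<not> z' r < z r"
    then have "r \<in> S" using that s by (simp add: S_def)
    then show False using cSup_upper[OF _ S(2)] that(1) by (fastforce simp: s_def)
  qed
  have gap: "0 < z r - d" "0 < u - z' r" if "s < r" "r \<le> t" for r
    using after[OF that] r[of r] that s by auto
  have st: "y1 t = y1 s" "y2' t = y2' s"
    by (rule A.const[OF s gap(1)] B.const[OF s gap(2)]; assumption)+
  moreover have "y1' s \<le> y1' t" "y2 s \<le> y2 t"
    using monoD[OF mono(1) s(2)] monoD[OF mono(2) s(2)] by simp_all
  ultimately have "z t - z' t \<le> z s - z' s" using eq[of t] eq[of s] s t by simp
  then have sp: "z' s < z s" using c by simp
  have szd: "0 < z s - d" "0 < u - z' s" using sp r[of s] s by auto
  have "((\<lambda>r. y1 r + y2' r) \<longlongrightarrow> y1 s + y2' s) (at_left s)"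
    by (intro tendsto_intros A.no_jump B.no_jump) (use s szd in auto)
  then have "\<forall>\<^sub>F r in at_left s. y1 s + y2' s - (z s - z' s) < y1 r + y2' r"
    using sp by (intro order_tendstoD) auto
  then obtain b where b: "b < s" "\<And>r. b < r \<Longrightarrow> r < s \<Longrightarrow> y1 s + y2' s - (z s - z' s) < y1 r + y2' r"
    by (auto simp: eventually_at_left_field)
  obtain r where "r \<in> S" "b < r" using less_cSup_iff[of S b] b(1) S by (auto simp: s_def)
  moreover have "r \<le> s" using cSup_upper[OF \<open>r \<in> S\<close> S(2)] by (simp add: s_def)
  ultimately have rs: "0 \<le> r" "z r \<le> z' r" "b < r" "r < s" using sp by (auto simp: S_def less_le)
  have "y1' r \<le> y1' s" "y2 r \<le> y2 s"
    using monoD[OF mono(1), of r s] monoD[OF mono(2), of r s] rs(4) by simp_all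
  then show False using b(2)[OF rs(3,4)] eq[of r] eq[of s] rs s(1) by simp
qed

text \<open>Let \<open>D = y1 - y1' = y2 - y2'\<close>, and let \<open>s\<close> be the infimum of the times at which \<open>D\<close> is nonzero. If
  \<open>z s > d\<close>, then \<open>y1\<close> and \<open>y1'\<close> do not jump at \<open>s\<close> and stay constant for a while after \<open>s\<close>; if
  \<open>z s < u\<close>, the same holds for \<open>y2\<close> and \<open>y2'\<close>. In both cases \<open>D\<close> still vanishes on an interval to
  the right of \<open>s\<close>.\<close>

lemma regulator_control_unique_aux:
  assumes A: "complementary y1 (\<lambda>t. z t - d)" "complementary y1' (\<lambda>t. z t - d)"
    and B: "complementary y2 (\<lambda>t. u - z t)" "complementary y2' (\<lambda>t. u - z t)"
    and eq: "\<And>t. 0 \<le> t \<Longrightarrow> y1 t - y2 t = y1' t - y2' t"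
    and 0: "y1 0 = y1' 0" and t: "0 \<le> t" and du: "d < u"
  shows "y1 t = y1' t"
proof (rule ccontr)
  interpret A: complementary y1 "\<lambda>t. z t - d" by fact
  interpret A': complementary y1' "\<lambda>t. z t - d" by fact
  interpret B: complementary y2 "\<lambda>t. u - z t" by fact
  interpret B': complementary y2' "\<lambda>t. u - z t" by fact
  define D where "D t = y1 t - y1' t" for t
  have D2: "D t = y2 t - y2' t" if "0 \<le> t" for t using eq[OF that] by (simp add: D_def)
  assume "y1 t \<noteq> y1' t"
  define S where "S = {r. 0 \<le> r \<and> D r \<noteq> 0}"
  define s where "s = Inf S"
  have S: "t \<in> S" "bdd_below S" using t \<open>y1 t \<noteq> y1' t\<close> by (auto simp: S_def D_def intro!: bdd_belowI[of _ 0])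
  have "0 \<le> Inf S" by (rule cInf_greatest) (use S in \<open>auto simp: S_def\<close>)
  then have s: "0 \<le> s" by (simp add: s_def)
  have before: "D r = 0" if "0 \<le> r" "r < s" for r
  proof (rule ccontr)
    assume "D r \<noteq> 0"
    then have "r \<in> S" using that by (simp add: S_def)
    then show False using cInf_lower[OF _ S(2)] that(2) by (fastforce simp: s_def)
  qed
  have zs: "0 < z s - d \<or> 0 < u - z s" using du by auto
  have Ds: "D s = 0"
  proof (cases "s = 0")
    case True then show ?thesis using 0 by (simp add: D_def)
  next
    case False
    have ev: "\<forall>\<^sub>F r in at_left s. 0 \<le> r \<and> r < s"
      using False s by (intro eventually_at_leftI[of 0]) auto
    have "(D \<longlongrightarrow> D s) (at_left s)" using zs
    proof
      assume "0 < z s - d"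
      then show ?thesis unfolding D_def using s by (intro tendsto_intros A.no_jump A'.no_jump)
    next
      assume "0 < u - z s"
      then have "((\<lambda>r. y2 r - y2' r) \<longlongrightarrow> y2 s - y2' s) (at_left s)"
        using s by (intro tendsto_intros B.no_jump B'.no_jump)
      then show ?thesis unfolding D2[OF s]
        by (rule Lim_transform_eventually) (use ev in eventually_elim, simp add: D2)
    qed
    moreover have "(D \<longlongrightarrow> 0) (at_left s)"
      by (rule Lim_transform_eventually[OF tendsto_const]) (use ev in eventually_elim, simp add: before)
    ultimately show ?thesis by (rule tendsto_unique[rotated]) simp
  qed
  have "\<forall>\<^sub>F r in at_right s. D r = D s" using zs
  proof
    assume "0 < z s - d"
    then show ?thesis using A.const_right[OF s] A'.const_right[OF s]
      by (auto elim: eventually_elim2 simp: D_def)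
  next
    assume "0 < u - z s"
    then have "\<forall>\<^sub>F r in at_right s. y2 r - y2' r = y2 s - y2' s"
      using B.const_right[OF s] B'.const_right[OF s] by (auto elim: eventually_elim2)
    with eventually_at_right_less[of s] show ?thesis
      by eventually_elim (use s in \<open>simp add: D2\<close>)
  qed
  then obtain b where b: "b > s" "\<And>r. s < r \<Longrightarrow> r < b \<Longrightarrow> D r = 0"
    using Ds by (auto simp: eventually_at_right_field)
  obtain r where "r \<in> S" "r < b" using cInf_less_iff[of S b] b(1) S by (auto simp: s_def)
  moreover have "s \<le> r" using cInf_lower[OF \<open>r \<in> S\<close> S(2)] by (simp add: s_def)
  ultimately show False using b(2)[of r] Ds by (cases "s = r") (auto simp: S_def)
qed

lemma rcll_affine:
  assumes "rcll f" shows "rcll (\<lambda>t. c * f t + b)"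
  unfolding rcll_def
proof (intro conjI allI impI)
  fix t :: real assume "0 < t"
  then obtain L where "(f \<longlongrightarrow> L) (at_left t)" using assms by (auto simp: rcll_def)
  then have "((\<lambda>t. c * f t + b) \<longlongrightarrow> c * L + b) (at_left t)" by (intro tendsto_intros)
  then show "\<exists>L. ((\<lambda>t. c * f t + b) \<longlongrightarrow> L) (at_left t)" ..
next
  fix t :: real assume "0 \<le> t"
  then show "continuous (at_right t) (\<lambda>t. c * f t + b)"
    using assms by (intro continuous_intros) (auto simp: rcll_def)
qed

lemma two_sided_regulator_complementary:
  assumes "continuous_on {0..} w" "two_sided_regulator d u w y1 y2 z"
  shows "complementary y1 (\<lambda>t. z t - d)" "complementary y2 (\<lambda>t. u - z t)"
proof -
  note R = assms(2)[unfolded two_sided_regulator_def]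
  have y: "y1 \<in> borel_measurable borel" "y2 \<in> borel_measurable borel"
    using R by (auto intro: borel_measurable_mono)
  have w: "(\<lambda>t. indicator {0..} t * w t) \<in> borel_measurable borel"
    using borel_measurable_continuous_on_indicator[OF _ assms(1)] by simp
  have e1: "(\<lambda>t. indicator {0..} t * (z t - d)) =
      (\<lambda>t. indicator {0..} t * w t + indicator {0..} t * (y1 t - y2 t - d))"
    and e2: "(\<lambda>t. indicator {0..} t * (u - z t)) =
      (\<lambda>t. indicator {0..} t * (u - y1 t + y2 t) - indicator {0..} t * w t)"
    using R by (auto simp: indicator_def fun_eq_iff)
  have m: "(\<lambda>t. indicator {0..} t * (z t - d)) \<in> borel_measurable borel"
    "(\<lambda>t. indicator {0..} t * (u - z t)) \<in> borel_measurable borel"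
    unfolding e1 e2 using w y by measurable
  have "rcll z" using R by simp
  have "rcll (\<lambda>t. z t - d)" "rcll (\<lambda>t. u - z t)"
    using rcll_affine[OF \<open>rcll z\<close>, of 1 "- d"] rcll_affine[OF \<open>rcll z\<close>, of "-1" u] by simp_all
  then show "complementary y1 (\<lambda>t. z t - d)" "complementary y2 (\<lambda>t. u - z t)"
    using R m by (auto simp: complementary_def)
qed

lemma two_sided_regulator_unique:
  assumes w: "continuous_on {0..} w" and du: "d < u"
    and R: "two_sided_regulator d u w y1 y2 z" and R': "two_sided_regulator d u w y1' y2' z'"
  shows "y1 = y1' \<and> y2 = y2' \<and> z = z'"
proof -
  note C = two_sided_regulator_complementary[OF w R] two_sided_regulator_complementary[OF w R']
  have m: "mono y1" "mono y2" "mono y1'" "mono y2'"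
    using R R' by (simp_all add: two_sided_regulator_def)
  have zero: "y1 0 = 0" "y2 0 = 0" "y1' 0 = 0" "y2' 0 = 0"
    using R R' by (simp_all add: two_sided_regulator_def)
  have neg: "y1 t = 0 \<and> y2 t = 0 \<and> z t = 0 \<and> y1' t = 0 \<and> y2' t = 0 \<and> z' t = 0" if "t < 0" for t
    using R R' that unfolding two_sided_regulator_def by blast
  have range: "z t \<in> {d..u}" "z' t \<in> {d..u}" if "0 \<le> t" for t
    using R R' that unfolding two_sided_regulator_def by blast+
  have bal: "z t = w t + y1 t - y2 t" "z' t = w t + y1' t - y2' t" if "0 \<le> t" for t
    using R R' that unfolding two_sided_regulator_def by blast+
  have z0: "z 0 = z' 0" using bal[of 0] zero by simp
  have diff: "z t - z' t = (y1 t - y2 t) - (y1' t - y2' t)"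
    "z' t - z t = (y1' t - y2' t) - (y1 t - y2 t)" if "0 \<le> t" for t
    using bal[OF that] by simp_all
  have zz: "z t = z' t" if t: "0 \<le> t" for t
  proof (rule antisym)
    show "z t \<le> z' t"
      by (rule regulator_level_unique_aux[OF C(1,4) m(3,2) diff(1) range _ t]) (simp_all add: z0)
    show "z' t \<le> z t"
      by (rule regulator_level_unique_aux[OF C(3,2) m(1,4) diff(2) range(2,1) _ t]) (simp_all add: z0)
  qed
  have z: "z = z'"
  proof
    fix t show "z t = z' t" using zz[of t] neg[of t] by (cases "t < 0") auto
  qed
  have eq: "y1 t - y2 t = y1' t - y2' t" if "0 \<le> t" for t
    using diff(1)[OF that] zz[OF that] by simp
  have y1: "y1 t = y1' t" if t: "0 \<le> t" for t
    by (rule regulator_control_unique_aux[OF C(1) C(3)[folded z] C(2) C(4)[folded z] eq _ t du])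
      (simp_all add: zero)
  have "y1 = y1'" "y2 = y2'"
  proof (safe intro!: ext)
    fix t
    show "y1 t = y1' t" using y1[of t] neg[of t] by (cases "t < 0") auto
    show "y2 t = y2' t" using y1[of t] eq[of t] neg[of t] by (cases "t < 0") auto
  qed
  with z show ?thesis by simp
qed

context regulator_path begin

text \<open>The times at which the continuous level exceeds \<open>d\<close> are covered by countably many intervals with
  rational endpoints on which \<open>Low\<close> is constant.\<close>

lemma Low_complementary:
  "(\<integral>\<^sup>+t\<in>{0..}. ennreal (Lev t - d) \<partial>interval_measure Low) = 0"
proof -
  have rc: "continuous (at_right a) Low" for a
    by (rule rcll_mono_right_cont[OF continuous_on_imp_rcll[OF Low_cont]]) (simp add: Low_def)
  define Q where "Q = {(p, q) \<in> \<rat> \<times> \<rat>. 0 \<le> p \<and> p \<le> q \<and> (\<forall>r\<in>{p..q}. d < Lev r)}"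
  have "countable Q" unfolding Q_def by (rule countable_subset[of _ "\<rat> \<times> \<rat>"]) (auto simp: countable_rat)
  have N: "(\<Union>(p, q)\<in>Q. {p<..q}) \<in> null_sets (interval_measure Low)"
  proof (rule null_sets_UN'[OF \<open>countable Q\<close>])
    fix i assume "i \<in> Q"
    then obtain p q where i: "i = (p, q)" "0 \<le> p" "p \<le> q" "\<forall>r\<in>{p..q}. d < Lev r" by (auto simp: Q_def)
    then have "emeasure (interval_measure Low) {p<..q} = 0"
      using Low_const[of p q] by (subst emeasure_interval_measure_Ioc) (auto intro: rc monoD[OF Low_mono])
    then show "(case i of (p, q) \<Rightarrow> {p<..q}) \<in> null_sets (interval_measure Low)"
      using i by (auto simp: null_sets_def)
  qed
  have Z: "{-1<..0} \<in> null_sets (interval_measure Low)"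
    using Low_0 Low_def[of "-1"] emeasure_interval_measure_Ioc[OF _ monoD[OF Low_mono] rc, of "-1" 0]
    by (simp add: null_sets_def)
  have "AE t in interval_measure Low. t \<notin> (\<Union>(p, q)\<in>Q. {p<..q}) \<union> {-1<..0}"
    by (intro AE_not_in null_sets.Un N Z)
  then have "AE t in interval_measure Low. ennreal (Lev t - d) * indicator {0..} t = 0"
  proof eventually_elim
    case (elim t)
    have "Lev t \<le> d" if t: "0 < t"
    proof (rule ccontr)
      assume "\<not> Lev t \<le> d"
      then have "d < Lev t" by simp
      have "(Lev \<longlongrightarrow> Lev t) (at t)"
        using continuous_on_interior[OF Lev_cont, of t] t by (simp add: interior_real_atLeast isCont_def)
      then have "\<forall>\<^sub>F r in at t. d < Lev r" using \<open>d < Lev t\<close> by (rule order_tendstoD)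
      then obtain e where e: "e > 0" "\<And>r. dist r t < e \<Longrightarrow> d < Lev r"
        using \<open>d < Lev t\<close> by (auto simp: eventually_at) metis
      obtain p where p: "p \<in> \<rat>" "max 0 (t - e) < p" "p < t" using Rats_dense_in_real[of "max 0 (t - e)" t] t e by auto
      obtain q where q: "q \<in> \<rat>" "t < q" "q < t + e" using Rats_dense_in_real[of t "t + e"] t e by auto
      have "(p, q) \<in> Q" using p q e by (auto simp: Q_def dist_real_def)
      then show False using elim p q by auto
    qed
    then show ?case using elim by (auto simp: indicator_def ennreal_neg)
  qed
  then show ?thesis
    by (subst nn_integral_cong_AE[of _ "\<lambda>_. 0"]) auto
qed

lemma Upp_complementary:
  "(\<integral>\<^sup>+t\<in>{0..}. ennreal (u - Lev t) \<partial>interval_measure Upp) = 0"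
proof -
  have "regulator_path.Lev (- u) (- d) (\<lambda>s. - w s) t = - Lev t" for t
    by (simp add: regulator_path.Lev_def[OF mirror] Lev_def Upp_eq[symmetric] Low_eq[symmetric])
  then show ?thesis using regulator_path.Low_complementary[OF mirror] by (simp add: Upp_eq[symmetric])
qed

lemma two_sided_regulator_exists: "two_sided_regulator d u w Low Upp Lev"
  unfolding two_sided_regulator_def
proof (intro conjI allI impI)
  fix t :: real
  show "Lev t = w t + Low t - Upp t" if "0 \<le> t" using that by (simp add: Lev_def)
  show "Low t = 0" "Upp t = 0" "Lev t = 0" if "t < 0"
    using that by (simp_all add: Low_def Upp_def Lev_def)
qed (fact Low_complementary Upp_complementary Low_mono Upp_mono Low_0 Upp_0
    | erule Lev_range | rule continuous_on_imp_rcll[OF Low_cont] continuous_on_imp_rcll[OF Upp_cont] continuous_on_imp_rcll[OF Lev_cont])+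

lemma regulator_map_eq: "regulator_map d u w = (Low, Upp, Lev)"
  unfolding regulator_map_def
proof (rule the_equality)
  show "case (Low, Upp, Lev) of (y1, y2, z) \<Rightarrow> two_sided_regulator d u w y1 y2 z"
    unfolding prod.case by (rule two_sided_regulator_exists)
  fix p assume p: "case p of (y1, y2, z) \<Rightarrow> two_sided_regulator d u w y1 y2 z"
  obtain y1 y2 z where y: "p = (y1, y2, z)" by (rule prod_cases3)
  have "two_sided_regulator d u w y1 y2 z" using p unfolding y by simp
  from two_sided_regulator_unique[OF wcont du this two_sided_regulator_exists]
  show "p = (Low, Upp, Lev)" unfolding y by simp
qed

lemma \<Psi>_eq: "\<Psi>1 d u w = Low" "\<Psi>2 d u w = Upp"
  by (simp_all add: \<Psi>1_def \<Psi>2_def regulator_map_eq)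

end

section \<open>The relative value function\<close>

definition clamp_to :: "real \<Rightarrow> real \<Rightarrow> real \<Rightarrow> real" where
  "clamp_to d u x = max d (min u x)"

lemma clamp_to_simps:
  "d \<le> u \<Longrightarrow> x \<in> {d..u} \<Longrightarrow> clamp_to d u x = x"
  "d \<le> u \<Longrightarrow> x \<le> d \<Longrightarrow> clamp_to d u x = d"
  "d \<le> u \<Longrightarrow> u \<le> x \<Longrightarrow> clamp_to d u x = u"
  "d \<le> u \<Longrightarrow> clamp_to d u x \<in> {d..u}"
  by (auto simp: clamp_to_def)

lemma clamp_to_lipschitz: "\<bar>clamp_to d u x - clamp_to d u y\<bar> \<le> \<bar>x - y\<bar>"
  by (auto simp: clamp_to_def max_def min_def)

text \<open>The optimality equations solved by the relative value function \<open>V\<close>, with derivatives \<open>V1\<close> and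
  \<open>V2\<close>, and by the optimal average cost \<open>\<gamma>\<close>. The constant \<open>L\<close> controls the Taylor remainder, and
  \<open>K\<close> says that \<open>V\<close> grows at most as fast as the holding cost.\<close>

locale relative_value =
  fixes \<mu> \<sigma> k l d u \<gamma> :: real and h V V1 V2 :: "real \<Rightarrow> real" and L K :: real
  assumes pos: "0 < \<mu>" "0 < \<sigma>" "0 < k" "0 < l" "0 < \<gamma>" "0 < K"
    and du: "d < u"
    and V_deriv: "\<And>x. (V has_real_derivative V1 x) (at x)"
    and V1_deriv: "\<And>x. (V1 has_real_derivative V2 x) (at x)"
    and V2_lipschitz: "\<And>x y. \<bar>V2 x - V2 y\<bar> \<le> L * \<bar>x - y\<bar>"
    and V1_outside: "\<And>x. x \<le> d \<Longrightarrow> V1 x = - k" "\<And>x. u \<le> x \<Longrightarrow> V1 x = l"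
    and V1_bounds: "\<And>x. - k \<le> V1 x" "\<And>x. V1 x \<le> l"
    and generator: "\<And>x. \<sigma>\<^sup>2 / 2 * V2 x + \<mu> * V1 x + h (clamp_to d u x) = \<gamma>"
    and h_cont: "continuous_on UNIV h" and h_nonneg: "\<And>x. 0 \<le> h x"
    and h_clamp: "\<And>x. h (clamp_to d u x) \<le> h x"
    and V_growth: "\<And>x. V x \<le> K * (1 + h x)"

lemma interval_integral_has_derivative:
  fixes f :: "real \<Rightarrow> real"
  assumes "continuous_on UNIV f"
  shows "((\<lambda>x. LBINT y=ereal a..ereal x. f y) has_real_derivative f x) (at x)"
proof -
  let ?l = "min a x - 1" and ?r = "max a x + 1"
  have "((\<lambda>x. LBINT y=ereal a..ereal x. f y) has_vector_derivative f x) (at x within {?l..?r})"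
    by (rule interval_integral_FTC2) (auto intro: continuous_on_subset[OF assms])
  then have "((\<lambda>x. LBINT y=ereal a..ereal x. f y) has_vector_derivative f x) (at x within {?l<..<?r})"
    by (rule has_vector_derivative_within_subset) auto
  moreover have "at x within {?l<..<?r} = at x" by (rule at_within_open) auto
  ultimately show ?thesis unfolding has_real_derivative_iff_has_vector_derivative by metis
qed

lemma DERIV_compose_contraction_zero:
  fixes g c :: "real \<Rightarrow> real"
  assumes g: "(g has_real_derivative 0) (at (c x))" and c: "\<And>y. \<bar>c y - c x\<bar> \<le> \<bar>y - x\<bar>"
  shows "((\<lambda>x. g (c x)) has_real_derivative 0) (at x)"
proof -
  have "\<forall>e>0. \<exists>\<delta>>0. \<forall>y. \<bar>y - c x\<bar> < \<delta> \<longrightarrow> \<bar>g y - g (c x)\<bar> \<le> e * \<bar>y - c x\<bar>"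
    using g by (simp add: has_field_derivative_def has_derivative_at_alt)
  then have "\<forall>e>0. \<exists>\<delta>>0. \<forall>y. \<bar>y - x\<bar> < \<delta> \<longrightarrow> \<bar>g (c y) - g (c x)\<bar> \<le> e * \<bar>y - x\<bar>"
    by (meson c le_less_trans mult_left_mono order_trans less_imp_le)
  moreover have "bounded_linear ((*) (0::real))" by (rule bounded_linear_mult_right)
  ultimately show ?thesis
    unfolding has_field_derivative_def has_derivative_at_alt by (intro conjI) simp_all
qed

text \<open>At \<open>d\<close> and \<open>u\<close>, where the projection is not differentiable, it is a contraction, and composing a
  function of vanishing derivative with a contraction gives vanishing derivative.\<close>

lemma DERIV_compose_clamp:
  assumes g: "\<And>x. (g has_real_derivative g' x) (at x)" and z: "g' d = 0" "g' u = 0" and du: "d < u"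
  shows "((\<lambda>x. g (clamp_to d u x)) has_real_derivative g' (clamp_to d u x)) (at x)"
proof (cases "x \<in> {d<..<u}")
  case True
  have "((\<lambda>x. g (clamp_to d u x)) has_real_derivative g' x) (at x)"
  proof (rule has_field_derivative_transform_within_open[OF g, where S = "{d<..<u}"])
    show "\<And>y. y \<in> {d<..<u} \<Longrightarrow> g y = g (clamp_to d u y)" by (simp add: clamp_to_def)
  qed (use True in auto)
  then show ?thesis using True by (simp add: clamp_to_def)
next
  case False
  then have "clamp_to d u x = d \<or> clamp_to d u x = u" using du by (auto simp: clamp_to_def)
  then have 0: "g' (clamp_to d u x) = 0" using z by auto
  show ?thesis unfolding 0
    by (rule DERIV_compose_contraction_zero) (use g[of "clamp_to d u x"] 0 clamp_to_lipschitz in auto)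
qed

text \<open>The slopes of a convex function inside \<open>[d, u]\<close> lie between its slopes over \<open>[d - 1, d]\<close> and over
  \<open>[u, u + 1]\<close>.\<close>

lemma convex_on_lipschitz_interval:
  fixes h :: "real \<Rightarrow> real"
  assumes h: "convex_on UNIV h"
  obtains C where "C \<ge> 0" "\<And>x y. x \<in> {d..u} \<Longrightarrow> y \<in> {d..u} \<Longrightarrow> \<bar>h x - h y\<bar> \<le> C * \<bar>x - y\<bar>"
proof -
  define C where "C = \<bar>h (u + 1) - h u\<bar> + \<bar>h d - h (d - 1)\<bar>"
  have slope: "(f1 - f2) / (a - b) = (f2 - f1) / (b - a)" for a b f1 f2 :: real
    by (metis minus_diff_eq minus_divide_divide)
  have main: "\<bar>h y - h x\<bar> \<le> C * (y - x)" if xy: "d \<le> x" "x < y" "y \<le> u" for x y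
  proof -
    have "(h y - h x) / (y - x) \<le> (h (u + 1) - h x) / (u + 1 - x)"
      using convex_on_slope_le(1)[OF h, of x "u + 1" y] xy by (simp add: slope[of "h x"])
    also have "\<dots> \<le> (h (u + 1) - h u) / (u + 1 - u)"
      using convex_on_slope_le(2)[OF h, of x "u + 1" u] xy by (cases "x = u") (auto simp: slope[of _ "h (u+1)"])
    finally have 1: "(h y - h x) / (y - x) \<le> C" by (simp add: C_def)
    have "(h d - h (d - 1)) / (d - (d - 1)) \<le> (h y - h (d - 1)) / (y - (d - 1))"
      using convex_on_slope_le(1)[OF h, of "d - 1" y d] xy by (simp add: slope[of "h (d - 1)"])
    also have "\<dots> \<le> (h y - h x) / (y - x)"
      using convex_on_slope_le(2)[OF h, of "d - 1" y x] xy by (simp add: slope[of _ "h y"])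
    finally have "- C \<le> (h y - h x) / (y - x)" by (simp add: C_def)
    with 1 have "\<bar>(h y - h x) / (y - x)\<bar> \<le> C" by (intro abs_leI) linarith+
    then show ?thesis using xy by (simp add: abs_divide pos_divide_le_eq del: abs_le_iff)
  qed
  show ?thesis
  proof (rule that[of C])
    show "C \<ge> 0" by (simp add: C_def)
    fix x y assume "x \<in> {d..u}" "y \<in> {d..u}"
    then show "\<bar>h x - h y\<bar> \<le> C * \<bar>x - y\<bar>"
      using main[of x y] main[of y x] by (cases x y rule: linorder_cases) (auto simp: abs_minus_commute)
  qed
qed

lemma holding_costD:
  assumes "holding_cost \<mu> \<sigma> h a"
  shows "0 \<le> h x" "continuous_on UNIV h" "convex_on UNIV h" "h a = 0"
    "x < a \<Longrightarrow> deriv h x < 0" "a < x \<Longrightarrow> 0 < deriv h x"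
  using assms unfolding holding_cost_def by blast+

lemma holding_cost_deriv:
  assumes "holding_cost \<mu> \<sigma> h a" "x \<noteq> a"
  shows "(h has_real_derivative deriv h x) (at x)"
proof -
  have "h differentiable (at x within - {a})"
    using assms unfolding holding_cost_def differentiable_on_def by blast
  then have "h differentiable (at x)" using assms(2) at_within_open[of x "- {a}"] open_Compl[OF closed_singleton[of a]] by simp
  then show ?thesis by (simp add: DERIV_deriv_iff_real_differentiable)
qed

lemma holding_cost_strict_mono:
  assumes h: "holding_cost \<mu> \<sigma> h a"
  shows "x < y \<Longrightarrow> y \<le> a \<Longrightarrow> h y < h x" "a \<le> x \<Longrightarrow> x < y \<Longrightarrow> h x < h y"
proof -
  have c: "continuous_on S h" for S by (rule continuous_on_subset[OF holding_costD(2)[OF h]]) simp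
  have s: "x < a \<Longrightarrow> deriv h x < 0" "a < x \<Longrightarrow> 0 < deriv h x" for x
    using holding_costD[OF h] by simp_all
  show "h y < h x" if "x < y" "y \<le> a"
  proof (rule DERIV_neg_imp_decreasing_open[OF that(1) _ c])
    fix t assume "x < t" "t < y"
    then have "t < a" using that by simp
    then show "\<exists>D. DERIV h t :> D \<and> D < 0" using holding_cost_deriv[OF h, of t] s(1) by blast
  qed
  show "h x < h y" if "a \<le> x" "x < y"
  proof (rule DERIV_pos_imp_increasing_open[OF that(2) _ c])
    fix t assume "x < t" "t < y"
    then have "a < t" using that by simp
    then show "\<exists>D. DERIV h t :> D \<and> 0 < D" using holding_cost_deriv[OF h, of t] s(2) by blast
  qed
qed

lemma holding_cost_linear_growth:
  assumes h: "holding_cost \<mu> \<sigma> h a"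
  obtains c C where "c > 0" "\<And>x. c * \<bar>x - a\<bar> \<le> h x + C"
proof -
  note hc = holding_costD(3)[OF h] and h0 = holding_costD(4)[OF h] and hn = holding_costD(1)[OF h]
  \<comment> \<open>outside \<open>[a - 1, a + 1]\<close>, convexity bounds \<open>h\<close> below by the secants through \<open>a\<close>\<close>
  define p q where "p = h (a + 1)" and "q = h (a - 1)"
  have pq: "p > 0" "q > 0" using holding_cost_strict_mono[OF h, of a "a+1"] holding_cost_strict_mono[OF h, of "a-1" a] h0
    by (auto simp: p_def q_def)
  have "min p q * \<bar>x - a\<bar> \<le> h x + max p q" for x
  proof -
    have m: "min p q * \<bar>x - a\<bar> \<le> p * \<bar>x - a\<bar>" "min p q * \<bar>x - a\<bar> \<le> q * \<bar>x - a\<bar>"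
      by (auto intro!: mult_right_mono)
    have mx: "0 < max p q" using pq by simp
    consider "x > a + 1" | "x < a - 1" | "\<bar>x - a\<bar> \<le> 1" by linarith
    then show ?thesis
    proof cases
      case 1
      have "p \<le> h x / (x - a)"
        using convex_on_slope_le(1)[OF hc, of a x "a + 1"] 1 h0 by (simp add: p_def minus_divide_right)
      then have "p * (x - a) \<le> h x" using 1 by (simp add: pos_le_divide_eq)
      moreover have "\<bar>x - a\<bar> = x - a" using 1 by simp
      ultimately have "p * \<bar>x - a\<bar> \<le> h x" by simp
      also have "\<dots> \<le> h x + max p q" using mx by simp
      finally show ?thesis using m(1) by (rule order_trans[rotated])
    next
      case 2
      have "- (h x / (a - x)) \<le> - q"
        using convex_on_slope_le(2)[OF hc, of x a "a - 1"] 2 h0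
        by (simp add: q_def minus_divide_right)
      then have "q * (a - x) \<le> h x" using 2 by (simp add: pos_le_divide_eq)
      moreover have "\<bar>x - a\<bar> = a - x" using 2 by simp
      ultimately have "q * \<bar>x - a\<bar> \<le> h x" by simp
      also have "\<dots> \<le> h x + max p q" using mx by simp
      finally show ?thesis using m(2) by (rule order_trans[rotated])
    next
      case 3
      have "p * \<bar>x - a\<bar> \<le> p * 1" using 3 pq by (intro mult_left_mono) auto
      also have "p * 1 \<le> h x + max p q" using hn[of x] by simp
      finally show ?thesis using m(1) by (rule order_trans[rotated])
    qed
  qed
  then show ?thesis using that[of "min p q" "max p q"] pq by simp
qed

text \<open>Taking the factor depending on \<open>x\<close> out of the integral leaves an integral that can be differentiated
  with respect to its endpoint.\<close>

lemma g_AB_decomposition: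
  "g_AB \<mu> \<sigma> h a A B x = A - B * exp (- (decay_rate \<mu> \<sigma> * (x - a)))
     - decay_rate \<mu> \<sigma> / \<mu> * exp (- (decay_rate \<mu> \<sigma> * (x - a))) *
       (LBINT y=ereal a..ereal x. h y * exp (decay_rate \<mu> \<sigma> * (y - a)))"
proof -
  let ?\<rho> = "decay_rate \<mu> \<sigma>"
  have "(\<lambda>y. h y * exp (- ?\<rho> * (x - y))) = (\<lambda>y. exp (- (?\<rho> * (x - a))) * (h y * exp (?\<rho> * (y - a))))"
    by (rule ext) (simp add: exp_add[symmetric] algebra_simps)
  then show ?thesis
    unfolding g_AB_def by (simp only: interval_lebesgue_integral_mult_right mult.assoc mult_minus_left)
qed

text \<open>This is the equation \<open>\<sigma>\<^sup>2/2 g' + \<mu> g + h = \<mu> A\<close>, solved for \<open>g'\<close>.\<close>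

lemma g_AB_ode:
  assumes "continuous_on UNIV h"
  shows "(g_AB \<mu> \<sigma> h a A B has_real_derivative
    decay_rate \<mu> \<sigma> * (A - g_AB \<mu> \<sigma> h a A B x) - decay_rate \<mu> \<sigma> / \<mu> * h x) (at x)"
proof -
  let ?\<rho> = "decay_rate \<mu> \<sigma>"
  have "continuous_on UNIV (\<lambda>y. h y * exp (?\<rho> * (y - a)))" by (intro continuous_intros assms)
  note D [derivative_intros] = interval_integral_has_derivative[OF this, of a x]
  let ?E = "exp (- (?\<rho> * (x - a)))"
  let ?\<Phi> = "LBINT y=ereal a..ereal x. h y * exp (?\<rho> * (y - a))"
  have "exp (?\<rho> * (x - a)) * ?E = 1" by (simp flip: exp_add)
  then have e: "h x * exp (?\<rho> * (x - a)) * ?E = h x" by (simp only: mult.assoc mult_1_right)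
  have alg: "0 - B * (E * - r) - ((r / m * (E * - r)) * I + X * (r / m * E))
      = r * (A - (A - B * E - r / m * E * I)) - r / m * Y" if "X * E = Y" for E r m I X Y :: real
    by (simp add: algebra_simps flip: that)
  have "(g_AB \<mu> \<sigma> h a A B has_real_derivative
      0 - B * (?E * - ?\<rho>) - ((?\<rho> / \<mu> * (?E * - ?\<rho>)) * ?\<Phi> + (h x * exp (?\<rho> * (x - a))) * (?\<rho> / \<mu> * ?E))) (at x)"
    unfolding g_AB_decomposition[abs_def]
    by (rule derivative_eq_intros refl | simp)+
  moreover have "0 - B * (?E * - ?\<rho>) - ((?\<rho> / \<mu> * (?E * - ?\<rho>)) * ?\<Phi> + (h x * exp (?\<rho> * (x - a))) * (?\<rho> / \<mu> * ?E))
      = ?\<rho> * (A - g_AB \<mu> \<sigma> h a A B x) - ?\<rho> / \<mu> * h x"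
    unfolding g_AB_decomposition by (rule alg[OF e])
  ultimately show ?thesis by simp
qed


text \<open>The function \<open>G x = exp (\<rho> (x - a)) g' x\<close>, where \<open>\<rho>\<close> is the decay rate, has derivative
  \<open>- \<rho>/\<mu> exp (\<rho> (x - a)) h' x\<close> away from \<open>a\<close>. It increases strictly up to \<open>a\<close> and decreases strictly
  after \<open>a\<close>, so its two zeros lie on different sides of \<open>a\<close>, and it is positive between them. The
  inequality \<open>g d < g u\<close> decides which of the two is the left one.\<close>

lemma g_AB_critical_points:
  assumes h: "holding_cost \<mu> \<sigma> h a" and \<mu>: "0 < \<mu>" and \<sigma>: "0 < \<sigma>"
    and dg: "(g_AB \<mu> \<sigma> h a A B has_real_derivative 0) (at d)"
      "(g_AB \<mu> \<sigma> h a A B has_real_derivative 0) (at u)"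
    and less: "g_AB \<mu> \<sigma> h a A B d < g_AB \<mu> \<sigma> h a A B u"
  shows "d < a" "a < u"
    "\<And>x y. d \<le> x \<Longrightarrow> x < y \<Longrightarrow> y \<le> u \<Longrightarrow> g_AB \<mu> \<sigma> h a A B x < g_AB \<mu> \<sigma> h a A B y"
proof -
  define \<rho> where "\<rho> = decay_rate \<mu> \<sigma>"
  define g where "g = g_AB \<mu> \<sigma> h a A B"
  define g' where "g' x = \<rho> * (A - g x) - \<rho> / \<mu> * h x" for x
  define G where "G x = exp (\<rho> * (x - a)) * g' x" for x
  have \<rho>: "0 < \<rho>" using \<mu> \<sigma> by (simp add: \<rho>_def decay_rate_def)
  note hc = holding_costD(2)[OF h]
  have Dg: "(g has_real_derivative g' x) (at x)" for x
    using g_AB_ode[OF hc] by (simp add: g_def g'_def \<rho>_def)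
  have g'0: "g' d = 0" "g' u = 0" using DERIV_unique[OF Dg] dg by (simp_all add: g_def)
  then have G0: "G d = 0" "G u = 0" by (simp_all add: G_def)
  have gc: "continuous_on S g" for S
    by (intro continuous_at_imp_continuous_on ballI) (rule DERIV_isCont[OF Dg])
  have Gc: "continuous_on S G" for S
    unfolding G_def[abs_def] g'_def[abs_def]
    by (intro continuous_intros gc continuous_on_subset[OF hc subset_UNIV])
  have DG: "(G has_real_derivative - (\<rho> / \<mu> * (exp (\<rho> * (x - a)) * deriv h x))) (at x)" if "x \<noteq> a" for x
  proof -
    note [derivative_intros] = Dg holding_cost_deriv[OF h that]
    have "((\<lambda>x. exp (\<rho> * (x - a)) * (\<rho> * (A - g x) - \<rho> / \<mu> * h x)) has_real_derivative
       (exp (\<rho> * (x - a)) * \<rho>) * (\<rho> * (A - g x) - \<rho> / \<mu> * h x) +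
        (\<rho> * (0 - g' x) - \<rho> / \<mu> * deriv h x) * exp (\<rho> * (x - a))) (at x)"
      by (rule derivative_eq_intros refl | simp)+
    moreover have "(exp (\<rho> * (x - a)) * \<rho>) * (\<rho> * (A - g x) - \<rho> / \<mu> * h x) +
        (\<rho> * (0 - g' x) - \<rho> / \<mu> * deriv h x) * exp (\<rho> * (x - a))
       = - (\<rho> / \<mu> * (exp (\<rho> * (x - a)) * deriv h x))"
      by (simp add: g'_def algebra_simps)
    ultimately show ?thesis unfolding G_def[abs_def] g'_def by simp
  qed
  have sgn: "x < a \<Longrightarrow> deriv h x < 0" "a < x \<Longrightarrow> 0 < deriv h x" for x
    using holding_costD(5,6)[OF h] by simp_all
  have up: "G x < G y" if "x < y" "y \<le> a" for x y
  proof (rule DERIV_pos_imp_increasing_open[OF that(1) _ Gc])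
    fix t assume "x < t" "t < y"
    then have "t < a" using that by simp
    then have "0 < - (\<rho> / \<mu> * (exp (\<rho> * (t - a)) * deriv h t))"
      using sgn(1)[of t] \<rho> \<mu> by (simp add: mult_pos_neg divide_neg_pos)
    then show "\<exists>D. DERIV G t :> D \<and> 0 < D" using DG[of t] \<open>t < a\<close> by blast
  qed
  have down: "G y < G x" if "a \<le> x" "x < y" for x y
  proof (rule DERIV_neg_imp_decreasing_open[OF that(2) _ Gc])
    fix t assume "x < t" "t < y"
    then have "a < t" using that by simp
    then have "- (\<rho> / \<mu> * (exp (\<rho> * (t - a)) * deriv h t)) < 0"
      using sgn(2)[of t] \<rho> \<mu> by simp
    then show "\<exists>D. DERIV G t :> D \<and> D < 0" using DG[of t] \<open>a < t\<close> by blast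
  qed
  have incr: "g x < g y" if pq: "p < a" "a < q" "G p = 0" "G q = 0" "p \<le> x" "x < y" "y \<le> q" for p q x y
  proof (rule DERIV_pos_imp_increasing_open[OF \<open>x < y\<close> _ gc])
    fix t assume t: "x < t" "t < y"
    have "0 < G t"
    proof (cases "t \<le> a")
      case True then show ?thesis using up[of p t] pq t by simp
    next
      case False then show ?thesis using down[of t q] pq t by simp
    qed
    then have "0 < g' t" by (simp add: G_def zero_less_mult_iff)
    then show "\<exists>D. DERIV g t :> D \<and> 0 < D" using Dg by blast
  qed
  have dnu: "d \<noteq> u" using less by auto
  have not_same: "\<not> (d \<le> a \<and> u \<le> a)" "\<not> (a \<le> d \<and> a \<le> u)"
    using up[of d u] up[of u d] down[of d u] down[of u d] G0 dnu by (auto simp: neq_iff)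
  have "\<not> (u < a \<and> a < d)"
    using incr[of u d u d] G0 less by (auto simp: g_def)
  then show "d < a" "a < u" using not_same by linarith+
  then show "g_AB \<mu> \<sigma> h a A B x < g_AB \<mu> \<sigma> h a A B y" if "d \<le> x" "x < y" "y \<le> u" for x y
    using incr[of d u x y] G0 that by (simp add: g_def)
qed

text \<open>\<open>V'\<close> is \<open>g\<close> composed with the projection to \<open>[d, u]\<close>. The optimality equation is the differential
  equation for \<open>g\<close>, and its value \<open>\<mu> A\<close> is positive because at \<open>u\<close> it reads \<open>\<mu> A = \<mu> l + h u\<close>.\<close>

lemma relative_value_exists:
  assumes h: "holding_cost \<mu> \<sigma> h a" and pos: "0 < \<mu>" "0 < \<sigma>" "0 < k" "0 < l"
    and g: "g_AB \<mu> \<sigma> h a A B d = - k" "g_AB \<mu> \<sigma> h a A B u = l"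
    and dg: "(g_AB \<mu> \<sigma> h a A B has_real_derivative 0) (at d)"
      "(g_AB \<mu> \<sigma> h a A B has_real_derivative 0) (at u)"
  obtains V V1 V2 L K where "relative_value \<mu> \<sigma> k l d u (\<mu> * A) h V V1 V2 L K"
proof -
  define \<rho> where "\<rho> = decay_rate \<mu> \<sigma>"
  define f where "f = g_AB \<mu> \<sigma> h a A B"
  define f' where "f' x = \<rho> * (A - f x) - \<rho> / \<mu> * h x" for x
  have \<rho>: "0 < \<rho>" using pos by (simp add: \<rho>_def decay_rate_def)
  have \<rho>2: "\<sigma>\<^sup>2 / 2 * \<rho> = \<mu>" using pos by (simp add: \<rho>_def decay_rate_def)
  note hc = holding_costD(2)[OF h] and hconv = holding_costD(3)[OF h] and h0 = holding_costD(1)[OF h]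
  have less: "g_AB \<mu> \<sigma> h a A B d < g_AB \<mu> \<sigma> h a A B u" using g pos by simp
  note crit = g_AB_critical_points[OF h pos(1,2) dg less]
  have du: "d < u" using crit(1,2) by simp
  have Df: "(f has_real_derivative f' x) (at x)" for x
    using g_AB_ode[OF hc] by (simp add: f_def f'_def \<rho>_def)
  have f'0: "f' d = 0" "f' u = 0" using DERIV_unique[OF Df] dg by (simp_all add: f_def)
  define V1 where "V1 x = f (clamp_to d u x)" for x
  define V2 where "V2 x = f' (clamp_to d u x)" for x
  have D1: "(V1 has_real_derivative V2 x) (at x)" for x
    unfolding V1_def[abs_def] V2_def by (rule DERIV_compose_clamp[OF Df f'0 du])
  have V1c: "continuous_on UNIV V1"
    by (intro continuous_at_imp_continuous_on ballI) (rule DERIV_isCont[OF D1])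
  define V where "V x = (LBINT y=ereal a..ereal x. V1 y)" for x
  have D0: "(V has_real_derivative V1 x) (at x)" for x
    unfolding V_def[abs_def] by (rule interval_integral_has_derivative[OF V1c])
  have bounds: "- k \<le> V1 x" "V1 x \<le> l" for x
  proof -
    let ?c = "clamp_to d u x"
    have c: "?c \<in> {d..u}" by (rule clamp_to_simps(4)) (use du in simp)
    show "- k \<le> V1 x" using crit(3)[of d ?c] c g du by (cases "?c = d") (auto simp: V1_def f_def)
    show "V1 x \<le> l" using crit(3)[of ?c u] c g du by (cases "?c = u") (auto simp: V1_def f_def)
  qed
  have gen: "\<sigma>\<^sup>2 / 2 * V2 x + \<mu> * V1 x + h (clamp_to d u x) = \<mu> * A" for x
  proof -
    have "\<sigma>\<^sup>2 / 2 * V2 x = (\<sigma>\<^sup>2 / 2 * \<rho>) * ((A - V1 x) - h (clamp_to d u x) / \<mu>)"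
      by (simp add: V2_def f'_def V1_def algebra_simps)
    also have "\<dots> = \<mu> * (A - V1 x) - h (clamp_to d u x)"
      unfolding \<rho>2 using pos by (simp add: algebra_simps)
    finally show ?thesis by (simp add: algebra_simps)
  qed
  have hclamp: "h (clamp_to d u x) \<le> h x" for x
  proof -
    consider "x < d" | "x \<in> {d..u}" | "u < x" by force
    then show ?thesis
    proof cases
      case 1 then show ?thesis using holding_cost_strict_mono(1)[OF h, of x d] crit du by (simp add: clamp_to_def)
    next
      case 2 then show ?thesis using du by (simp add: clamp_to_def)
    next
      case 3 then show ?thesis using holding_cost_strict_mono(2)[OF h, of u x] crit du by (simp add: clamp_to_def)
    qed
  qed
  obtain Ch where Ch: "Ch \<ge> 0" "\<And>x y. x \<in> {d..u} \<Longrightarrow> y \<in> {d..u} \<Longrightarrow> \<bar>h x - h y\<bar> \<le> Ch * \<bar>x - y\<bar>"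
    using convex_on_lipschitz_interval[OF hconv] by blast
  have hcl: "\<bar>h (clamp_to d u x) - h (clamp_to d u y)\<bar> \<le> Ch * \<bar>x - y\<bar>" for x y
  proof -
    have "\<bar>h (clamp_to d u x) - h (clamp_to d u y)\<bar> \<le> Ch * \<bar>clamp_to d u x - clamp_to d u y\<bar>"
      using du by (intro Ch clamp_to_simps) auto
    also have "\<dots> \<le> Ch * \<bar>x - y\<bar>" using Ch(1) clamp_to_lipschitz by (intro mult_left_mono)
    finally show ?thesis .
  qed
  have V2c: "continuous_on {d..u} f'"
    unfolding f'_def[abs_def]
    by (intro continuous_intros continuous_on_subset[OF hc subset_UNIV]
        continuous_at_imp_continuous_on ballI DERIV_isCont[OF Df])
  then have "bounded (f' ` {d..u})" by (intro compact_imp_bounded compact_continuous_image) auto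
  then obtain M where M: "\<And>x. x \<in> {d..u} \<Longrightarrow> \<bar>f' x\<bar> \<le> M" unfolding bounded_iff by (metis imageI real_norm_def)
  have V2M: "\<bar>V2 x\<bar> \<le> M" for x unfolding V2_def using du by (intro M clamp_to_simps) simp
  have V1l: "\<bar>V1 x - V1 y\<bar> \<le> M * \<bar>x - y\<bar>" for x y
    using field_differentiable_bound[of UNIV V1 V2 M x y] D1 V2M by simp
  have V2l: "\<bar>V2 x - V2 y\<bar> \<le> (\<rho> * M + \<rho> / \<mu> * Ch) * \<bar>x - y\<bar>" for x y
  proof -
    have "V2 x - V2 y = - (\<rho> * (V1 x - V1 y)) - \<rho> / \<mu> * (h (clamp_to d u x) - h (clamp_to d u y))"
      by (simp add: V2_def f'_def V1_def algebra_simps)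
    also have "\<bar>\<dots>\<bar> \<le> \<rho> * \<bar>V1 x - V1 y\<bar> + \<rho> / \<mu> * \<bar>h (clamp_to d u x) - h (clamp_to d u y)\<bar>"
      using \<rho> pos by (intro order_trans[OF abs_triangle_ineq4]) (simp add: abs_mult)
    also have "\<dots> \<le> \<rho> * (M * \<bar>x - y\<bar>) + \<rho> / \<mu> * (Ch * \<bar>x - y\<bar>)"
      using \<rho> pos V1l hcl by (intro add_mono mult_left_mono) auto
    finally show ?thesis by (simp add: algebra_simps)
  qed
  obtain c C where c: "c > 0" "\<And>x. c * \<bar>x - a\<bar> \<le> h x + C" using holding_cost_linear_growth[OF h] by blast
  define m where "m = max k l"
  have m: "0 < m" using pos by (simp add: m_def)
  have V1m: "\<bar>V1 x\<bar> \<le> m" for x using bounds[of x] by (auto simp: m_def)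
  define K where "K = m / c + m * \<bar>C\<bar> / c + \<bar>V a\<bar>"
  have K: "0 < K" using m c by (simp add: K_def add_pos_nonneg)
  have growth: "V x \<le> K * (1 + h x)" for x
  proof -
    have "\<bar>V x - V a\<bar> \<le> m * \<bar>x - a\<bar>"
      using field_differentiable_bound[of UNIV V V1 m x a] D0 V1m by simp
    also have "m * \<bar>x - a\<bar> \<le> m * ((h x + C) / c)"
      using m c by (intro mult_left_mono) (auto simp: field_simps)
    finally have "V x \<le> m / c * h x + (m * C / c + V a)" by (simp add: field_simps add_divide_distrib)
    also have "\<dots> \<le> K * h x + K"
    proof (rule add_mono)
      show "m / c * h x \<le> K * h x" using h0 m c by (intro mult_right_mono) (auto simp: K_def)
      have "m * C / c \<le> m * \<bar>C\<bar> / c" using m c by (intro divide_right_mono mult_left_mono) auto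
      moreover have "0 < m / c" using m c by simp
      ultimately show "m * C / c + V a \<le> K" using abs_ge_self[of "V a"] unfolding K_def by linarith
    qed
    finally show ?thesis by (simp add: algebra_simps)
  qed
  have "\<mu> * A = \<mu> * l + h u"
  proof -
    have "\<rho> / \<mu> * (\<mu> * A - (\<mu> * l + h u)) = 0"
      using f'0(2) g(2) pos by (simp add: f'_def f_def algebra_simps)
    then show ?thesis using \<rho> pos by simp
  qed
  then have "0 < \<mu> * A" using pos h0[of u] by (simp add: add_pos_nonneg)
  then have "relative_value \<mu> \<sigma> k l d u (\<mu> * A) h V V1 V2 (\<rho> * M + \<rho> / \<mu> * Ch) K"
    unfolding relative_value_def
    using pos K du D0 D1 V2l bounds gen hc h0 hclamp growth g
    by (auto simp: V1_def clamp_to_simps f_def)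
  then show thesis by (rule that)
qed

context relative_value begin

abbreviation proj :: "real \<Rightarrow> real" where "proj \<equiv> clamp_to d u"

lemma clamp_range: "proj x \<in> {d..u}"
  using du by (intro clamp_to_simps) simp

lemma V_tilt_deriv:
  "((\<lambda>x. V x + k * x) has_real_derivative V1 x + k) (at x within S)"
  "((\<lambda>x. V x - l * x) has_real_derivative V1 x - l) (at x within S)"
  by (rule derivative_eq_intros has_field_derivative_at_within[OF V_deriv] refl | simp)+

text \<open>Moving up by \<open>p\<close> lowers \<open>V\<close> by at most \<open>k p\<close>, and moving down by \<open>q\<close> lowers it by at most \<open>l q\<close>,
  because \<open>- k \<le> V1 \<le> l\<close>.\<close>

lemma V_push: assumes "0 \<le> p" "0 \<le> q" shows "V z - k * p - l * q \<le> V (z + p - q)"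
proof -
  have nn: "0 \<le> V1 x + k" "V1 x - l \<le> 0" for x using V1_bounds[of x] by simp_all
  have "V z + k * z \<le> V (z + p) + k * (z + p)"
    by (rule DERIV_nonneg_imp_nondecreasing[of z "z + p"])
      (use assms(1) in simp, use V_tilt_deriv(1) nn(1) in blast)
  moreover have "V (z + p) - l * (z + p) \<le> V (z + p - q) - l * (z + p - q)"
    by (rule DERIV_nonpos_imp_nonincreasing[of "z + p - q" "z + p"])
      (use assms(2) in simp, use V_tilt_deriv(2) nn(2) in blast)
  ultimately show ?thesis by (simp add: algebra_simps)
qed

text \<open>Outside the band \<open>V\<close> is affine with slopes \<open>- k\<close> and \<open>l\<close>, so projecting to the band costs exactly the
  drop in \<open>V\<close>.\<close>

lemma V_clamp: "V s = V (proj s) + k * max 0 (d - s) + l * max 0 (s - u)"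
proof -
  have below: "V s + k * s = V d + k * d" if "s \<le> d"
  proof -
    have "norm ((V s + k * s) - (V d + k * d)) \<le> 0 * norm (s - d)"
      by (rule field_differentiable_bound[OF _ V_tilt_deriv(1)[of _ "{..d}"]]) (use that V1_outside(1) in auto)
    then show ?thesis by simp
  qed
  have above: "V s - l * s = V u - l * u" if "u \<le> s"
  proof -
    have "norm ((V s - l * s) - (V u - l * u)) \<le> 0 * norm (s - u)"
      by (rule field_differentiable_bound[OF _ V_tilt_deriv(2)[of _ "{u..}"]]) (use that V1_outside(2) in auto)
    then show ?thesis by simp
  qed
  consider "s < d" | "s \<in> {d..u}" | "u < s" by force
  then show ?thesis
    using below above du by cases (auto simp: clamp_to_def algebra_simps)
qed

lemma V_lipschitz: "\<bar>V x - V y\<bar> \<le> (k + l) * \<bar>x - y\<bar>"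
proof -
  have "\<bar>V1 x\<bar> \<le> k + l" for x using V1_bounds[of x] pos by auto
  then show ?thesis using field_differentiable_bound[of UNIV V V1 "k + l" x y] V_deriv by simp
qed

lemma V_abs_le: "\<bar>V x\<bar> \<le> \<bar>V 0\<bar> + (k + l) * \<bar>x\<bar>"
  using V_lipschitz[of x 0] by simp

lemma L_nonneg: "0 \<le> L"
  using V2_lipschitz[of 1 0] by simp

text \<open>The bound on \<open>V2 x - V2 z\<close> is integrated twice over the ball of radius \<open>\<bar>y\<bar>\<close> around \<open>z\<close>.\<close>

lemma V_taylor: "\<bar>V (z + y) - V z - V1 z * y - V2 z * y\<^sup>2 / 2\<bar> \<le> L * \<bar>y\<bar> ^ 3"
proof -
  define r where "r = \<bar>y\<bar>"
  define \<phi> where "\<phi> x = V x - V z - V1 z * (x - z) - V2 z * (x - z)\<^sup>2 / 2" for x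
  define \<phi>' where "\<phi>' x = V1 x - V1 z - V2 z * (x - z)" for x
  have D: "(\<phi> has_real_derivative \<phi>' x) (at x within S)" for x S
    unfolding \<phi>_def[abs_def] \<phi>'_def
    by (rule derivative_eq_intros has_field_derivative_at_within[OF V_deriv] refl | simp)+
  have D': "(\<phi>' has_real_derivative V2 x - V2 z) (at x within S)" for x S
    unfolding \<phi>'_def[abs_def]
    by (rule derivative_eq_intros has_field_derivative_at_within[OF V1_deriv] refl | simp)+
  have b2: "\<bar>V2 x - V2 z\<bar> \<le> L * r" if "x \<in> cball z r" for x
  proof -
    have "\<bar>V2 x - V2 z\<bar> \<le> L * \<bar>x - z\<bar>" by (rule V2_lipschitz)
    also have "\<dots> \<le> L * r" using that L_nonneg by (intro mult_left_mono) (auto simp: dist_real_def)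
    finally show ?thesis .
  qed
  have b1: "\<bar>\<phi>' x\<bar> \<le> L * r\<^sup>2" if x: "x \<in> cball z r" for x
  proof -
    have "norm (\<phi>' x - \<phi>' z) \<le> L * r * norm (x - z)"
      using D' b2 x by (intro field_differentiable_bound[of "cball z r" _ "\<lambda>x. V2 x - V2 z"]) (auto simp: r_def)
    also have "\<dots> \<le> L * r * r"
      using x L_nonneg by (intro mult_left_mono) (auto simp: r_def dist_real_def)
    finally show ?thesis by (simp add: \<phi>'_def power2_eq_square)
  qed
  have "norm (\<phi> (z + y) - \<phi> z) \<le> L * r\<^sup>2 * norm (z + y - z)"
    using D b1 by (intro field_differentiable_bound[of "cball z r" _ \<phi>']) (auto simp: r_def dist_real_def)
  also have "\<dots> = L * \<bar>y\<bar> ^ 3" by (simp add: r_def power3_eq_cube power2_eq_square)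
  finally show ?thesis by (simp add: \<phi>_def)
qed

lemma h_clamp_bounded: obtains C where "\<And>x. h (proj x) \<le> C"
proof -
  have "bounded (h ` {d..u})"
    by (intro compact_imp_bounded compact_continuous_image continuous_on_subset[OF h_cont]) auto
  then obtain C where C: "\<forall>y\<in>h ` {d..u}. norm y \<le> C" unfolding bounded_iff by blast
  have "h (proj x) \<le> C" for x
  proof -
    have "norm (h (proj x)) \<le> C" using C clamp_range[of x] by blast
    then show ?thesis by simp
  qed
  then show ?thesis by (rule that)
qed

lemma V2_bounded: obtains C where "\<And>x. \<bar>V2 x\<bar> \<le> C"
proof -
  obtain C where C: "\<And>x. h (proj x) \<le> C" using h_clamp_bounded by blast
  have "\<bar>V2 x\<bar> \<le> 2 / \<sigma>\<^sup>2 * (\<gamma> + C + \<mu> * (k + l))" for x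
  proof -
    have "V2 x = 2 / \<sigma>\<^sup>2 * (\<gamma> - h (proj x) - \<mu> * V1 x)"
      using generator[of x] pos by (simp add: field_simps)
    also have "\<bar>\<dots>\<bar> = 2 / \<sigma>\<^sup>2 * \<bar>\<gamma> - h (proj x) - \<mu> * V1 x\<bar>"
    proof -
      have "\<bar>2 / \<sigma>\<^sup>2\<bar> = 2 / \<sigma>\<^sup>2" by simp
      then show ?thesis unfolding abs_mult by simp
    qed
    also have "\<bar>\<gamma> - h (proj x) - \<mu> * V1 x\<bar> \<le> \<gamma> + C + \<mu> * (k + l)"
    proof -
      have "\<bar>\<mu> * V1 x\<bar> \<le> \<mu> * (k + l)"
        using V1_bounds[of x] pos by (simp add: abs_mult)
      then show ?thesis using C[of x] h_nonneg[of "proj x"] pos by (intro abs_leI) linarith+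
    qed
    finally show ?thesis using pos by (simp add: mult_left_mono divide_right_mono)
  qed
  then show ?thesis by (rule that)
qed

lemma continuous_parts:
  "continuous_on UNIV V" "continuous_on UNIV V1" "continuous_on UNIV V2"
  "continuous_on UNIV (\<lambda>x. h (proj x))"
proof -
  show c: "continuous_on UNIV (\<lambda>x. h (proj x))"
    unfolding clamp_to_def by (intro continuous_on_compose2[OF h_cont] continuous_intros) auto
  show "continuous_on UNIV V" "continuous_on UNIV V1"
    by (intro continuous_at_imp_continuous_on ballI DERIV_isCont[OF V_deriv] DERIV_isCont[OF V1_deriv])+
  have "V2 x = 2 / \<sigma>\<^sup>2 * (\<gamma> - h (proj x) - \<mu> * V1 x)" for x
    using generator[of x] pos by (simp add: field_simps)
  then have "V2 = (\<lambda>x. 2 / \<sigma>\<^sup>2 * (\<gamma> - h (proj x) - \<mu> * V1 x))" by blast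
  moreover have "continuous_on UNIV (\<lambda>x. 2 / \<sigma>\<^sup>2 * (\<gamma> - h (proj x) - \<mu> * V1 x))"
    by (intro continuous_intros c \<open>continuous_on UNIV V1\<close>)
  ultimately show "continuous_on UNIV V2" by simp
qed

lemma measurable_parts [measurable]:
  "V \<in> borel_measurable borel" "V1 \<in> borel_measurable borel" "V2 \<in> borel_measurable borel"
  "h \<in> borel_measurable borel" "clamp_to d u \<in> borel_measurable borel"
  using continuous_parts h_cont by (auto intro!: borel_measurable_continuous_onI simp: clamp_to_def[abs_def])

end

section \<open>Brownian increments and one-step expansions\<close>

locale brownian = prob_space M for M :: "'w measure" +
  fixes F :: "real \<Rightarrow> 'w measure" and W :: "real \<Rightarrow> 'w \<Rightarrow> real"
  assumes filt: "filtered_prob_space M F" and bm: "std_brownian_motion M F W"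
begin

lemma space_F [simp]: "space (F t) = space M"
  using filt unfolding filtered_prob_space_def filtration_def by blast

lemma F_mono: "s \<le> t \<Longrightarrow> sets (F s) \<subseteq> sets (F t)"
  using filt unfolding filtered_prob_space_def filtration_def by blast

lemma F_subset: "sets (F t) \<subseteq> sets M"
  using filt unfolding filtered_prob_space_def subalgebra_def by blast

lemma measurable_F_mono: "f \<in> borel_measurable (F s) \<Longrightarrow> s \<le> t \<Longrightarrow> f \<in> borel_measurable (F t)"
  using measurable_mono[of borel borel "F s" "F t"] F_mono by auto

lemma measurable_F_M: "f \<in> borel_measurable (F s) \<Longrightarrow> f \<in> borel_measurable M"
  using measurable_mono[of borel borel "F s" M] F_subset by auto

lemma W_measurable_F: "0 \<le> t \<Longrightarrow> W t \<in> borel_measurable (F t)"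
  using bm unfolding std_brownian_motion_def adapted_def by blast

lemma W_measurable [measurable]: "0 \<le> t \<Longrightarrow> W t \<in> borel_measurable M"
  by (rule measurable_F_M[OF W_measurable_F])

lemma W_path: "\<omega> \<in> space M \<Longrightarrow> W 0 \<omega> = 0" "\<omega> \<in> space M \<Longrightarrow> continuous_on {0..} (\<lambda>t. W t \<omega>)"
  using bm unfolding std_brownian_motion_def by blast+

lemma increment_distributed:
  "0 \<le> s \<Longrightarrow> s < t \<Longrightarrow> distributed M lborel (\<lambda>\<omega>. W t \<omega> - W s \<omega>) (\<lambda>y. ennreal (normal_density 0 (sqrt (t - s)) y))"
  using bm unfolding std_brownian_motion_def by blast

lemma increment_indep:
  assumes s: "0 \<le> s" "s < t" and X: "X \<in> borel_measurable (F s)"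
  shows "indep_var borel X borel (\<lambda>\<omega>. W t \<omega> - W s \<omega>)"
proof -
  let ?D = "\<lambda>\<omega>. W t \<omega> - W s \<omega>"
  have "indep_set (sets (F s)) (sets (vimage_algebra (space M) ?D borel))"
    using bm s unfolding std_brownian_motion_def by blast
  then have I: "indep_set (sets (F s)) (sigma_sets (space M) {?D -` A \<inter> space M | A. A \<in> sets borel})"
    by (simp add: sets_vimage_algebra)
  have sub: "sigma_sets (space M) {X -` A \<inter> space M | A. A \<in> sets borel} \<subseteq> sets (F s)"
    using sets.sigma_sets_subset[of "{X -` A \<inter> space M | A. A \<in> sets borel}" "F s"]
      measurable_sets[OF X] by auto
  have "indep_set (sigma_sets (space M) {X -` A \<inter> space M | A. A \<in> sets borel})
      (sigma_sets (space M) {?D -` A \<inter> space M | A. A \<in> sets borel})"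
    using I sub unfolding indep_sets2_eq by blast
  moreover have "X \<in> borel_measurable M" "?D \<in> borel_measurable M"
    using measurable_F_M[OF X] s by (auto intro!: borel_measurable_diff)
  ultimately show ?thesis unfolding indep_var_eq by blast
qed

lemma increment_moments:
  assumes s: "0 \<le> s" "s < t"
  defines "D \<equiv> \<lambda>\<omega>. W t \<omega> - W s \<omega>"
  shows "integrable M D" "expectation D = 0"
    "integrable M (\<lambda>\<omega>. (D \<omega>)\<^sup>2)" "expectation (\<lambda>\<omega>. (D \<omega>)\<^sup>2) = t - s"
    "integrable M (\<lambda>\<omega>. \<bar>D \<omega>\<bar> ^ 3)" "expectation (\<lambda>\<omega>. \<bar>D \<omega>\<bar> ^ 3) = 2 * sqrt (2 / pi) * sqrt (t - s) ^ 3"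
proof -
  let ?n = "normal_density 0 (sqrt (t - s))"
  have p: "0 < sqrt (t - s)" using s by simp
  note dist = increment_distributed[OF s, folded D_def]
  have I: "integrable M (\<lambda>\<omega>. g (D \<omega>))" "expectation (\<lambda>\<omega>. g (D \<omega>)) = c"
    if "has_bochner_integral lborel (\<lambda>x. ?n x * g x) c" "g \<in> borel_measurable borel" for g c
    using distributed_integrable[OF dist, of g] distributed_integral[OF dist, of g] that
    by (auto simp: has_bochner_integral_iff)
  show "integrable M D" "expectation D = 0"
    using I[of "\<lambda>x. x" 0] normal_moment_odd[OF p, of 0 0] by simp_all
  show "integrable M (\<lambda>\<omega>. (D \<omega>)\<^sup>2)" "expectation (\<lambda>\<omega>. (D \<omega>)\<^sup>2) = t - s"
  proof -
    have e: "fact (2 * 1) / ((2 / (sqrt (t - s))\<^sup>2) ^ 1 * fact 1) = t - s" using s by (simp add: fact_2)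
    show "integrable M (\<lambda>\<omega>. (D \<omega>)\<^sup>2)" "expectation (\<lambda>\<omega>. (D \<omega>)\<^sup>2) = t - s"
      using I[of "\<lambda>x. x\<^sup>2" "t - s"] normal_moment_even[OF p, of 0 1] unfolding e by simp_all
  qed
  show "integrable M (\<lambda>\<omega>. \<bar>D \<omega>\<bar> ^ 3)" "expectation (\<lambda>\<omega>. \<bar>D \<omega>\<bar> ^ 3) = 2 * sqrt (2 / pi) * sqrt (t - s) ^ 3"
    using I[of "\<lambda>x. \<bar>x\<bar> ^ 3" "2 * sqrt (2 / pi) * sqrt (t - s) ^ 3"] normal_moment_abs_odd[OF p, of 0 1]
    by (simp_all add: eval_nat_numeral mult.commute mult.left_commute)
qed

lemma bounded_times_increment:
  assumes s: "0 \<le> s" "s < t" and b: "b \<in> borel_measurable (F s)" "\<And>\<omega>. \<bar>b \<omega>\<bar> \<le> C"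
  shows "integrable M (\<lambda>\<omega>. b \<omega> * (W t \<omega> - W s \<omega>))" "expectation (\<lambda>\<omega>. b \<omega> * (W t \<omega> - W s \<omega>)) = 0"
    "integrable M (\<lambda>\<omega>. b \<omega> * (W t \<omega> - W s \<omega>)\<^sup>2)"
    "expectation (\<lambda>\<omega>. b \<omega> * (W t \<omega> - W s \<omega>)\<^sup>2) = (t - s) * expectation b"
proof -
  let ?D = "\<lambda>\<omega>. W t \<omega> - W s \<omega>"
  have ib: "integrable M b"
    by (rule integrable_const_bound[of _ C]) (use b in \<open>auto intro: measurable_F_M\<close>)
  note i1 = increment_indep[OF s b(1)]
  have i2: "indep_var borel b borel (\<lambda>\<omega>. (?D \<omega>)\<^sup>2)"
    using indep_var_compose[OF i1, of "\<lambda>x. x" borel "\<lambda>x. x\<^sup>2" borel] by (simp add: comp_def)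
  note m = increment_moments[OF s]
  show "integrable M (\<lambda>\<omega>. b \<omega> * ?D \<omega>)" "integrable M (\<lambda>\<omega>. b \<omega> * (?D \<omega>)\<^sup>2)"
    using indep_var_integrable[OF i1 ib m(1)] indep_var_integrable[OF i2 ib m(3)] by auto
  show "expectation (\<lambda>\<omega>. b \<omega> * ?D \<omega>) = 0" "expectation (\<lambda>\<omega>. b \<omega> * (?D \<omega>)\<^sup>2) = (t - s) * expectation b"
    using indep_var_lebesgue_integral[OF i1 ib m(1)] indep_var_lebesgue_integral[OF i2 ib m(3)] m by auto
qed

end

locale controlled_brownian = relative_value \<mu> \<sigma> k l d u \<gamma> h V V1 V2 L K + brownian M F W
  for \<mu> \<sigma> k l d u \<gamma> :: real and h V V1 V2 L K and M :: "'w measure" and F W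
begin

text \<open>After the expansion of \<open>V\<close> to second order, independence of the increment from \<open>F s\<close> turns the
  expectation of the first two terms into \<open>\<delta> (\<mu> E V1 + \<sigma>\<^sup>2/2 E V2) = \<delta> (\<gamma> - E h [Z])\<close>, up to the term
  of order \<open>\<delta>\<^sup>2\<close> caused by the squared drift. The remainder is controlled by the third absolute moment,
  which is of order \<open>sqrt \<delta> ^ 3\<close>. The constant must not depend on \<open>Z\<close>, \<open>s\<close> or \<open>\<delta>\<close>, so that the
  errors of many steps can be added.\<close>

lemma one_step:
  obtains C where "C \<ge> 0"
    "\<And>(Z :: 'w \<Rightarrow> real) s \<delta>. Z \<in> borel_measurable (F s) \<Longrightarrow> 0 \<le> s \<Longrightarrow> 0 < \<delta> \<Longrightarrow> \<delta> \<le> 1 \<Longrightarrow>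
      integrable M (\<lambda>\<omega>. V (Z \<omega> + (\<mu> * \<delta> + \<sigma> * (W (s + \<delta>) \<omega> - W s \<omega>))) - V (Z \<omega>)) \<and>
      \<bar>expectation (\<lambda>\<omega>. V (Z \<omega> + (\<mu> * \<delta> + \<sigma> * (W (s + \<delta>) \<omega> - W s \<omega>))) - V (Z \<omega>))
        - \<delta> * (\<gamma> - expectation (\<lambda>\<omega>. h (proj (Z \<omega>))))\<bar> \<le> C * sqrt \<delta> ^ 3"
proof -
  obtain C2 where C2: "\<And>x. \<bar>V2 x\<bar> \<le> C2" using V2_bounded by blast
  obtain Ch where Ch: "\<And>x. h (proj x) \<le> Ch" using h_clamp_bounded by blast
  define C where "C = C2 * \<mu>\<^sup>2 / 2 + L * (4 * (\<mu> ^ 3 + \<sigma> ^ 3 * (2 * sqrt (2 / pi))))"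
  have C2n: "0 \<le> C2" using C2[of 0] by simp
  have Cn: "0 \<le> C" unfolding C_def using C2n L_nonneg pos by (intro add_nonneg_nonneg mult_nonneg_nonneg) auto
  show thesis
  proof (rule that[of C])
    show "0 \<le> C" by fact
    fix Z :: "'w \<Rightarrow> real" and s \<delta> :: real
    assume Z: "Z \<in> borel_measurable (F s)" and s: "0 \<le> s" and \<delta>: "0 < \<delta>" "\<delta> \<le> 1"
    have s': "s < s + \<delta>" using \<delta> by simp
    define D where "D \<omega> = W (s + \<delta>) \<omega> - W s \<omega>" for \<omega>
    define \<xi> where "\<xi> \<omega> = \<mu> * \<delta> + \<sigma> * D \<omega>" for \<omega>
    define b1 where "b1 \<omega> = V1 (Z \<omega>)" for \<omega>
    define b2 where "b2 \<omega> = V2 (Z \<omega>)" for \<omega>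
    \<comment> \<open>the Taylor remainder\<close>
    define R where "R \<omega> = V (Z \<omega> + \<xi> \<omega>) - V (Z \<omega>) - b1 \<omega> * \<xi> \<omega> - b2 \<omega> * (\<xi> \<omega>)\<^sup>2 / 2" for \<omega>
    have [measurable]: "Z \<in> borel_measurable M" by (rule measurable_F_M[OF Z])
    have Dm [measurable]: "D \<in> borel_measurable M"
      unfolding D_def[abs_def] using s \<delta> by (intro borel_measurable_diff W_measurable) auto
    have bF: "b1 \<in> borel_measurable (F s)" "b2 \<in> borel_measurable (F s)"
      unfolding b1_def[abs_def] b2_def[abs_def]
      by (rule measurable_compose[OF Z measurable_parts(2)] measurable_compose[OF Z measurable_parts(3)])+
    have bb: "\<bar>b1 \<omega>\<bar> \<le> k + l" "\<bar>b2 \<omega>\<bar> \<le> C2" for \<omega>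
      using V1_bounds[of "Z \<omega>"] C2 pos by (auto simp: b1_def b2_def)
    note m1 = bounded_times_increment[OF s s' bF(1) bb(1), folded D_def]
    note m2 = bounded_times_increment[OF s s' bF(2) bb(2), folded D_def]
    note mD = increment_moments[OF s s', folded D_def]
    have ib [simp]: "integrable M b1" "integrable M b2"
      using integrable_const_bound[OF AE_I2, OF _ measurable_F_M[OF bF(1)], of "k + l"]
        integrable_const_bound[OF AE_I2, OF _ measurable_F_M[OF bF(2)], of C2] bb by simp_all
    have e1: "(\<lambda>\<omega>. b1 \<omega> * \<xi> \<omega>) = (\<lambda>\<omega>. \<mu> * \<delta> * b1 \<omega> + \<sigma> * (b1 \<omega> * D \<omega>))"
      by (simp add: \<xi>_def algebra_simps fun_eq_iff)
    have e2: "(\<lambda>\<omega>. b2 \<omega> * (\<xi> \<omega>)\<^sup>2) =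
        (\<lambda>\<omega>. (\<mu> * \<delta>)\<^sup>2 * b2 \<omega> + 2 * \<mu> * \<delta> * \<sigma> * (b2 \<omega> * D \<omega>) + \<sigma>\<^sup>2 * (b2 \<omega> * (D \<omega>)\<^sup>2))"
      by (simp add: \<xi>_def algebra_simps fun_eq_iff power2_eq_square)
    have i1: "integrable M (\<lambda>\<omega>. b1 \<omega> * \<xi> \<omega>)" and E1: "expectation (\<lambda>\<omega>. b1 \<omega> * \<xi> \<omega>) = \<mu> * \<delta> * expectation b1"
      unfolding e1 using m1(1,2) by simp_all
    have i2: "integrable M (\<lambda>\<omega>. b2 \<omega> * (\<xi> \<omega>)\<^sup>2)"
      and E2: "expectation (\<lambda>\<omega>. b2 \<omega> * (\<xi> \<omega>)\<^sup>2) = (\<mu> * \<delta>)\<^sup>2 * expectation b2 + \<sigma>\<^sup>2 * (\<delta> * expectation b2)"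
      unfolding e2 using m2 by simp_all
    have sq: "\<delta> = (sqrt \<delta>)\<^sup>2" using \<delta> by simp
    have sq1: "sqrt \<delta> \<le> 1" using \<delta> by simp
    have \<xi>3: "\<bar>\<xi> \<omega>\<bar> ^ 3 \<le> 4 * ((\<mu> * \<delta>) ^ 3 + \<sigma> ^ 3 * \<bar>D \<omega>\<bar> ^ 3)" for \<omega>
    proof -
      have cube: "(p + q) ^ 3 \<le> 4 * (p ^ 3 + q ^ 3)" if "0 \<le> p" "0 \<le> q" for p q :: real
      proof -
        have "0 \<le> 3 * ((p + q) * (p - q)\<^sup>2)" using that by simp
        then show ?thesis by (simp add: power2_eq_square power3_eq_cube algebra_simps)
      qed
      have "\<bar>\<xi> \<omega>\<bar> \<le> \<mu> * \<delta> + \<sigma> * \<bar>D \<omega>\<bar>"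
        using pos \<delta> abs_triangle_ineq[of "\<mu> * \<delta>" "\<sigma> * D \<omega>"] by (simp add: \<xi>_def abs_mult)
      then have "\<bar>\<xi> \<omega>\<bar> ^ 3 \<le> (\<mu> * \<delta> + \<sigma> * \<bar>D \<omega>\<bar>) ^ 3" by (intro power_mono) auto
      also have "\<dots> \<le> 4 * ((\<mu> * \<delta>) ^ 3 + (\<sigma> * \<bar>D \<omega>\<bar>) ^ 3)" using pos \<delta> by (intro cube) auto
      finally show ?thesis by (simp add: power_mult_distrib)
    qed
    have R3: "\<bar>R \<omega>\<bar> \<le> L * (4 * ((\<mu> * \<delta>) ^ 3 + \<sigma> ^ 3 * \<bar>D \<omega>\<bar> ^ 3))" for \<omega>
      using order_trans[OF V_taylor mult_left_mono[OF \<xi>3 L_nonneg]] by (simp add: R_def b1_def b2_def)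
    have iB: "integrable M (\<lambda>\<omega>. L * (4 * ((\<mu> * \<delta>) ^ 3 + \<sigma> ^ 3 * \<bar>D \<omega>\<bar> ^ 3)))" using mD(5) by simp
    have Rm: "R \<in> borel_measurable M"
      unfolding R_def[abs_def] b1_def[abs_def] b2_def[abs_def] \<xi>_def[abs_def] by measurable
    have iR: "integrable M R"
      by (rule Bochner_Integration.integrable_bound[OF iB Rm]) (use R3 in \<open>auto intro!: AE_I2 order_trans[OF _ abs_ge_self]\<close>)
    have "\<bar>expectation R\<bar> \<le> expectation (\<lambda>\<omega>. L * (4 * ((\<mu> * \<delta>) ^ 3 + \<sigma> ^ 3 * \<bar>D \<omega>\<bar> ^ 3)))"
      using R3 by (intro order_trans[OF integral_abs_bound] integral_mono iB integrable_abs iR) auto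
    also have "\<dots> = L * (4 * ((\<mu> * \<delta>) ^ 3 + \<sigma> ^ 3 * (2 * sqrt (2 / pi) * sqrt \<delta> ^ 3)))"
      using mD(5,6) prob_space by simp
    also have "\<dots> \<le> L * (4 * (\<mu> ^ 3 + \<sigma> ^ 3 * (2 * sqrt (2 / pi)))) * sqrt \<delta> ^ 3"
    proof -
      have "\<delta> ^ 3 \<le> sqrt \<delta> ^ 3" using \<delta> sq1 by (intro power_mono) (auto simp: real_le_rsqrt power2_eq_square mult_left_le)
      then have "\<mu> ^ 3 * \<delta> ^ 3 \<le> \<mu> ^ 3 * sqrt \<delta> ^ 3" using pos by (intro mult_left_mono) auto
      then have "4 * ((\<mu> * \<delta>) ^ 3 + \<sigma> ^ 3 * (2 * sqrt (2 / pi) * sqrt \<delta> ^ 3))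
          \<le> 4 * (\<mu> ^ 3 + \<sigma> ^ 3 * (2 * sqrt (2 / pi))) * sqrt \<delta> ^ 3"
        by (simp add: power_mult_distrib algebra_simps)
      from mult_left_mono[OF this L_nonneg] show ?thesis by (simp add: mult.assoc)
    qed
    finally have ER: "\<bar>expectation R\<bar> \<le> L * (4 * (\<mu> ^ 3 + \<sigma> ^ 3 * (2 * sqrt (2 / pi)))) * sqrt \<delta> ^ 3" .
    have V_eq: "(\<lambda>\<omega>. V (Z \<omega> + \<xi> \<omega>) - V (Z \<omega>)) = (\<lambda>\<omega>. b1 \<omega> * \<xi> \<omega> + b2 \<omega> * (\<xi> \<omega>)\<^sup>2 / 2 + R \<omega>)"
      by (simp add: R_def fun_eq_iff)
    have iV: "integrable M (\<lambda>\<omega>. V (Z \<omega> + \<xi> \<omega>) - V (Z \<omega>))"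
      unfolding V_eq using i1 i2 iR by simp
    have EV: "expectation (\<lambda>\<omega>. V (Z \<omega> + \<xi> \<omega>) - V (Z \<omega>)) =
        \<mu> * \<delta> * expectation b1 + ((\<mu> * \<delta>)\<^sup>2 * expectation b2 + \<sigma>\<^sup>2 * (\<delta> * expectation b2)) / 2 + expectation R"
      unfolding V_eq using i1 i2 iR E1 E2 by simp
    have ih: "integrable M (\<lambda>\<omega>. h (proj (Z \<omega>)))"
      by (rule integrable_const_bound[of _ Ch]) (use Ch h_nonneg in auto)
    have "expectation (\<lambda>\<omega>. \<sigma>\<^sup>2 / 2 * b2 \<omega> + \<mu> * b1 \<omega> + h (proj (Z \<omega>))) = \<gamma>"
      unfolding b1_def b2_def generator using prob_space by simp
    then have gen: "\<sigma>\<^sup>2 / 2 * expectation b2 + \<mu> * expectation b1 = \<gamma> - expectation (\<lambda>\<omega>. h (proj (Z \<omega>)))"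
      using ih by simp
    have "expectation (\<lambda>\<omega>. V (Z \<omega> + \<xi> \<omega>) - V (Z \<omega>)) - \<delta> * (\<gamma> - expectation (\<lambda>\<omega>. h (proj (Z \<omega>))))
        = (\<mu> * \<delta>)\<^sup>2 * expectation b2 / 2 + expectation R"
      unfolding EV gen[symmetric] by (simp add: algebra_simps)
    also have "\<bar>\<dots>\<bar> \<le> C2 * \<mu>\<^sup>2 / 2 * sqrt \<delta> ^ 3 + L * (4 * (\<mu> ^ 3 + \<sigma> ^ 3 * (2 * sqrt (2 / pi)))) * sqrt \<delta> ^ 3"
    proof (rule order_trans[OF abs_triangle_ineq add_mono[OF _ ER]])
      have "\<bar>expectation b2\<bar> \<le> expectation (\<lambda>_. C2)"
        using bb(2) by (intro order_trans[OF integral_abs_bound] integral_mono integrable_abs ib) auto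
      then have Eb: "\<bar>expectation b2\<bar> \<le> C2" using prob_space by simp
      have "\<delta>\<^sup>2 = sqrt \<delta> ^ 4" using \<delta> by (simp add: power4_eq_xxxx power2_eq_square)
      also have "\<dots> \<le> sqrt \<delta> ^ 3" using sq1 \<delta> by (intro power_decreasing) auto
      finally have d2: "\<delta>\<^sup>2 \<le> sqrt \<delta> ^ 3" .
      have "\<bar>(\<mu> * \<delta>)\<^sup>2 * expectation b2 / 2\<bar> = \<mu>\<^sup>2 / 2 * (\<bar>expectation b2\<bar> * \<delta>\<^sup>2)"
        by (simp add: abs_mult power_mult_distrib)
      also have "\<dots> \<le> \<mu>\<^sup>2 / 2 * (C2 * sqrt \<delta> ^ 3)"
        using Eb d2 C2n by (intro mult_left_mono mult_mono) auto
      finally show "\<bar>(\<mu> * \<delta>)\<^sup>2 * expectation b2 / 2\<bar> \<le> C2 * \<mu>\<^sup>2 / 2 * sqrt \<delta> ^ 3" by (simp add: algebra_simps)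
    qed
    finally have "\<bar>expectation (\<lambda>\<omega>. V (Z \<omega> + \<xi> \<omega>) - V (Z \<omega>))
        - \<delta> * (\<gamma> - expectation (\<lambda>\<omega>. h (proj (Z \<omega>))))\<bar> \<le> C * sqrt \<delta> ^ 3"
      by (simp add: C_def algebra_simps)
    with iV show "integrable M (\<lambda>\<omega>. V (Z \<omega> + (\<mu> * \<delta> + \<sigma> * (W (s + \<delta>) \<omega> - W s \<omega>))) - V (Z \<omega>)) \<and>
      \<bar>expectation (\<lambda>\<omega>. V (Z \<omega> + (\<mu> * \<delta> + \<sigma> * (W (s + \<delta>) \<omega> - W s \<omega>))) - V (Z \<omega>))
        - \<delta> * (\<gamma> - expectation (\<lambda>\<omega>. h (proj (Z \<omega>))))\<bar> \<le> C * sqrt \<delta> ^ 3"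
      unfolding \<xi>_def D_def by blast
  qed
qed

end

section \<open>Riemann sums\<close>

lemma step_function_integral:
  fixes c :: "nat \<Rightarrow> real"
  assumes \<delta>: "0 < \<delta>"
  shows "has_bochner_integral lborel (\<lambda>s. indicator {0..<real N * \<delta>} s * c (nat \<lfloor>s / \<delta>\<rfloor>)) (\<delta> * (\<Sum>i<N. c i))"
proof (induction N)
  case 0 show ?case by (simp add: has_bochner_integral_zero)
next
  case (Suc N)
  let ?A = "{real N * \<delta>..<real (Suc N) * \<delta>}"
  have fl: "nat \<lfloor>s / \<delta>\<rfloor> = N" if "s \<in> ?A" for s
  proof -
    have "real N \<le> s / \<delta>" "s / \<delta> < real N + 1" using that \<delta> by (auto simp: field_simps)
    then have "\<lfloor>s / \<delta>\<rfloor> = int N" by (intro floor_unique) auto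
    then show ?thesis by simp
  qed
  have "has_bochner_integral lborel (indicator ?A :: real \<Rightarrow> real) (measure lborel ?A)"
    by (rule has_bochner_integral_real_indicator) (use \<delta> in \<open>auto simp: algebra_simps\<close>)
  then have "has_bochner_integral lborel (\<lambda>s. indicator ?A s * c N) (\<delta> * c N)"
    using \<delta> has_bochner_integral_mult_left[of "c N" lborel "indicator ?A"] by (fastforce simp: algebra_simps)
  from has_bochner_integral_add[OF Suc this]
  have "has_bochner_integral lborel (\<lambda>s. indicator {0..<real N * \<delta>} s * c (nat \<lfloor>s / \<delta>\<rfloor>) + indicator ?A s * c N)
      (\<delta> * (\<Sum>i<Suc N. c i))"
    by (simp add: algebra_simps)
  moreover have "(\<lambda>s. indicator {0..<real N * \<delta>} s * c (nat \<lfloor>s / \<delta>\<rfloor>) + indicator ?A s * c N) =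
      (\<lambda>s. indicator {0..<real (Suc N) * \<delta>} s * c (nat \<lfloor>s / \<delta>\<rfloor>))"
  proof
    fix s
    have le: "0 \<le> real N * \<delta>" "real N * \<delta> \<le> real (Suc N) * \<delta>" using \<delta> by (auto simp: algebra_simps)
    consider "s < 0" | "s \<in> {0..<real N * \<delta>}" | "s \<in> ?A" | "real (Suc N) * \<delta> \<le> s" by force
    then show "indicator {0..<real N * \<delta>} s * c (nat \<lfloor>s / \<delta>\<rfloor>) + indicator ?A s * c N =
      indicator {0..<real (Suc N) * \<delta>} s * c (nat \<lfloor>s / \<delta>\<rfloor>)"
      using le fl[of s] by cases (auto simp: indicator_def)
  qed
  ultimately show ?case by simp
qed

text \<open>A Riemann sum is the integral of a step function that samples \<open>f\<close> at the grid point to the left of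
  \<open>s\<close>; it converges at every continuity point, hence almost everywhere.\<close>

lemma riemann_sums_tendsto:
  fixes f :: "real \<Rightarrow> real"
  assumes t: "0 < t" and m: "(\<lambda>s. indicator {0..<t} s * f s) \<in> borel_measurable borel"
    and b: "\<And>s. \<bar>f s\<bar> \<le> C" and D: "countable D" "\<And>s. 0 \<le> s \<Longrightarrow> s \<notin> D \<Longrightarrow> isCont f s"
  shows "(\<lambda>n. t / real (Suc n) * (\<Sum>i<Suc n. f (real i * (t / real (Suc n)))))
    \<longlonglongrightarrow> (LINT s|lborel. indicator {0..<t} s * f s)"
proof -
  define \<delta> where "\<delta> n = t / real (Suc n)" for n
  have \<delta>: "0 < \<delta> n" "real (Suc n) * \<delta> n = t" for n using t by (simp_all add: \<delta>_def)
  define g where "g n s = indicator {0..<t} s * f (real (nat \<lfloor>s / \<delta> n\<rfloor>) * \<delta> n)" for n s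
  have step: "has_bochner_integral lborel (g n) (\<delta> n * (\<Sum>i<Suc n. f (real i * \<delta> n)))" for n
    using step_function_integral[OF \<delta>(1)[of n], of "Suc n" "\<lambda>i. f (real i * \<delta> n)"] unfolding \<delta>(2) g_def[abs_def] .
  have "(\<lambda>n. LINT s|lborel. g n s) \<longlonglongrightarrow> (LINT s|lborel. indicator {0..<t} s * f s)"
  proof (rule integral_dominated_convergence[where w = "\<lambda>s. indicator {0..<t} s * C"])
    show "(\<lambda>s. indicator {0..<t} s * f s) \<in> borel_measurable lborel" using m by simp
    show "g n \<in> borel_measurable lborel" for n using step[of n] by (rule borel_measurable_has_bochner_integral)
    show "integrable lborel (\<lambda>s. indicator {0..<t} s * C)"
      using t by (intro integrable_mult_left integrable_real_indicator) auto
    show "AE s in lborel. norm (g n s) \<le> indicator {0..<t} s * C" for n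
      using b by (intro AE_I2) (auto simp: g_def indicator_def)
    have "AE s in lborel. s \<notin> D" by (intro AE_not_in countable_imp_null_set_lborel D)
    then show "AE s in lborel. (\<lambda>n. g n s) \<longlonglongrightarrow> indicator {0..<t} s * f s"
    proof eventually_elim
      case (elim s)
      show ?case
      proof (cases "s \<in> {0..<t}")
        case True
        have "(\<lambda>n. real (nat \<lfloor>s / \<delta> n\<rfloor>) * \<delta> n) \<longlonglongrightarrow> s"
        proof (rule real_tendsto_sandwich[of "\<lambda>n. s - \<delta> n" _ _ "\<lambda>_. s"])
          have fl: "real (nat \<lfloor>s / \<delta> n\<rfloor>) \<le> s / \<delta> n" "s / \<delta> n < real (nat \<lfloor>s / \<delta> n\<rfloor>) + 1" for n
            using True \<delta>(1)[of n] by simp_all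
          show "\<forall>\<^sub>F n in sequentially. s - \<delta> n \<le> real (nat \<lfloor>s / \<delta> n\<rfloor>) * \<delta> n"
            "\<forall>\<^sub>F n in sequentially. real (nat \<lfloor>s / \<delta> n\<rfloor>) * \<delta> n \<le> s"
            using fl \<delta>(1) by (auto intro!: always_eventually simp: field_simps less_imp_le)
          have "\<delta> \<longlonglongrightarrow> 0" unfolding \<delta>_def[abs_def]
            by (rule LIMSEQ_Suc[OF lim_const_over_n])
          then show "(\<lambda>n. s - \<delta> n) \<longlonglongrightarrow> s" using tendsto_diff[OF tendsto_const[of s]] by fastforce
        qed auto
        then have "(\<lambda>n. f (real (nat \<lfloor>s / \<delta> n\<rfloor>) * \<delta> n)) \<longlonglongrightarrow> f s"
          by (rule isCont_tendsto_compose[OF D(2)[of s], rotated -1]) (use elim True in auto)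
        then show ?thesis using True by (simp add: g_def)
      qed (simp add: g_def)
    qed
  qed
  moreover have "(LINT s|lborel. g n s) = \<delta> n * (\<Sum>i<Suc n. f (real i * \<delta> n))" for n
    using step[of n] by (rule has_bochner_integral_integral_eq)
  ultimately show ?thesis unfolding \<delta>_def by simp
qed

section \<open>Lower bound for an arbitrary feasible policy\<close>

context brownian begin

lemma W_integrable: assumes "0 \<le> t" shows "integrable M (W t)"
proof (cases "t = 0")
  case True
  have "integrable M (\<lambda>_. 0 :: real)" by simp
  then show ?thesis by (rule Bochner_Integration.integrable_cong[THEN iffD1, rotated -1]) (simp_all add: W_path True)
next
  case False
  then have "integrable M (\<lambda>\<omega>. W t \<omega> - W 0 \<omega>)" using assms by (intro increment_moments) auto
  then show ?thesis by (rule Bochner_Integration.integrable_cong[THEN iffD1, rotated -1]) (simp_all add: W_path)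
qed

end

context controlled_brownian begin

lemma V_comp_integrable: assumes X: "integrable M X" shows "integrable M (\<lambda>\<omega>. V (X \<omega>))"
proof (rule Bochner_Integration.integrable_bound)
  show "integrable M (\<lambda>\<omega>. \<bar>V 0\<bar> + (k + l) * \<bar>X \<omega>\<bar>)" using X by simp
  show "(\<lambda>\<omega>. V (X \<omega>)) \<in> borel_measurable M" using X by measurable
  show "AE \<omega> in M. norm (V (X \<omega>)) \<le> norm (\<bar>V 0\<bar> + (k + l) * \<bar>X \<omega>\<bar>)"
    using V_abs_le by (intro AE_I2) (auto intro: order_trans[OF _ abs_ge_self])
qed

end

locale feasible_policy = controlled_brownian +
  fixes x :: real and \<phi> :: "'a policy"
  assumes feas: "feasible M F \<phi>"
begin

abbreviation "Y1 \<equiv> fst \<phi>"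
abbreviation "Y2 \<equiv> snd \<phi>"
abbreviation "Z \<equiv> inventory \<mu> \<sigma> W x \<phi>"

lemma Y_measurable_F: "0 \<le> t \<Longrightarrow> Y1 t \<in> borel_measurable (F t)" "0 \<le> t \<Longrightarrow> Y2 t \<in> borel_measurable (F t)"
  using feas unfolding feasible_def control_process_def adapted_def by blast+

lemma Y_integrable: "0 \<le> t \<Longrightarrow> integrable M (Y1 t)" "0 \<le> t \<Longrightarrow> integrable M (Y2 t)"
  using feas unfolding feasible_def by blast+

lemma Y_path:
  assumes "\<omega> \<in> space M"
  shows "mono (\<lambda>t. Y1 t \<omega>)" "mono (\<lambda>t. Y2 t \<omega>)" "rcll (\<lambda>t. Y1 t \<omega>)" "rcll (\<lambda>t. Y2 t \<omega>)"
    "t < 0 \<Longrightarrow> Y1 t \<omega> = 0" "t < 0 \<Longrightarrow> Y2 t \<omega> = 0"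
  using feas assms unfolding feasible_def control_process_def by blast+

lemma Y_nonneg: assumes "\<omega> \<in> space M" shows "0 \<le> Y1 t \<omega>" "0 \<le> Y2 t \<omega>"
proof -
  have "Y1 (min t (-1)) \<omega> \<le> Y1 t \<omega>" "Y2 (min t (-1)) \<omega> \<le> Y2 t \<omega>"
    using Y_path(1,2)[OF assms] by (auto elim!: monoD)
  then show "0 \<le> Y1 t \<omega>" "0 \<le> Y2 t \<omega>" using Y_path(5,6)[OF assms, of "min t (-1)"] by simp_all
qed

lemma Z_eq: "Z t \<omega> = x + \<mu> * t + \<sigma> * W t \<omega> + Y1 t \<omega> - Y2 t \<omega>"
  by (simp add: inventory_def drifted_bm_def)

lemma Z_measurable_F: "0 \<le> t \<Longrightarrow> Z t \<in> borel_measurable (F t)"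
  unfolding Z_eq[abs_def]
  by (intro borel_measurable_add borel_measurable_diff borel_measurable_times borel_measurable_const
      W_measurable_F Y_measurable_F)

lemma Z_measurable [measurable]: "0 \<le> t \<Longrightarrow> Z t \<in> borel_measurable M"
  by (rule measurable_F_M[OF Z_measurable_F])

lemma Z_integrable: "0 \<le> t \<Longrightarrow> integrable M (Z t)"
  unfolding Z_eq[abs_def] using W_integrable[of t] Y_integrable[of t] by simp

lemma VZ_integrable: "0 \<le> t \<Longrightarrow> integrable M (\<lambda>\<omega>. V (Z t \<omega>))"
  by (rule V_comp_integrable[OF Z_integrable])

lemma hZ_integrable: "0 \<le> t \<Longrightarrow> integrable M (\<lambda>\<omega>. h (proj (Z t \<omega>)))"
proof -
  assume t: "0 \<le> t"
  note [measurable] = Z_measurable[OF t]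
  obtain C where C: "\<And>x. h (proj x) \<le> C" using h_clamp_bounded by blast
  show ?thesis by (rule integrable_const_bound[of _ C]) (use C h_nonneg in auto)
qed

lemma Z_right_cont:
  assumes "\<omega> \<in> space M" "0 \<le> s" shows "((\<lambda>r. Z r \<omega>) \<longlongrightarrow> Z s \<omega>) (at_right s)"
proof -
  have "((\<lambda>r. W r \<omega>) \<longlongrightarrow> W s \<omega>) (at s within {0..})"
    using W_path(2)[OF assms(1)] assms(2) by (auto simp: continuous_on_def)
  then have "((\<lambda>r. W r \<omega>) \<longlongrightarrow> W s \<omega>) (at_right s)"
    by (rule tendsto_within_subset) (use assms(2) in auto)
  moreover have "((\<lambda>r. Y1 r \<omega>) \<longlongrightarrow> Y1 s \<omega>) (at_right s)" "((\<lambda>r. Y2 r \<omega>) \<longlongrightarrow> Y2 s \<omega>) (at_right s)"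
    using Y_path(3,4)[OF assms(1)] assms(2) unfolding rcll_def continuous_within by blast+
  ultimately show ?thesis unfolding Z_eq by (intro tendsto_intros)
qed

text \<open>By right continuity, \<open>Z\<close> is the limit of processes that sample it at the next grid point strictly
  after \<open>s\<close>.\<close>

lemma Z_joint_measurable [measurable]:
  "(\<lambda>(s, \<omega>). indicator {0..} s * Z s \<omega>) \<in> borel_measurable (lborel \<Otimes>\<^sub>M M)"
proof (rule borel_measurable_LIMSEQ_real)
  let ?u = "\<lambda>n (s, \<omega>). indicator {0..} s * Z ((real (grid_floor n s) + 1) / 2 ^ n) \<omega>"
  show "(\<lambda>n. ?u n p) \<longlonglongrightarrow> (case p of (s, \<omega>) \<Rightarrow> indicator {0..} s * Z s \<omega>)"
    if "p \<in> space (lborel \<Otimes>\<^sub>M M)" for p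
  proof -
    obtain s \<omega> where p: "p = (s, \<omega>)" by (cases p)
    have "\<omega> \<in> space M" using that by (simp add: p space_pair_measure)
    note p = p this
    show ?thesis
    proof (cases "0 \<le> s")
      case True
      have "(\<lambda>n. real (grid_floor n s) / 2 ^ n + (1/2) ^ n) \<longlonglongrightarrow> s + 0"
        by (intro tendsto_intros grid_floor_tendsto True LIMSEQ_realpow_zero) auto
      then have "(\<lambda>n. (real (grid_floor n s) + 1) / 2 ^ n) \<longlonglongrightarrow> s"
        by (simp add: add_divide_distrib power_divide)
      moreover have "s < (real (grid_floor n s) + 1) / 2 ^ n" for n
        using grid_floor_less[OF True, of n] by (simp add: add_divide_distrib)
      ultimately have "filterlim (\<lambda>n. (real (grid_floor n s) + 1) / 2 ^ n) (at_right s) sequentially"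
        by (intro tendsto_imp_filterlim_at_right always_eventually allI)
      from filterlim_compose[OF Z_right_cont[OF p(2) True] this]
      show ?thesis using True by (simp add: p)
    qed (simp add: p)
  qed
  fix n
  have "(\<lambda>p. Z ((real (grid_floor n (fst p)) + 1) / 2 ^ n) (snd p)) \<in> borel_measurable (lborel \<Otimes>\<^sub>M M)"
  proof (rule measurable_compose_countable'[where I = UNIV and g = "\<lambda>p. grid_floor n (fst p)"
        and f = "\<lambda>i p. Z ((real i + 1) / 2 ^ n) (snd p)"])
    fix i :: nat
    have "Z ((real i + 1) / 2 ^ n) \<in> borel_measurable M" by (rule Z_measurable) simp
    from measurable_compose[OF measurable_snd this]
    show "(\<lambda>p. Z ((real i + 1) / 2 ^ n) (snd p)) \<in> borel_measurable (lborel \<Otimes>\<^sub>M M)" .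
    show "(\<lambda>p. grid_floor n (fst p)) \<in> lborel \<Otimes>\<^sub>M M \<rightarrow>\<^sub>M count_space UNIV"
      unfolding grid_floor_def by measurable
  qed auto
  then show "?u n \<in> borel_measurable (lborel \<Otimes>\<^sub>M M)" by (simp add: split_beta') measurable
qed

text \<open>The holding cost accumulated up to time \<open>t\<close> when \<open>h\<close> is truncated outside the band. Unlike the
  actual holding cost it is bounded, so that its Riemann sums converge in mean.\<close>

definition J :: "real \<Rightarrow> 'a \<Rightarrow> real" where
  "J t \<omega> = (LINT s|lborel. indicator {0..<t} s * h (proj (Z s \<omega>)))"

lemma Z_path_measurable:
  assumes "\<omega> \<in> space M" shows "(\<lambda>s. indicator {0..} s * Z s \<omega>) \<in> borel_measurable borel"
  using measurable_compose[OF measurable_Pair2'[of \<omega> M lborel] Z_joint_measurable] assms by simp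

lemma hZ_path_measurable:
  assumes "\<omega> \<in> space M" "A \<subseteq> {0..}" "A \<in> sets borel" "f \<in> borel_measurable borel"
  shows "(\<lambda>s. indicator A s * (f (Z s \<omega>) :: real)) \<in> borel_measurable borel"
proof -
  note [measurable] = Z_path_measurable[OF assms(1)] assms(3,4)
  have "(\<lambda>s. indicator A s * f (Z s \<omega>)) = (\<lambda>s. indicator A s * f (indicator {0..} s * Z s \<omega>))"
    using assms(2) by (auto simp: indicator_def fun_eq_iff)
  also have "\<dots> \<in> borel_measurable borel" by measurable
  finally show ?thesis .
qed

text \<open>A monotone path has only countably many discontinuities.\<close>

lemma riemann_J:
  assumes "0 < t" "\<omega> \<in> space M"
  shows "(\<lambda>n. t / real (Suc n) * (\<Sum>i<Suc n. h (proj (Z (real i * (t / real (Suc n))) \<omega>)))) \<longlonglongrightarrow> J t \<omega>"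
proof -
  obtain C where C: "\<And>x. h (proj x) \<le> C" using h_clamp_bounded by blast
  have hp: "h (proj y) \<ge> 0" for y by (rule h_nonneg)
  let ?D = "{a. \<not> isCont (\<lambda>s. Y1 s \<omega>) a} \<union> {a. \<not> isCont (\<lambda>s. Y2 s \<omega>) a} \<union> {0}"
  show ?thesis unfolding J_def
  proof (rule riemann_sums_tendsto[OF assms(1), where C = C and D = ?D])
    show "\<bar>h (proj (Z s \<omega>))\<bar> \<le> C" for s using C hp by simp
    show "countable ?D" using mono_ctble_discont[OF Y_path(1)[OF assms(2)]] mono_ctble_discont[OF Y_path(2)[OF assms(2)]] by simp
    show "(\<lambda>s. indicator {0..<t} s * h (proj (Z s \<omega>))) \<in> borel_measurable borel"
      by (rule hZ_path_measurable[OF assms(2)]) auto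
    fix s :: real assume s: "0 \<le> s" "s \<notin> ?D"
    have W: "isCont (\<lambda>s. W s \<omega>) s"
      using continuous_on_interior[OF W_path(2)[OF assms(2)], of s] s by simp
    have "isCont (\<lambda>s. Z s \<omega>) s" unfolding Z_eq using s W by (intro continuous_intros) auto
    moreover have "isCont (\<lambda>y. h (proj y)) (Z s \<omega>)"
      using continuous_parts(4) by (simp add: continuous_on_eq_continuous_at)
    ultimately show "isCont (\<lambda>s. h (proj (Z s \<omega>))) s" by (rule isCont_o2)
  qed
qed

lemma J_measurable [measurable]: assumes "0 < t" shows "J t \<in> borel_measurable M"
proof (rule borel_measurable_LIMSEQ_real[OF riemann_J[OF assms]])
  fix n
  have hp: "(\<lambda>y. h (proj y)) \<in> borel_measurable borel" by measurable
  have m: "(\<lambda>\<omega>. h (proj (Z (real i * (t / real (Suc n))) \<omega>))) \<in> borel_measurable M" for i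
    using assms by (intro measurable_compose[OF Z_measurable hp]) simp
  show "(\<lambda>\<omega>. t / real (Suc n) * (\<Sum>i<Suc n. h (proj (Z (real i * (t / real (Suc n))) \<omega>)))) \<in> borel_measurable M"
    by (intro borel_measurable_times borel_measurable_sum borel_measurable_const m)
qed

text \<open>The uncontrolled increment contributes the expansion of \<open>one_step\<close>, and the controls exerted during
  the step, taken together at its end, contribute at most their cost.\<close>

lemma lower_step:
  obtains C where "C \<ge> 0"
    "\<And>s \<delta>. 0 \<le> s \<Longrightarrow> 0 < \<delta> \<Longrightarrow> \<delta> \<le> 1 \<Longrightarrow>
      expectation (\<lambda>\<omega>. V (Z s \<omega>)) + k * expectation (Y1 s) + l * expectation (Y2 s)
        + \<delta> * (\<gamma> - expectation (\<lambda>\<omega>. h (proj (Z s \<omega>)))) - C * sqrt \<delta> ^ 3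
      \<le> expectation (\<lambda>\<omega>. V (Z (s + \<delta>) \<omega>)) + k * expectation (Y1 (s + \<delta>)) + l * expectation (Y2 (s + \<delta>))"
proof -
  obtain C where C: "C \<ge> 0"
    "\<And>Z s \<delta>. Z \<in> borel_measurable (F s) \<Longrightarrow> 0 \<le> s \<Longrightarrow> 0 < \<delta> \<Longrightarrow> \<delta> \<le> 1 \<Longrightarrow>
      integrable M (\<lambda>\<omega>. V (Z \<omega> + (\<mu> * \<delta> + \<sigma> * (W (s + \<delta>) \<omega> - W s \<omega>))) - V (Z \<omega>)) \<and>
      \<bar>expectation (\<lambda>\<omega>. V (Z \<omega> + (\<mu> * \<delta> + \<sigma> * (W (s + \<delta>) \<omega> - W s \<omega>))) - V (Z \<omega>))
        - \<delta> * (\<gamma> - expectation (\<lambda>\<omega>. h (proj (Z \<omega>))))\<bar> \<le> C * sqrt \<delta> ^ 3"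
    using one_step by blast
  show thesis
  proof (rule that[OF C(1)])
    fix s \<delta> :: real assume s: "0 \<le> s" "0 < \<delta>" "\<delta> \<le> 1"
    let ?X = "\<lambda>\<omega>. Z s \<omega> + (\<mu> * \<delta> + \<sigma> * (W (s + \<delta>) \<omega> - W s \<omega>))"
    note o = C(2)[OF Z_measurable_F[OF s(1)] s]
    have s0: "0 \<le> s + \<delta>" using s by simp
    note i = VZ_integrable[OF s(1)] VZ_integrable[OF s0] Y_integrable[OF s(1)] Y_integrable[OF s0]
    have iX: "integrable M (\<lambda>\<omega>. V (?X \<omega>) - V (Z s \<omega>))" using o by blast
    have "V (?X \<omega>) - V (Z s \<omega>) \<le> V (Z (s + \<delta>) \<omega>) - V (Z s \<omega>) + k * (Y1 (s + \<delta>) \<omega> - Y1 s \<omega>) + l * (Y2 (s + \<delta>) \<omega> - Y2 s \<omega>)"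
      if "\<omega> \<in> space M" for \<omega>
    proof -
      have "0 \<le> Y1 (s + \<delta>) \<omega> - Y1 s \<omega>" "0 \<le> Y2 (s + \<delta>) \<omega> - Y2 s \<omega>"
        using monoD[OF Y_path(1)[OF that], of s "s + \<delta>"] monoD[OF Y_path(2)[OF that], of s "s + \<delta>"] s by simp_all
      from V_push[OF this, of "?X \<omega>"]
      have "V (?X \<omega>) - k * (Y1 (s + \<delta>) \<omega> - Y1 s \<omega>) - l * (Y2 (s + \<delta>) \<omega> - Y2 s \<omega>)
          \<le> V (?X \<omega> + (Y1 (s + \<delta>) \<omega> - Y1 s \<omega>) - (Y2 (s + \<delta>) \<omega> - Y2 s \<omega>))" .
      also have "?X \<omega> + (Y1 (s + \<delta>) \<omega> - Y1 s \<omega>) - (Y2 (s + \<delta>) \<omega> - Y2 s \<omega>) = Z (s + \<delta>) \<omega>"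
        by (simp add: Z_eq algebra_simps)
      finally show ?thesis by simp
    qed
    then have "expectation (\<lambda>\<omega>. V (?X \<omega>) - V (Z s \<omega>)) \<le>
        expectation (\<lambda>\<omega>. V (Z (s + \<delta>) \<omega>) - V (Z s \<omega>) + k * (Y1 (s + \<delta>) \<omega> - Y1 s \<omega>) + l * (Y2 (s + \<delta>) \<omega> - Y2 s \<omega>))"
      using i by (intro integral_mono iX) auto
    also have "\<dots> = expectation (\<lambda>\<omega>. V (Z (s + \<delta>) \<omega>)) - expectation (\<lambda>\<omega>. V (Z s \<omega>))
        + k * (expectation (Y1 (s + \<delta>)) - expectation (Y1 s)) + l * (expectation (Y2 (s + \<delta>)) - expectation (Y2 s))"
      using i by simp
    moreover have "\<delta> * (\<gamma> - expectation (\<lambda>\<omega>. h (proj (Z s \<omega>)))) - C * sqrt \<delta> ^ 3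
        \<le> expectation (\<lambda>\<omega>. V (?X \<omega>) - V (Z s \<omega>))"
      using abs_le_D2[OF o[THEN conjunct2]] by linarith
    ultimately show "expectation (\<lambda>\<omega>. V (Z s \<omega>)) + k * expectation (Y1 s) + l * expectation (Y2 s)
        + \<delta> * (\<gamma> - expectation (\<lambda>\<omega>. h (proj (Z s \<omega>)))) - C * sqrt \<delta> ^ 3
      \<le> expectation (\<lambda>\<omega>. V (Z (s + \<delta>) \<omega>)) + k * expectation (Y1 (s + \<delta>)) + l * expectation (Y2 (s + \<delta>))"
      unfolding right_diff_distrib by linarith
  qed
qed

lemma initial_jump: "V x \<le> expectation (\<lambda>\<omega>. V (Z 0 \<omega>)) + k * expectation (Y1 0) + l * expectation (Y2 0)"
proof -
  note i = VZ_integrable[of 0] Y_integrable[of 0]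
  have "V x \<le> V (Z 0 \<omega>) + k * Y1 0 \<omega> + l * Y2 0 \<omega>" if "\<omega> \<in> space M" for \<omega>
    using V_push[OF Y_nonneg[OF that], of x 0 0] by (simp add: Z_eq W_path(1)[OF that])
  then have "expectation (\<lambda>_. V x) \<le> expectation (\<lambda>\<omega>. V (Z 0 \<omega>) + k * Y1 0 \<omega> + l * Y2 0 \<omega>)"
    using i by (intro integral_mono) auto
  then show ?thesis using i prob_space by simp
qed

text \<open>Summing \<open>lower_step\<close> over a grid of \<open>n + 1\<close> steps of length \<open>t / (n + 1)\<close> leaves an error of
  \<open>C t sqrt (t / (n + 1))\<close> and a Riemann sum for \<open>J\<close>.\<close>

lemma lower_bound:
  assumes t: "0 < t"
  shows "integrable M (J t)"
    "\<gamma> * t + V x - expectation (\<lambda>\<omega>. V (Z t \<omega>)) \<le> expectation (\<lambda>\<omega>. J t \<omega> + k * Y1 t \<omega> + l * Y2 t \<omega>)"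
proof -
  obtain C where C: "C \<ge> 0" and step:
    "\<And>s \<delta>. 0 \<le> s \<Longrightarrow> 0 < \<delta> \<Longrightarrow> \<delta> \<le> 1 \<Longrightarrow>
      expectation (\<lambda>\<omega>. V (Z s \<omega>)) + k * expectation (Y1 s) + l * expectation (Y2 s)
        + \<delta> * (\<gamma> - expectation (\<lambda>\<omega>. h (proj (Z s \<omega>)))) - C * sqrt \<delta> ^ 3
      \<le> expectation (\<lambda>\<omega>. V (Z (s + \<delta>) \<omega>)) + k * expectation (Y1 (s + \<delta>)) + l * expectation (Y2 (s + \<delta>))"
    using lower_step by blast
  obtain B where B: "\<And>x. h (proj x) \<le> B" using h_clamp_bounded by blast
  define S where "S n \<omega> = t / real (Suc n) * (\<Sum>i<Suc n. h (proj (Z (real i * (t / real (Suc n))) \<omega>)))" for n \<omega>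
  define E where "E s = expectation (\<lambda>\<omega>. V (Z s \<omega>)) + k * expectation (Y1 s) + l * expectation (Y2 s)" for s
  have iS: "integrable M (S n)" for n
    unfolding S_def[abs_def] using t
    by (intro integrable_mult_right Bochner_Integration.integrable_sum hZ_integrable) simp
  have S_eq: "expectation (S n) = t / real (Suc n) * (\<Sum>i<Suc n. expectation (\<lambda>\<omega>. h (proj (Z (real i * (t / real (Suc n))) \<omega>))))" for n
  proof -
    have "integrable M (\<lambda>\<omega>. h (proj (Z (real i * (t / real (Suc n))) \<omega>)))" for i
      using t by (intro hZ_integrable) simp
    then show ?thesis
      unfolding S_def[abs_def] by (simp only: integral_mult_right_zero Bochner_Integration.integral_sum)
  qed
  have main: "V x + \<gamma> * t - expectation (S n) - C * t * sqrt (t / real (Suc n)) \<le> E t" if n: "t / real (Suc n) \<le> 1" for n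
  proof -
    define \<delta> where "\<delta> = t / real (Suc n)"
    have \<delta>: "0 < \<delta>" "\<delta> \<le> 1" "real (Suc n) * \<delta> = t" using t n by (simp_all add: \<delta>_def)
    have "E 0 + real i * (\<delta> * \<gamma>) - \<delta> * (\<Sum>j<i. expectation (\<lambda>\<omega>. h (proj (Z (real j * \<delta>) \<omega>)))) - real i * (C * sqrt \<delta> ^ 3) \<le> E (real i * \<delta>)" for i
    proof (induction i)
      case (Suc i)
      have e: "real (Suc i) * \<delta> = real i * \<delta> + \<delta>" by (simp add: algebra_simps)
      have "E (real i * \<delta>) + \<delta> * (\<gamma> - expectation (\<lambda>\<omega>. h (proj (Z (real i * \<delta>) \<omega>)))) - C * sqrt \<delta> ^ 3 \<le> E (real (Suc i) * \<delta>)"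
        unfolding e E_def using step[of "real i * \<delta>" \<delta>] \<delta> by simp
      then show ?case using Suc by (simp add: algebra_simps)
    qed simp
    note * = this[of "Suc n"]
    have e: "real (Suc n) * (\<delta> * \<gamma>) = \<gamma> * t"
      unfolding \<delta>(3)[symmetric] by (simp only: mult.commute mult.left_commute)
    have "E 0 + \<gamma> * t - expectation (S n) - real (Suc n) * (C * sqrt \<delta> ^ 3) \<le> E t"
      using * unfolding S_eq \<delta>_def[symmetric] \<delta>(3) e .
    moreover have "real (Suc n) * (C * sqrt \<delta> ^ 3) = C * t * sqrt \<delta>"
    proof -
      have "sqrt \<delta> ^ 3 = \<delta> * sqrt \<delta>" using \<delta> by (simp add: power3_eq_cube)
      then have "real (Suc n) * (C * sqrt \<delta> ^ 3) = C * (real (Suc n) * \<delta>) * sqrt \<delta>" by (simp add: algebra_simps)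
      then show ?thesis unfolding \<delta>(3) .
    qed
    moreover have "V x \<le> E 0" using initial_jump by (simp add: E_def)
    ultimately show ?thesis unfolding \<delta>_def[symmetric] by linarith
  qed
  have SB: "norm (S n \<omega>) \<le> t * B" for n \<omega>
  proof -
    have "(\<Sum>i<Suc n. h (proj (Z (real i * (t / real (Suc n))) \<omega>))) \<le> (\<Sum>i<Suc n. B)" by (intro sum_mono B)
    then have "S n \<omega> \<le> t / real (Suc n) * (\<Sum>i<Suc n. B)" unfolding S_def using t by (intro mult_left_mono) auto
    also have "\<dots> = t * B" by simp
    finally show ?thesis using t h_nonneg by (simp add: S_def sum_nonneg)
  qed
  have lim: "(\<lambda>n. S n \<omega>) \<longlonglongrightarrow> J t \<omega>" if "\<omega> \<in> space M" for \<omega>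
    unfolding S_def using riemann_J[OF t that] .
  have dom: "integrable M (J t)" "(\<lambda>n. expectation (S n)) \<longlonglongrightarrow> expectation (J t)"
    by (rule integrable_dominated_convergence[where s = S and w = "\<lambda>_. t * B"]
             integral_dominated_convergence[where w = "\<lambda>_. t * B"];
        use J_measurable[OF t] iS SB lim in \<open>auto intro!: AE_I2\<close>)+
  then show "integrable M (J t)" by simp
  have d0: "(\<lambda>n. t / real (Suc n)) \<longlonglongrightarrow> 0" by (rule LIMSEQ_Suc[OF lim_const_over_n])
  have "V x + \<gamma> * t - expectation (J t) - C * t * sqrt 0 \<le> E t"
  proof (rule tendsto_upperbound)
    show "(\<lambda>n. V x + \<gamma> * t - expectation (S n) - C * t * sqrt (t / real (Suc n))) \<longlonglongrightarrow> V x + \<gamma> * t - expectation (J t) - C * t * sqrt 0"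
      by (intro tendsto_intros dom d0)
    have "\<forall>\<^sub>F n in sequentially. t / real (Suc n) < 1" by (rule order_tendstoD(2)[OF d0]) simp
    then show "\<forall>\<^sub>F n in sequentially. V x + \<gamma> * t - expectation (S n) - C * t * sqrt (t / real (Suc n)) \<le> E t"
      by eventually_elim (intro main, simp)
  qed simp
  then show "\<gamma> * t + V x - expectation (\<lambda>\<omega>. V (Z t \<omega>)) \<le> expectation (\<lambda>\<omega>. J t \<omega> + k * Y1 t \<omega> + l * Y2 t \<omega>)"
    using dom(1) Y_integrable[of t] t by (simp add: E_def)
qed

definition total_cost :: "real \<Rightarrow> ennreal" where
  "total_cost t = (\<integral>\<^sup>+\<omega>. ((\<integral>\<^sup>+s\<in>{0..t}. ennreal (h (Z s \<omega>)) \<partial>lborel)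
              + ennreal (k * Y1 t \<omega> + l * Y2 t \<omega>)) \<partial>M)"

lemma total_cost_lower:
  assumes t: "0 < t"
  shows "ennreal (\<gamma> * t + V x - expectation (\<lambda>\<omega>. V (Z t \<omega>))) \<le> total_cost t"
proof -
  obtain B where B: "\<And>x. h (proj x) \<le> B" using h_clamp_bounded by blast
  have "ennreal (\<gamma> * t + V x - expectation (\<lambda>\<omega>. V (Z t \<omega>))) \<le> ennreal (expectation (\<lambda>\<omega>. J t \<omega> + k * Y1 t \<omega> + l * Y2 t \<omega>))"
    by (rule ennreal_leI[OF lower_bound(2)[OF t]])
  also have Jn: "0 \<le> J t \<omega>" for \<omega> unfolding J_def using h_nonneg by (intro integral_nonneg_AE) auto
  have "ennreal (expectation (\<lambda>\<omega>. J t \<omega> + k * Y1 t \<omega> + l * Y2 t \<omega>)) = (\<integral>\<^sup>+\<omega>. ennreal (J t \<omega> + k * Y1 t \<omega> + l * Y2 t \<omega>) \<partial>M)"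
    using lower_bound(1)[OF t] Y_integrable[of t] t Jn Y_nonneg pos
    by (intro nn_integral_eq_integral[symmetric]) (auto intro!: AE_I2 add_nonneg_nonneg)
  also have "\<dots> \<le> total_cost t"
    unfolding total_cost_def
  proof (rule nn_integral_mono)
    fix \<omega> assume w: "\<omega> \<in> space M"
    have i: "integrable lborel (\<lambda>s. indicator {0..<t} s * h (proj (Z s \<omega>)))"
    proof (rule Bochner_Integration.integrable_bound)
      show "integrable lborel (\<lambda>s. indicator {0..<t} s * B)"
        using t by (intro integrable_mult_left integrable_real_indicator) auto
      show "(\<lambda>s. indicator {0..<t} s * h (proj (Z s \<omega>))) \<in> borel_measurable lborel"
        unfolding measurable_lborel2 by (rule hZ_path_measurable[OF w]) auto
      show "AE s in lborel. norm (indicator {0..<t} s * h (proj (Z s \<omega>))) \<le> norm (indicator {0..<t} s * B)"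
        using B h_nonneg by (intro AE_I2) (auto simp: indicator_def intro: order_trans[OF _ abs_ge_self])
    qed
    have "ennreal (J t \<omega>) = (\<integral>\<^sup>+s. ennreal (indicator {0..<t} s * h (proj (Z s \<omega>))) \<partial>lborel)"
      unfolding J_def using h_nonneg by (intro nn_integral_eq_integral[symmetric] i) auto
    also have "\<dots> \<le> (\<integral>\<^sup>+s\<in>{0..t}. ennreal (h (Z s \<omega>)) \<partial>lborel)"
      using h_clamp by (intro nn_integral_mono) (auto simp: indicator_def intro!: ennreal_leI)
    finally have "ennreal (J t \<omega>) \<le> (\<integral>\<^sup>+s\<in>{0..t}. ennreal (h (Z s \<omega>)) \<partial>lborel)" .
    moreover have "ennreal (J t \<omega> + k * Y1 t \<omega> + l * Y2 t \<omega>) = ennreal (J t \<omega>) + ennreal (k * Y1 t \<omega> + l * Y2 t \<omega>)"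
      unfolding add.assoc using Jn[of \<omega>] Y_nonneg[OF w] pos by (intro ennreal_plus) auto
    ultimately show "ennreal (J t \<omega> + k * Y1 t \<omega> + l * Y2 t \<omega>)
        \<le> (\<integral>\<^sup>+s\<in>{0..t}. ennreal (h (Z s \<omega>)) \<partial>lborel) + ennreal (k * Y1 t \<omega> + l * Y2 t \<omega>)"
      by (simp add: add_right_mono)
  qed
  finally show ?thesis .
qed

lemma holding_lower:
  assumes t: "0 \<le> t"
  shows "ennreal (expectation (\<lambda>\<omega>. V (Z t \<omega>)) / K - 1) \<le> (\<integral>\<^sup>+\<omega>. ennreal (h (Z t \<omega>)) \<partial>M)"
proof (cases "(\<integral>\<^sup>+\<omega>. ennreal (h (Z t \<omega>)) \<partial>M) = \<infinity>")
  case False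
  note [measurable] = Z_measurable[OF t]
  have i: "integrable M (\<lambda>\<omega>. h (Z t \<omega>))"
    using False h_nonneg by (intro integrableI_nonneg) (auto simp: top.not_eq_extremum)
  have "expectation (\<lambda>\<omega>. V (Z t \<omega>)) \<le> expectation (\<lambda>\<omega>. K * (1 + h (Z t \<omega>)))"
    using i V_growth by (intro integral_mono VZ_integrable t) auto
  also have "\<dots> = K * (1 + expectation (\<lambda>\<omega>. h (Z t \<omega>)))" using i prob_space by simp
  finally have "expectation (\<lambda>\<omega>. V (Z t \<omega>)) / K - 1 \<le> expectation (\<lambda>\<omega>. h (Z t \<omega>))"
    using pos by (simp add: field_simps)
  then show ?thesis using i h_nonneg by (subst nn_integral_eq_integral) (auto intro: ennreal_leI)
qed simp

lemma total_cost_holding: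
  "(\<integral>\<^sup>+s\<in>{0..t}. (\<integral>\<^sup>+\<omega>. ennreal (h (Z s \<omega>)) \<partial>M) \<partial>lborel) \<le> total_cost t"
proof -
  interpret P: pair_sigma_finite lborel M ..
  let ?f = "\<lambda>(s, \<omega>). ennreal (h (indicator {0..} s * Z s \<omega>)) * indicator {0..t} s"
  have m: "?f \<in> borel_measurable (lborel \<Otimes>\<^sub>M M)"
  proof -
    have "(\<lambda>p. ennreal (h ((\<lambda>(s, \<omega>). indicator {0..} s * Z s \<omega>) p)) * indicator {0..t} (fst p)) \<in> borel_measurable (lborel \<Otimes>\<^sub>M M)"
      by measurable
    then show ?thesis by (simp add: split_beta')
  qed
  have "(\<integral>\<^sup>+s\<in>{0..t}. (\<integral>\<^sup>+\<omega>. ennreal (h (Z s \<omega>)) \<partial>M) \<partial>lborel) = (\<integral>\<^sup>+s. \<integral>\<^sup>+\<omega>. ?f (s, \<omega>) \<partial>M \<partial>lborel)"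
    by (intro nn_integral_cong) (auto simp: indicator_def)
  also have "\<dots> = (\<integral>\<^sup>+\<omega>. \<integral>\<^sup>+s. ?f (s, \<omega>) \<partial>lborel \<partial>M)" by (rule P.Fubini[OF m, symmetric])
  also have "\<dots> \<le> total_cost t"
    unfolding total_cost_def
  proof (rule nn_integral_mono)
    fix \<omega> assume "\<omega> \<in> space M"
    have "(\<integral>\<^sup>+s. ?f (s, \<omega>) \<partial>lborel) = (\<integral>\<^sup>+s\<in>{0..t}. ennreal (h (Z s \<omega>)) \<partial>lborel)"
      by (intro nn_integral_cong) (auto simp: indicator_def)
    then show "(\<integral>\<^sup>+s. ?f (s, \<omega>) \<partial>lborel) \<le> (\<integral>\<^sup>+s\<in>{0..t}. ennreal (h (Z s \<omega>)) \<partial>lborel) + ennreal (k * Y1 t \<omega> + l * Y2 t \<omega>)"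
      by simp
  qed
  finally show ?thesis .
qed

text \<open>If the average cost were below some \<open>q < \<gamma>\<close>, then by \<open>lower_bound\<close> \<open>E V (Z t)\<close> would
  eventually be at least \<open>(\<gamma> - q) t + V x\<close>, and therefore \<open>E h (Z t)\<close> at least \<open>4 q + 1\<close> from some time
  \<open>T\<close> on. The holding cost over \<open>[T, 2 T]\<close> alone would then be more than \<open>q (2 T)\<close>.\<close>

lemma average_cost_lower: "ennreal \<gamma> \<le> average_cost M W \<mu> \<sigma> h k l x \<phi>"
proof (rule ccontr)
  assume "\<not> ennreal \<gamma> \<le> average_cost M W \<mu> \<sigma> h k l x \<phi>"
  then have "average_cost M W \<mu> \<sigma> h k l x \<phi> < ennreal \<gamma>" by simp
  then obtain y where y: "average_cost M W \<mu> \<sigma> h k l x \<phi> < y" "y < ennreal \<gamma>" using dense by blast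
  then obtain q where q: "y = ennreal q" "0 \<le> q" by (cases y) auto
  have q\<gamma>: "q < \<gamma>" using y(2) q by (simp add: ennreal_less_iff)
  have "\<forall>\<^sub>F t in at_top. total_cost t / ennreal t < ennreal q"
    using Limsup_lessD[OF y(1)[unfolded average_cost_def]] unfolding q(1) total_cost_def .
  then obtain T0 where T0: "\<And>t. T0 \<le> t \<Longrightarrow> total_cost t / ennreal t < ennreal q"
    unfolding eventually_at_top_linorder by blast
  have tot: "total_cost t \<le> ennreal (q * t)" if "T0 \<le> t" "0 < t" for t
  proof (cases "total_cost t")
    case (real r)
    then have "ennreal (r / t) < ennreal q" using T0[OF that(1)] that(2) by (simp add: divide_ennreal)
    then have "r < q * t" using real that by (simp add: ennreal_less_iff pos_divide_less_eq)
    then show ?thesis using real by (simp add: ennreal_leI)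
  next
    case top
    then show ?thesis using T0[OF that(1)] by (simp add: ennreal_top_divide)
  qed
  have EV: "(\<gamma> - q) * t + V x \<le> expectation (\<lambda>\<omega>. V (Z t \<omega>))" if "T0 \<le> t" "0 < t" for t
  proof -
    have "ennreal (\<gamma> * t + V x - expectation (\<lambda>\<omega>. V (Z t \<omega>))) \<le> ennreal (q * t)"
      using total_cost_lower[OF that(2)] tot[OF that] by (rule order_trans)
    then have "\<gamma> * t + V x - expectation (\<lambda>\<omega>. V (Z t \<omega>)) \<le> q * t" using q that by (subst (asm) ennreal_le_iff) auto
    then show ?thesis by (simp add: algebra_simps)
  qed
  \<comment> \<open>from time \<open>R\<close> on, \<open>(\<gamma> - q) t + V x\<close> is at least \<open>K (4 q + 2)\<close>\<close>
  define R where "R = (K * (4 * q + 2) + \<bar>V x\<bar>) / (\<gamma> - q)"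
  define T where "T = max (max T0 1) R"
  have T: "T0 \<le> T" "1 \<le> T" "R \<le> T" by (auto simp: T_def)
  have big: "ennreal (4 * q + 1) \<le> (\<integral>\<^sup>+\<omega>. ennreal (h (Z s \<omega>)) \<partial>M)" if s: "T \<le> s" for s
  proof -
    have "(\<gamma> - q) * R \<le> (\<gamma> - q) * s" using T s q\<gamma> by (intro mult_left_mono) auto
    then have "K * (4 * q + 2) + \<bar>V x\<bar> \<le> (\<gamma> - q) * s" using q\<gamma> by (simp add: R_def)
    then have "K * (4 * q + 2) \<le> expectation (\<lambda>\<omega>. V (Z s \<omega>))" using EV[of s] T s by linarith
    then have "4 * q + 1 \<le> expectation (\<lambda>\<omega>. V (Z s \<omega>)) / K - 1"
      using pos by (simp add: field_simps)
    then show ?thesis using holding_lower[of s] T s by (meson ennreal_leI order_trans less_imp_le zero_less_one dual_order.trans)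
  qed
  have "ennreal ((4 * q + 1) * T) = ennreal (4 * q + 1) * emeasure lborel {T..2 * T}"
    using T q by (simp add: ennreal_mult)
  also have "\<dots> = (\<integral>\<^sup>+s\<in>{T..2 * T}. ennreal (4 * q + 1) \<partial>lborel)" by (subst nn_integral_cmult_indicator) auto
  also have "\<dots> \<le> (\<integral>\<^sup>+s\<in>{0..2 * T}. (\<integral>\<^sup>+\<omega>. ennreal (h (Z s \<omega>)) \<partial>M) \<partial>lborel)"
    using big T by (intro nn_integral_mono) (auto simp: indicator_def)
  also have "\<dots> \<le> ennreal (q * (2 * T))" using total_cost_holding[of "2 * T"] tot[of "2 * T"] T by (auto intro: order_trans)
  finally have "(4 * q + 1) * T \<le> q * (2 * T)" using q T by (subst (asm) ennreal_le_iff) auto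
  moreover have "(4 * q + 1) * T - q * (2 * T) = 2 * (q * T) + T" by (simp add: algebra_simps)
  moreover have "0 \<le> q * T" using q T by simp
  ultimately show False using T(2) by linarith
qed

end

section \<open>Cost of the control band policy\<close>

locale band_policy = controlled_brownian +
  fixes x :: real
begin

text \<open>The level right after the initial jump.\<close>

definition c :: real where "c = closest_point {d..u} x"

definition path :: "'a \<Rightarrow> real \<Rightarrow> real" where "path \<omega> s = drifted_bm \<mu> \<sigma> W c s \<omega>"

lemma c_range: "c \<in> {d..u}"
  unfolding c_def by (rule closest_point_in_set) (use du in auto)

lemma path_eq: "path \<omega> s = c + \<mu> * s + \<sigma> * W s \<omega>"
  by (simp add: path_def drifted_bm_def)

lemma path_regulator: assumes "\<omega> \<in> space M" shows "regulator_path d u (path \<omega>)"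
proof
  show "d < u" by (rule du)
  show "path \<omega> 0 \<in> {d..u}" using c_range by (simp add: path_eq W_path[OF assms])
  show "continuous_on {0..} (path \<omega>)"
    unfolding path_eq[abs_def] by (intro continuous_intros W_path[OF assms])
qed

definition grid_low :: "nat \<Rightarrow> nat \<Rightarrow> 'a \<Rightarrow> real" where
  "grid_low n i \<omega> = low d u (\<lambda>j. path \<omega> (real j / 2 ^ n)) i"
definition grid_upp :: "nat \<Rightarrow> nat \<Rightarrow> 'a \<Rightarrow> real" where
  "grid_upp n i \<omega> = upp d u (\<lambda>j. path \<omega> (real j / 2 ^ n)) i"
definition grid_level :: "nat \<Rightarrow> nat \<Rightarrow> 'a \<Rightarrow> real" where
  "grid_level n i \<omega> = path \<omega> (real i / 2 ^ n) + grid_low n i \<omega> - grid_upp n i \<omega>"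

lemma path_measurable_F: "0 \<le> s \<Longrightarrow> s \<le> t \<Longrightarrow> (\<lambda>\<omega>. path \<omega> s) \<in> borel_measurable (F t)"
  unfolding path_eq
  by (intro borel_measurable_add borel_measurable_times borel_measurable_const
      measurable_F_mono[OF W_measurable_F])

lemma path_integrable: "0 \<le> s \<Longrightarrow> integrable M (\<lambda>\<omega>. path \<omega> s)"
  unfolding path_eq using W_integrable[of s] by simp

lemma grid_low_grid_upp_measurable_F:
  assumes "real i / 2 ^ n \<le> t"
  shows "grid_low n i \<in> borel_measurable (F t) \<and> grid_upp n i \<in> borel_measurable (F t)"
  using assms
proof (induction i)
  case (Suc i)
  have le: "real i / 2 ^ n \<le> real (Suc i) / 2 ^ n" by (intro divide_right_mono) auto
  have IH: "grid_low n i \<in> borel_measurable (F t)" "grid_upp n i \<in> borel_measurable (F t)"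
    using Suc le by auto
  have p: "(\<lambda>\<omega>. path \<omega> (real (Suc i) / 2 ^ n)) \<in> borel_measurable (F t)"
    by (rule path_measurable_F) (use Suc.prems in auto)
  show ?case
    unfolding grid_low_def grid_upp_def low_Suc upp_Suc
    unfolding grid_low_def[symmetric] grid_upp_def[symmetric]
    by (intro conjI borel_measurable_max borel_measurable_add borel_measurable_diff borel_measurable_const IH p)
qed (simp add: grid_low_def[abs_def] grid_upp_def[abs_def])

lemma grid_level_measurable_F: "real i / 2 ^ n \<le> t \<Longrightarrow> grid_level n i \<in> borel_measurable (F t)"
  unfolding grid_level_def[abs_def] using grid_low_grid_upp_measurable_F[of i n t]
  by (intro borel_measurable_add borel_measurable_diff path_measurable_F) auto

lemma grid_low_grid_upp_integrable: "integrable M (grid_low n i) \<and> integrable M (grid_upp n i)"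
proof (induction i)
  case (Suc i)
  have p: "integrable M (\<lambda>\<omega>. path \<omega> (real (Suc i) / 2 ^ n))" by (rule path_integrable) simp
  show ?case
    unfolding grid_low_def grid_upp_def low_Suc upp_Suc
    unfolding grid_low_def[symmetric] grid_upp_def[symmetric]
    using Suc p by (intro conjI integrable_max Bochner_Integration.integrable_add Bochner_Integration.integrable_diff) auto
qed (simp add: grid_low_def[abs_def] grid_upp_def[abs_def])

lemma grid_level_integrable: "integrable M (grid_level n i)"
  unfolding grid_level_def[abs_def] using grid_low_grid_upp_integrable[of n i] path_integrable[of "real i / 2 ^ n"] by simp

lemma grid_level_range: "\<omega> \<in> space M \<Longrightarrow> grid_level n i \<omega> \<in> {d..u}"
  unfolding grid_level_def grid_low_def grid_upp_def
  by (rule discrete_regulator_tube) (use du c_range in \<open>auto simp: path_eq W_path\<close>)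

lemma V_grid_level_integrable: "integrable M (\<lambda>\<omega>. V (grid_level n i \<omega>))"
  by (rule V_comp_integrable[OF grid_level_integrable])

lemma hp_measurable: "(\<lambda>y. h (proj y)) \<in> borel_measurable borel"
  by measurable

lemma h_grid_level_measurable: "(\<lambda>\<omega>. h (proj (grid_level n i \<omega>))) \<in> borel_measurable M"
  by (rule measurable_compose[OF _ hp_measurable]) (use grid_level_integrable in auto)

lemma h_grid_level_integrable: "integrable M (\<lambda>\<omega>. h (proj (grid_level n i \<omega>)))"
proof -
  obtain C where C: "\<And>x. h (proj x) \<le> C" using h_clamp_bounded by blast
  show ?thesis by (rule integrable_const_bound[of _ C]) (use C h_nonneg h_grid_level_measurable in auto)
qed

text \<open>The pushes of the chain are the distances by which the projection moves \<open>X\<close>, so \<open>V_clamp\<close> applies.\<close>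

lemma upper_step:
  defines "\<delta> \<equiv> \<lambda>n :: nat. 1 / 2 ^ n :: real"
  defines "X \<equiv> \<lambda>n i \<omega>. grid_level n i \<omega> + (\<mu> * \<delta> n + \<sigma> * (W (real i / 2 ^ n + \<delta> n) \<omega> - W (real i / 2 ^ n) \<omega>))"
  shows "V (X n i \<omega>) = V (grid_level n (Suc i) \<omega>) + k * (grid_low n (Suc i) \<omega> - grid_low n i \<omega>) + l * (grid_upp n (Suc i) \<omega> - grid_upp n i \<omega>)"
proof -
  have e: "real (Suc i) / 2 ^ n = real i / 2 ^ n + \<delta> n" by (simp add: \<delta>_def add_divide_distrib)
  have X: "X n i \<omega> = path \<omega> (real (Suc i) / 2 ^ n) + grid_low n i \<omega> - grid_upp n i \<omega>"
    unfolding X_def grid_level_def path_eq e by (simp add: algebra_simps)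
  have 1: "grid_level n (Suc i) \<omega> = proj (X n i \<omega>)"
    unfolding X grid_level_def grid_low_def grid_upp_def clamp_to_def
    by (rule discrete_regulator_clamp[OF less_imp_le[OF du]])
  have 2: "grid_low n (Suc i) \<omega> - grid_low n i \<omega> = max 0 (d - X n i \<omega>)"
    unfolding X grid_low_def grid_upp_def low_Suc by (simp add: max_def)
  have 3: "grid_upp n (Suc i) \<omega> - grid_upp n i \<omega> = max 0 (X n i \<omega> - u)"
    unfolding X grid_low_def grid_upp_def upp_Suc by (simp add: max_def)
  show ?thesis unfolding 1 2 3 by (rule V_clamp)
qed

text \<open>The counterpart of \<open>lower_step\<close>, summed over the grid: for the chain the controls cost exactly the
  drop in \<open>V\<close> that they cause.\<close>

lemma upper_sum:
  obtains C where "C \<ge> 0"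
    "\<And>n i. expectation (\<lambda>\<omega>. V (grid_level n i \<omega>)) + k * expectation (grid_low n i) + l * expectation (grid_upp n i)
      + 1 / 2 ^ n * (\<Sum>j<i. expectation (\<lambda>\<omega>. h (proj (grid_level n j \<omega>))))
      \<le> V c + real i / 2 ^ n * \<gamma> + real i / 2 ^ n * (C * sqrt (1 / 2 ^ n))"
proof -
  obtain C where C: "C \<ge> 0"
    "\<And>Z s \<delta>. Z \<in> borel_measurable (F s) \<Longrightarrow> 0 \<le> s \<Longrightarrow> 0 < \<delta> \<Longrightarrow> \<delta> \<le> 1 \<Longrightarrow>
      integrable M (\<lambda>\<omega>. V (Z \<omega> + (\<mu> * \<delta> + \<sigma> * (W (s + \<delta>) \<omega> - W s \<omega>))) - V (Z \<omega>)) \<and>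
      \<bar>expectation (\<lambda>\<omega>. V (Z \<omega> + (\<mu> * \<delta> + \<sigma> * (W (s + \<delta>) \<omega> - W s \<omega>))) - V (Z \<omega>))
        - \<delta> * (\<gamma> - expectation (\<lambda>\<omega>. h (proj (Z \<omega>))))\<bar> \<le> C * sqrt \<delta> ^ 3"
    using one_step by blast
  show thesis
  proof (rule that[OF C(1)])
    fix n i
    define \<delta> :: real where "\<delta> = 1 / 2 ^ n"
    have \<delta>: "0 < \<delta>" "\<delta> \<le> 1" by (auto simp: \<delta>_def)
    have d3: "sqrt \<delta> ^ 3 = \<delta> * sqrt \<delta>" using \<delta> by (simp add: power3_eq_cube)
    show "expectation (\<lambda>\<omega>. V (grid_level n i \<omega>)) + k * expectation (grid_low n i) + l * expectation (grid_upp n i)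
      + 1 / 2 ^ n * (\<Sum>j<i. expectation (\<lambda>\<omega>. h (proj (grid_level n j \<omega>))))
      \<le> V c + real i / 2 ^ n * \<gamma> + real i / 2 ^ n * (C * sqrt (1 / 2 ^ n))"
    proof (induction i)
      case 0
      have "expectation (\<lambda>\<omega>. V (grid_level n 0 \<omega>)) = expectation (\<lambda>_. V c)"
        by (intro Bochner_Integration.integral_cong) (auto simp: grid_level_def grid_low_def grid_upp_def path_eq W_path)
      then show ?case using prob_space by (simp add: grid_low_def[abs_def] grid_upp_def[abs_def])
    next
      case (Suc i)
      define s where "s = real i / 2 ^ n"
      have s: "0 \<le> s" by (simp add: s_def)
      have eS: "real (Suc i) / 2 ^ n = s + \<delta>" by (simp add: s_def \<delta>_def add_divide_distrib)
      have m: "grid_level n i \<in> borel_measurable (F s)" by (rule grid_level_measurable_F) (simp add: s_def)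
      note o = C(2)[OF m s \<delta>]
      let ?X = "\<lambda>\<omega>. grid_level n i \<omega> + (\<mu> * \<delta> + \<sigma> * (W (s + \<delta>) \<omega> - W s \<omega>))"
      note i = V_grid_level_integrable grid_low_grid_upp_integrable[THEN conjunct1] grid_low_grid_upp_integrable[THEN conjunct2]
      have "expectation (\<lambda>\<omega>. V (?X \<omega>) - V (grid_level n i \<omega>)) =
          expectation (\<lambda>\<omega>. V (grid_level n (Suc i) \<omega>) + k * (grid_low n (Suc i) \<omega> - grid_low n i \<omega>)
            + l * (grid_upp n (Suc i) \<omega> - grid_upp n i \<omega>) - V (grid_level n i \<omega>))"
        using upper_step[of n i] unfolding s_def \<delta>_def by simp
      also have "\<dots> = expectation (\<lambda>\<omega>. V (grid_level n (Suc i) \<omega>)) + k * (expectation (grid_low n (Suc i)) - expectation (grid_low n i))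
            + l * (expectation (grid_upp n (Suc i)) - expectation (grid_upp n i)) - expectation (\<lambda>\<omega>. V (grid_level n i \<omega>))"
        using i by simp
      finally have "expectation (\<lambda>\<omega>. V (grid_level n (Suc i) \<omega>)) + k * (expectation (grid_low n (Suc i)) - expectation (grid_low n i))
            + l * (expectation (grid_upp n (Suc i)) - expectation (grid_upp n i)) - expectation (\<lambda>\<omega>. V (grid_level n i \<omega>))
          \<le> \<delta> * (\<gamma> - expectation (\<lambda>\<omega>. h (proj (grid_level n i \<omega>)))) + C * (\<delta> * sqrt \<delta>)"
        using abs_le_D1[OF o[THEN conjunct2]] unfolding d3 by linarith
      then show ?case
        using Suc unfolding eS s_def[symmetric] \<delta>_def[symmetric] by (simp add: algebra_simps)
    qed
  qed
qed

definition low_push :: "real \<Rightarrow> 'a \<Rightarrow> real" where "low_push t \<omega> = regulator_path.Low d u (path \<omega>) t"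
definition upp_push :: "real \<Rightarrow> 'a \<Rightarrow> real" where "upp_push t \<omega> = regulator_path.Upp d u (path \<omega>) t"
definition level :: "real \<Rightarrow> 'a \<Rightarrow> real" where "level t \<omega> = regulator_path.Lev d u (path \<omega>) t"

lemma grid_low_at: "low_at d u (path \<omega>) n t = grid_low n (grid_floor n t) \<omega>"
  and grid_upp_at: "upp_at d u (path \<omega>) n t = grid_upp n (grid_floor n t) \<omega>"
  by (simp_all add: low_at_def upp_at_def grid_low_def grid_upp_def)

lemma grid_low_tendsto: "\<omega> \<in> space M \<Longrightarrow> 0 \<le> t \<Longrightarrow> (\<lambda>n. grid_low n (grid_floor n t) \<omega>) \<longlonglongrightarrow> low_push t \<omega>"
  using regulator_path.low_at_tendsto[OF path_regulator] by (simp add: grid_low_at low_push_def)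

lemma grid_upp_tendsto: "\<omega> \<in> space M \<Longrightarrow> 0 \<le> t \<Longrightarrow> (\<lambda>n. grid_upp n (grid_floor n t) \<omega>) \<longlonglongrightarrow> upp_push t \<omega>"
  using regulator_path.upp_at_tendsto[OF path_regulator] by (simp add: grid_upp_at upp_push_def)

lemma grid_level_tendsto: "\<omega> \<in> space M \<Longrightarrow> 0 \<le> t \<Longrightarrow> (\<lambda>n. grid_level n (grid_floor n t) \<omega>) \<longlonglongrightarrow> level t \<omega>"
  using regulator_path.lev_at_tendsto[OF path_regulator]
  by (simp add: regulator_path.lev_at_def[OF path_regulator] grid_level_def grid_low_at grid_upp_at level_def)

lemma level_eq: "\<omega> \<in> space M \<Longrightarrow> 0 \<le> t \<Longrightarrow> level t \<omega> = path \<omega> t + low_push t \<omega> - upp_push t \<omega>"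
  by (simp add: regulator_path.Lev_def[OF path_regulator] level_def low_push_def upp_push_def)

lemma level_range: "\<omega> \<in> space M \<Longrightarrow> 0 \<le> t \<Longrightarrow> level t \<omega> \<in> {d..u}"
  using regulator_path.Lev_range[OF path_regulator] by (simp add: level_def)

lemma low_push_upp_push_props:
  assumes "\<omega> \<in> space M"
  shows "mono (\<lambda>t. low_push t \<omega>)" "mono (\<lambda>t. upp_push t \<omega>)"
    "continuous_on {0..} (\<lambda>t. low_push t \<omega>)" "continuous_on {0..} (\<lambda>t. upp_push t \<omega>)"
    "low_push 0 \<omega> = 0" "upp_push 0 \<omega> = 0"
  using regulator_path.Low_mono[OF path_regulator[OF assms]] regulator_path.Upp_mono[OF path_regulator[OF assms]]
    regulator_path.Low_cont[OF path_regulator[OF assms]] regulator_path.Upp_cont[OF path_regulator[OF assms]]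
    regulator_path.Low_0[OF path_regulator[OF assms]] regulator_path.Upp_0[OF path_regulator[OF assms]]
  unfolding low_push_def upp_push_def by blast+

lemma low_push_upp_push_nonneg: "\<omega> \<in> space M \<Longrightarrow> 0 \<le> t \<Longrightarrow> 0 \<le> low_push t \<omega>" "\<omega> \<in> space M \<Longrightarrow> 0 \<le> t \<Longrightarrow> 0 \<le> upp_push t \<omega>"
  using monoD[OF low_push_upp_push_props(1), of \<omega> 0 t] monoD[OF low_push_upp_push_props(2), of \<omega> 0 t] low_push_upp_push_props(5,6) by simp_all

lemma low_push_upp_push_measurable_F:
  assumes "0 \<le> t" shows "low_push t \<in> borel_measurable (F t)" "upp_push t \<in> borel_measurable (F t)"
proof -
  note m = grid_low_grid_upp_measurable_F[OF grid_floor_le[OF assms]]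
  show "low_push t \<in> borel_measurable (F t)"
    by (rule borel_measurable_LIMSEQ_real[OF grid_low_tendsto[OF _ assms] m[THEN conjunct1]]) simp
  show "upp_push t \<in> borel_measurable (F t)"
    by (rule borel_measurable_LIMSEQ_real[OF grid_upp_tendsto[OF _ assms] m[THEN conjunct2]]) simp
qed

definition holding :: "nat \<Rightarrow> 'a \<Rightarrow> real" where
  "holding T \<omega> = (LINT s|lborel. indicator {0..<real T} s * h (level s \<omega>))"

lemma level_path_measurable:
  assumes "\<omega> \<in> space M" shows "(\<lambda>s. indicator {0..<real T} s * h (level s \<omega>)) \<in> borel_measurable borel"
proof -
  have "continuous_on {0..} (\<lambda>s. level s \<omega>)"
    using regulator_path.Lev_cont[OF path_regulator[OF assms]] by (simp add: level_def)
  then have "continuous_on {0..<real T} (\<lambda>s. h (level s \<omega>))"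
    by (intro continuous_on_compose2[OF h_cont continuous_on_subset]) auto
  then show ?thesis using borel_measurable_continuous_on_indicator[of "{0..<real T}" "\<lambda>s. h (level s \<omega>)"] by simp
qed

text \<open>The levels of the chain and of its limit lie in the band, where \<open>h\<close> agrees with its truncation.\<close>

lemma holding_bound:
  assumes "\<omega> \<in> space M"
  shows "integrable lborel (\<lambda>s. indicator {0..<real T} s * h (level s \<omega>))"
    "(\<lambda>n. 1 / 2 ^ n * (\<Sum>i<T * 2 ^ n. h (proj (grid_level n i \<omega>)))) \<longlonglongrightarrow> holding T \<omega>"
proof -
  obtain C where C: "\<And>x. h (proj x) \<le> C" using h_clamp_bounded by blast
  define g where "g n s = indicator {0..<real T} s * h (proj (grid_level n (grid_floor n s) \<omega>))" for n s
  have step: "has_bochner_integral lborel (g n) (1 / 2 ^ n * (\<Sum>i<T * 2 ^ n. h (proj (grid_level n i \<omega>))))" for n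
  proof -
    have e: "s / (1 / 2 ^ n) = s * 2 ^ n" for s :: real by simp
    have T: "real (T * 2 ^ n) * (1 / 2 ^ n) = real T" by simp
    show ?thesis
      using step_function_integral[of "1 / 2 ^ n" "T * 2 ^ n" "\<lambda>i. h (proj (grid_level n i \<omega>))"]
      unfolding T e g_def[abs_def] grid_floor_def by simp
  qed
  have proj_lev: "proj (level s \<omega>) = level s \<omega>" if "0 \<le> s" for s
    using level_range[OF assms that] du by (simp add: clamp_to_simps)
  let ?f = "\<lambda>s. indicator {0..<real T} s * h (level s \<omega>)"
  have A: "?f \<in> borel_measurable lborel" using level_path_measurable[OF assms] by simp
  have B: "g n \<in> borel_measurable lborel" for n using step[of n] by (rule borel_measurable_has_bochner_integral)
  have D: "integrable lborel (\<lambda>s. indicator {0..<real T} s * C)"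
    by (intro integrable_mult_left integrable_real_indicator) auto
  have E: "AE s in lborel. (\<lambda>n. g n s) \<longlonglongrightarrow> ?f s"
  proof (rule AE_I2)
    fix s :: real
    show "(\<lambda>n. g n s) \<longlonglongrightarrow> ?f s"
    proof (cases "s \<in> {0..<real T}")
      case True
      have "isCont (\<lambda>y. h (proj y)) (level s \<omega>)" using continuous_parts(4) by (simp add: continuous_on_eq_continuous_at)
      from isCont_tendsto_compose[OF this grid_level_tendsto[OF assms]]
      show ?thesis using True proj_lev[of s] by (simp add: g_def)
    qed (simp add: g_def)
  qed
  have G: "AE s in lborel. norm (g n s) \<le> indicator {0..<real T} s * C" for n
    using C h_nonneg by (intro AE_I2) (auto simp: g_def indicator_def)
  show "integrable lborel ?f" by (rule integrable_dominated_convergence[OF A B D E G])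
  have "(\<lambda>n. LINT s|lborel. g n s) \<longlonglongrightarrow> holding T \<omega>"
    unfolding holding_def by (rule integral_dominated_convergence[OF A B D E G])
  then show "(\<lambda>n. 1 / 2 ^ n * (\<Sum>i<T * 2 ^ n. h (proj (grid_level n i \<omega>)))) \<longlonglongrightarrow> holding T \<omega>"
    using has_bochner_integral_integral_eq[OF step] by simp
qed

text \<open>Fatou's lemma along the approximating chains; the initial and final values of \<open>V\<close> differ by at most
  \<open>(k + l) (u - d)\<close>, as both levels lie in the band.\<close>

lemma expected_cost_le:
  "(\<integral>\<^sup>+\<omega>. ennreal (holding T \<omega> + k * low_push T \<omega> + l * upp_push T \<omega>) \<partial>M) \<le> ennreal (\<gamma> * real T + (k + l) * (u - d))"
proof -
  obtain C where C: "C \<ge> 0" and sum: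
    "\<And>n i. expectation (\<lambda>\<omega>. V (grid_level n i \<omega>)) + k * expectation (grid_low n i) + l * expectation (grid_upp n i)
      + 1 / 2 ^ n * (\<Sum>j<i. expectation (\<lambda>\<omega>. h (proj (grid_level n j \<omega>))))
      \<le> V c + real i / 2 ^ n * \<gamma> + real i / 2 ^ n * (C * sqrt (1 / 2 ^ n))"
    using upper_sum by blast
  define f where "f n \<omega> = 1 / 2 ^ n * (\<Sum>i<T * 2 ^ n. h (proj (grid_level n i \<omega>))) + k * grid_low n (T * 2 ^ n) \<omega> + l * grid_upp n (T * 2 ^ n) \<omega>" for n \<omega>
  note i = V_grid_level_integrable grid_low_grid_upp_integrable[THEN conjunct1] grid_low_grid_upp_integrable[THEN conjunct2] h_grid_level_integrable
  have f_int: "integrable M (f n)" for n unfolding f_def[abs_def] using i by simp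
  have f0: "0 \<le> f n \<omega>" for n \<omega>
    unfolding f_def grid_low_def grid_upp_def using pos h_nonneg low_nonneg upp_nonneg
    by (intro add_nonneg_nonneg mult_nonneg_nonneg sum_nonneg) auto
  have Ef: "expectation (f n) \<le> \<gamma> * real T + (k + l) * (u - d) + T * (C * sqrt (1 / 2 ^ n))" for n
  proof -
    have T: "real (T * 2 ^ n) / 2 ^ n = real T" by simp
    have "V c - (k + l) * (u - d) \<le> V (grid_level n (T * 2 ^ n) \<omega>)" if "\<omega> \<in> space M" for \<omega>
    proof -
      have "\<bar>V c - V (grid_level n (T * 2 ^ n) \<omega>)\<bar> \<le> (k + l) * \<bar>c - grid_level n (T * 2 ^ n) \<omega>\<bar>" by (rule V_lipschitz)
      also have "\<dots> \<le> (k + l) * (u - d)"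
        using c_range grid_level_range[OF that, of n "T * 2 ^ n"] pos by (intro mult_left_mono) auto
      finally show ?thesis by simp
    qed
    then have "expectation (\<lambda>_. V c - (k + l) * (u - d)) \<le> expectation (\<lambda>\<omega>. V (grid_level n (T * 2 ^ n) \<omega>))"
      using i by (intro integral_mono) auto
    moreover have "expectation (f n) = 1 / 2 ^ n * (\<Sum>j<T * 2 ^ n. expectation (\<lambda>\<omega>. h (proj (grid_level n j \<omega>))))
        + k * expectation (grid_low n (T * 2 ^ n)) + l * expectation (grid_upp n (T * 2 ^ n))"
      unfolding f_def[abs_def] using i by simp
    ultimately show ?thesis using sum[of n "T * 2 ^ n"] prob_space unfolding T by (simp add: algebra_simps)
  qed
  have lim: "(\<lambda>n. f n \<omega>) \<longlonglongrightarrow> holding T \<omega> + k * low_push T \<omega> + l * upp_push T \<omega>" if "\<omega> \<in> space M" for \<omega>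
  proof -
    have g: "grid_floor n (real T) = T * 2 ^ n" for n
    proof -
      have "real T * 2 ^ n = of_int (int (T * 2 ^ n))" by simp
      then show ?thesis unfolding grid_floor_def by (metis floor_of_int nat_int)
    qed
    show ?thesis
      unfolding f_def
      using grid_low_tendsto[OF that, of "real T"] grid_upp_tendsto[OF that, of "real T"] holding_bound(2)[OF that]
      by (intro tendsto_intros) (simp_all add: g)
  qed
  have "(\<integral>\<^sup>+\<omega>. ennreal (holding T \<omega> + k * low_push T \<omega> + l * upp_push T \<omega>) \<partial>M) = (\<integral>\<^sup>+\<omega>. liminf (\<lambda>n. ennreal (f n \<omega>)) \<partial>M)"
    using lim by (intro nn_integral_cong lim_imp_Liminf[symmetric] tendsto_ennrealI) auto
  also have "\<dots> \<le> liminf (\<lambda>n. \<integral>\<^sup>+\<omega>. ennreal (f n \<omega>) \<partial>M)"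
    using f_int by (intro nn_integral_liminf) auto
  also have "\<dots> = liminf (\<lambda>n. ennreal (expectation (f n)))"
    using f_int f0 by (simp add: nn_integral_eq_integral)
  also have "\<dots> \<le> liminf (\<lambda>n. ennreal (\<gamma> * real T + (k + l) * (u - d) + T * (C * sqrt (1 / 2 ^ n))))"
    using Ef by (intro Liminf_mono always_eventually allI ennreal_leI)
  also have "\<dots> = ennreal (\<gamma> * real T + (k + l) * (u - d))"
  proof (intro lim_imp_Liminf tendsto_ennrealI)
    have "(\<lambda>n. (1 / 2) ^ n :: real) \<longlonglongrightarrow> 0" by (rule LIMSEQ_realpow_zero) auto
    then have "(\<lambda>n. 1 / 2 ^ n :: real) \<longlonglongrightarrow> 0" by (simp add: power_divide)
    from tendsto_add[OF tendsto_const tendsto_mult[OF tendsto_const tendsto_mult[OF tendsto_const tendsto_real_sqrt[OF this]]]]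
    show "(\<lambda>n. \<gamma> * real T + (k + l) * (u - d) + T * (C * sqrt (1 / 2 ^ n))) \<longlonglongrightarrow> \<gamma> * real T + (k + l) * (u - d)"
      by simp
  qed simp
  finally show ?thesis .
qed

abbreviation "band \<equiv> control_band_policy \<mu> \<sigma> W d u x"

lemma band_eq:
  assumes "\<omega> \<in> space M" "0 \<le> t"
  shows "fst band t \<omega> = max 0 (c - x) + low_push t \<omega>" "snd band t \<omega> = max 0 (x - c) + upp_push t \<omega>"
    "inventory \<mu> \<sigma> W x band t \<omega> = level t \<omega>"
proof -
  have p: "(\<lambda>s. drifted_bm \<mu> \<sigma> W c s \<omega>) = path \<omega>" by (simp add: path_def fun_eq_iff)
  note \<Psi> = regulator_path.\<Psi>_eq[OF path_regulator[OF assms(1)]]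
  show 1: "fst band t \<omega> = max 0 (c - x) + low_push t \<omega>" "snd band t \<omega> = max 0 (x - c) + upp_push t \<omega>"
    using assms(2) \<Psi> by (simp_all add: control_band_policy_def c_def[symmetric] p Let_def low_push_def upp_push_def)
  show "inventory \<mu> \<sigma> W x band t \<omega> = level t \<omega>"
    unfolding inventory_def 1 level_eq[OF assms] path_eq drifted_bm_def by (auto simp: max_def)
qed

lemma band_neg: "t < 0 \<Longrightarrow> fst band t \<omega> = 0" "t < 0 \<Longrightarrow> snd band t \<omega> = 0"
  by (simp_all add: control_band_policy_def Let_def)

lemma holding_nonneg: "0 \<le> holding T \<omega>"
  unfolding holding_def using h_nonneg by (intro integral_nonneg_AE) auto

text \<open>The expected cost up to an integer time beyond \<open>t\<close> is finite.\<close>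

lemma low_push_upp_push_integrable:
  assumes "0 \<le> t" shows "integrable M (low_push t)" "integrable M (upp_push t)"
proof -
  obtain T :: nat where T: "t \<le> real T" using real_arch_simple by blast
  have fin: "(\<integral>\<^sup>+\<omega>. ennreal (holding T \<omega> + k * low_push T \<omega> + l * upp_push T \<omega>) \<partial>M) < \<infinity>"
    using expected_cost_le[of T] by (rule order_le_less_trans) simp
  have m: "low_push t \<in> borel_measurable M" "upp_push t \<in> borel_measurable M"
    using low_push_upp_push_measurable_F[OF assms] by (auto intro: measurable_F_M)
  have le: "low_push t \<omega> \<le> low_push T \<omega>" "upp_push t \<omega> \<le> upp_push T \<omega>" if "\<omega> \<in> space M" for \<omega>
    using low_push_upp_push_props(1,2)[OF that] T by (auto dest: monoD)
  have int: "integrable M f" if f: "f \<in> borel_measurable M" "0 < a"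
    and b: "\<And>\<omega>. \<omega> \<in> space M \<Longrightarrow> 0 \<le> f \<omega> \<and> a * f \<omega> \<le> holding T \<omega> + k * low_push T \<omega> + l * upp_push T \<omega>" for f a
  proof -
    have "(\<integral>\<^sup>+\<omega>. ennreal (a * f \<omega>) \<partial>M) < \<infinity>"
      using b by (intro order_le_less_trans[OF nn_integral_mono fin] ennreal_leI) auto
    then have "integrable M (\<lambda>\<omega>. a * f \<omega>)"
      using f b by (intro integrableI_nonneg) (auto intro!: AE_I2)
    then show ?thesis using f(2) by simp
  qed
  have nn: "0 \<le> low_push t \<omega>" "0 \<le> upp_push t \<omega>" "0 \<le> low_push T \<omega>" "0 \<le> upp_push T \<omega>" if "\<omega> \<in> space M" for \<omega>
    using low_push_upp_push_nonneg[OF that] assms by auto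
  show "integrable M (low_push t)"
  proof (rule int[OF m(1) pos(3)])
    fix \<omega> assume w: "\<omega> \<in> space M"
    have "k * low_push t \<omega> \<le> k * low_push T \<omega>" using le[OF w] pos by (intro mult_left_mono) auto
    moreover have "0 \<le> l * upp_push T \<omega>" using nn[OF w] pos by simp
    ultimately show "0 \<le> low_push t \<omega> \<and> k * low_push t \<omega> \<le> holding T \<omega> + k * low_push T \<omega> + l * upp_push T \<omega>"
      using holding_nonneg[of T \<omega>] nn[OF w] by simp
  qed
  show "integrable M (upp_push t)"
  proof (rule int[OF m(2) pos(4)])
    fix \<omega> assume w: "\<omega> \<in> space M"
    have "l * upp_push t \<omega> \<le> l * upp_push T \<omega>" using le[OF w] pos by (intro mult_left_mono) auto
    moreover have "0 \<le> k * low_push T \<omega>" using nn[OF w] pos by simp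
    ultimately show "0 \<le> upp_push t \<omega> \<and> l * upp_push t \<omega> \<le> holding T \<omega> + k * low_push T \<omega> + l * upp_push T \<omega>"
      using holding_nonneg[of T \<omega>] nn[OF w] by simp
  qed
qed

lemma control_process_shifted:
  assumes Y: "\<And>t. 0 \<le> t \<Longrightarrow> P t \<in> borel_measurable (F t)"
    "\<And>\<omega>. \<omega> \<in> space M \<Longrightarrow> mono (\<lambda>t. P t \<omega>)" "\<And>\<omega>. \<omega> \<in> space M \<Longrightarrow> continuous_on {0..} (\<lambda>t. P t \<omega>)"
    "\<And>\<omega>. \<omega> \<in> space M \<Longrightarrow> P 0 \<omega> = 0"
    and Q: "\<And>t \<omega>. \<omega> \<in> space M \<Longrightarrow> 0 \<le> t \<Longrightarrow> Q t \<omega> = b + P t \<omega>" "\<And>t \<omega>. t < 0 \<Longrightarrow> Q t \<omega> = 0"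
    and b: "0 \<le> b"
  shows "control_process M F Q"
  unfolding control_process_def adapted_def
proof (intro conjI allI impI ballI)
  fix t :: real assume t: "0 \<le> t"
  have "(\<lambda>\<omega>. b + P t \<omega>) \<in> borel_measurable (F t)" by (intro borel_measurable_add borel_measurable_const Y t)
  then show "Q t \<in> borel_measurable (F t)"
    by (rule measurable_cong[THEN iffD1, rotated]) (simp add: Q(1) t)
next
  fix \<omega> assume w: "\<omega> \<in> space M"
  show "Q t \<omega> = 0" if "t < 0" for t using Q(2) that .
  have P0: "0 \<le> P t \<omega>" if "0 \<le> t" for t using monoD[OF Y(2)[OF w] that] Y(4)[OF w] by simp
  show "mono (\<lambda>t. Q t \<omega>)"
  proof (rule monoI)
    fix s t :: real assume "s \<le> t"
    consider "t < 0" | "s < 0" "0 \<le> t" | "0 \<le> s" using \<open>s \<le> t\<close> by linarith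
    then show "Q s \<omega> \<le> Q t \<omega>"
      using Q(1)[OF w] Q(2) P0[of t] b monoD[OF Y(2)[OF w] \<open>s \<le> t\<close>] \<open>s \<le> t\<close> by cases auto
  qed
  have "continuous_on {0..} (\<lambda>t. b + P t \<omega>)" by (intro continuous_intros Y w)
  then have "continuous_on {0..} (\<lambda>t. Q t \<omega>)" by (rule continuous_on_eq) (simp add: Q(1) w)
  then show "rcll (\<lambda>t. Q t \<omega>)" by (rule continuous_on_imp_rcll)
qed

lemma band_feasible: "feasible M F band"
  unfolding feasible_def
proof (intro conjI allI impI)
  show "control_process M F (fst band)"
    by (rule control_process_shifted[where P = low_push and b = "max 0 (c - x)"])
      (use low_push_upp_push_measurable_F low_push_upp_push_props band_eq band_neg in auto)
  show "control_process M F (snd band)"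
    by (rule control_process_shifted[where P = upp_push and b = "max 0 (x - c)"])
      (use low_push_upp_push_measurable_F low_push_upp_push_props band_eq band_neg in auto)
  fix t :: real assume t: "0 \<le> t"
  have "integrable M (\<lambda>\<omega>. max 0 (c - x) + low_push t \<omega>)" "integrable M (\<lambda>\<omega>. max 0 (x - c) + upp_push t \<omega>)"
    using low_push_upp_push_integrable[OF t] by auto
  then show "integrable M (fst band t)" "integrable M (snd band t)"
    by (auto simp: band_eq t cong: Bochner_Integration.integrable_cong)
qed

text \<open>The bound at integer times is used at the next integer after \<open>t\<close>, and the initial jump adds a constant.\<close>

lemma band_cost_le:
  assumes t: "0 < t"
  shows "(\<integral>\<^sup>+\<omega>. ((\<integral>\<^sup>+s\<in>{0..t}. ennreal (h (inventory \<mu> \<sigma> W x band s \<omega>)) \<partial>lborel)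
              + ennreal (k * fst band t \<omega> + l * snd band t \<omega>)) \<partial>M)
    \<le> ennreal (\<gamma> * (t + 1) + (k + l) * (u - d + \<bar>x - c\<bar>))"
proof -
  define T where "T = nat \<lceil>t\<rceil>"
  have T: "t \<le> real T" "real T \<le> t + 1" using t by (auto simp: T_def)
  define b where "b = (k + l) * \<bar>x - c\<bar>"
  have b0: "0 \<le> b" using pos by (simp add: b_def)
  have "(\<integral>\<^sup>+s\<in>{0..t}. ennreal (h (inventory \<mu> \<sigma> W x band s \<omega>)) \<partial>lborel)
              + ennreal (k * fst band t \<omega> + l * snd band t \<omega>)
      \<le> ennreal (holding T \<omega> + k * low_push T \<omega> + l * upp_push T \<omega>) + ennreal b" if w: "\<omega> \<in> space M" for \<omega>
  proof -
    have "(\<integral>\<^sup>+s\<in>{0..t}. ennreal (h (inventory \<mu> \<sigma> W x band s \<omega>)) \<partial>lborel)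
        \<le> (\<integral>\<^sup>+s. ennreal (indicator {0..<real T} s * h (level s \<omega>)) \<partial>lborel)"
    proof (rule nn_integral_mono_AE)
      show "AE s in lborel. ennreal (h (inventory \<mu> \<sigma> W x band s \<omega>)) * indicator {0..t} s
          \<le> ennreal (indicator {0..<real T} s * h (level s \<omega>))"
        using AE_lborel_singleton[of "real T"]
        by eventually_elim (use T in \<open>auto simp: indicator_def band_eq w\<close>)
    qed
    also have "\<dots> = ennreal (holding T \<omega>)"
      unfolding holding_def using h_nonneg by (intro nn_integral_eq_integral holding_bound(1) w) auto
    finally have 1: "(\<integral>\<^sup>+s\<in>{0..t}. ennreal (h (inventory \<mu> \<sigma> W x band s \<omega>)) \<partial>lborel) \<le> ennreal (holding T \<omega>)" .
    have nn: "0 \<le> low_push T \<omega>" "0 \<le> upp_push T \<omega>" using low_push_upp_push_nonneg[OF w] by auto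
    have "k * max 0 (c - x) + l * max 0 (x - c) \<le> k * \<bar>x - c\<bar> + l * \<bar>x - c\<bar>"
      using pos by (intro add_mono mult_left_mono) auto
    moreover have "k * low_push t \<omega> \<le> k * low_push T \<omega>" "l * upp_push t \<omega> \<le> l * upp_push T \<omega>"
      using monoD[OF low_push_upp_push_props(1)[OF w] T(1)] monoD[OF low_push_upp_push_props(2)[OF w] T(1)] pos by auto
    ultimately have *: "k * fst band t \<omega> + l * snd band t \<omega> \<le> (k * low_push T \<omega> + l * upp_push T \<omega>) + b"
      using t by (simp add: band_eq w b_def algebra_simps)
    have "ennreal (k * fst band t \<omega> + l * snd band t \<omega>) \<le> ennreal (k * low_push T \<omega> + l * upp_push T \<omega>) + ennreal b"
    proof -
      have "0 \<le> k * low_push T \<omega> + l * upp_push T \<omega>" using nn pos by simp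
      note plus = ennreal_plus[OF this b0]
      show ?thesis using ennreal_leI[OF *] unfolding plus .
    qed
    from add_mono[OF 1 this] have "(\<integral>\<^sup>+s\<in>{0..t}. ennreal (h (inventory \<mu> \<sigma> W x band s \<omega>)) \<partial>lborel)
              + ennreal (k * fst band t \<omega> + l * snd band t \<omega>)
        \<le> (ennreal (holding T \<omega>) + ennreal (k * low_push T \<omega> + l * upp_push T \<omega>)) + ennreal b" by (simp add: add.assoc)
    also have "ennreal (holding T \<omega>) + ennreal (k * low_push T \<omega> + l * upp_push T \<omega>) = ennreal (holding T \<omega> + k * low_push T \<omega> + l * upp_push T \<omega>)"
      unfolding add.assoc using holding_nonneg nn pos by (intro ennreal_plus[symmetric]) auto
    finally show ?thesis .
  qed
  then have "(\<integral>\<^sup>+\<omega>. ((\<integral>\<^sup>+s\<in>{0..t}. ennreal (h (inventory \<mu> \<sigma> W x band s \<omega>)) \<partial>lborel)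
              + ennreal (k * fst band t \<omega> + l * snd band t \<omega>)) \<partial>M)
      \<le> (\<integral>\<^sup>+\<omega>. ennreal (holding T \<omega> + k * low_push T \<omega> + l * upp_push T \<omega>) + ennreal b \<partial>M)"
    by (rule nn_integral_mono)
  also have "\<dots> = (\<integral>\<^sup>+\<omega>. ennreal (holding T \<omega> + k * low_push T \<omega> + l * upp_push T \<omega>) \<partial>M) + ennreal b"
  proof -
    have "holding T \<in> borel_measurable M"
    proof (rule borel_measurable_LIMSEQ_real[OF holding_bound(2)])
      fix n show "(\<lambda>\<omega>. 1 / 2 ^ n * (\<Sum>i<T * 2 ^ n. h (proj (grid_level n i \<omega>)))) \<in> borel_measurable M"
        by (intro borel_measurable_times borel_measurable_const borel_measurable_sum h_grid_level_measurable)
    qed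
    moreover have "low_push T \<in> borel_measurable M" "upp_push T \<in> borel_measurable M"
      by (rule measurable_F_M[OF low_push_upp_push_measurable_F(1)] measurable_F_M[OF low_push_upp_push_measurable_F(2)], simp)+
    ultimately have "(\<lambda>\<omega>. ennreal (holding T \<omega> + k * low_push T \<omega> + l * upp_push T \<omega>)) \<in> borel_measurable M" by measurable
    then show ?thesis by (subst nn_integral_add) (auto simp: emeasure_space_1)
  qed
  also have "\<dots> \<le> ennreal (\<gamma> * real T + (k + l) * (u - d)) + ennreal b"
    by (rule add_right_mono[OF expected_cost_le])
  also have "\<dots> = ennreal (\<gamma> * real T + (k + l) * (u - d) + b)"
    using pos du b0 by (intro ennreal_plus[symmetric]) (auto intro!: add_nonneg_nonneg mult_nonneg_nonneg)
  also have "\<dots> \<le> ennreal (\<gamma> * (t + 1) + (k + l) * (u - d + \<bar>x - c\<bar>))"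
  proof (rule ennreal_leI)
    have "\<gamma> * real T \<le> \<gamma> * (t + 1)" using T pos by (intro mult_left_mono) auto
    then show "\<gamma> * real T + (k + l) * (u - d) + b \<le> \<gamma> * (t + 1) + (k + l) * (u - d + \<bar>x - c\<bar>)"
      by (simp add: b_def algebra_simps)
  qed
  finally show ?thesis .
qed

lemma band_average_cost_le: "average_cost M W \<mu> \<sigma> h k l x band \<le> ennreal \<gamma>"
proof -
  define B where "B = \<gamma> + (k + l) * (u - d + \<bar>x - c\<bar>)"
  have "average_cost M W \<mu> \<sigma> h k l x band \<le> Limsup at_top (\<lambda>t. ennreal (\<gamma> + B / t))"
    unfolding average_cost_def
  proof (rule Limsup_mono)
    show "\<forall>\<^sub>F t in at_top. (\<integral>\<^sup>+\<omega>. ((\<integral>\<^sup>+s\<in>{0..t}. ennreal (h (inventory \<mu> \<sigma> W x band s \<omega>)) \<partial>lborel)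
              + ennreal (k * fst band t \<omega> + l * snd band t \<omega>)) \<partial>M) / ennreal t \<le> ennreal (\<gamma> + B / t)"
      using eventually_gt_at_top[of "0 :: real"]
    proof eventually_elim
      case (elim t)
      have nn: "0 \<le> \<gamma> * (t + 1) + (k + l) * (u - d + \<bar>x - c\<bar>)"
        using elim pos du by (intro add_nonneg_nonneg mult_nonneg_nonneg) auto
      have "(\<integral>\<^sup>+\<omega>. ((\<integral>\<^sup>+s\<in>{0..t}. ennreal (h (inventory \<mu> \<sigma> W x band s \<omega>)) \<partial>lborel)
              + ennreal (k * fst band t \<omega> + l * snd band t \<omega>)) \<partial>M) / ennreal t
          \<le> ennreal (\<gamma> * (t + 1) + (k + l) * (u - d + \<bar>x - c\<bar>)) / ennreal t"
        by (rule divide_right_mono_ennreal[OF band_cost_le[OF elim]])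
      also have "\<dots> = ennreal ((\<gamma> * (t + 1) + (k + l) * (u - d + \<bar>x - c\<bar>)) / t)"
        using nn elim by (simp add: divide_ennreal)
      also have "(\<gamma> * (t + 1) + (k + l) * (u - d + \<bar>x - c\<bar>)) / t = \<gamma> + B / t"
        using elim by (simp add: B_def field_simps)
      finally show ?case .
    qed
  qed
  also have "((\<lambda>t. ennreal (\<gamma> + B / t)) \<longlongrightarrow> ennreal (\<gamma> + 0)) at_top"
    by (intro tendsto_ennrealI tendsto_intros tendsto_divide_0[OF tendsto_const]
        filterlim_at_top_imp_at_infinity filterlim_ident)
  then have "Limsup at_top (\<lambda>t. ennreal (\<gamma> + B / t)) = ennreal \<gamma>"
    by (intro lim_imp_Limsup) simp_all
  finally show ?thesis .
qed

end

section \<open>Optimality of the control band policy\<close>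

theorem theorem6p3:
  fixes M :: "'w measure" and F :: "real \<Rightarrow> 'w measure" and W :: "real \<Rightarrow> 'w \<Rightarrow> real"
    and \<mu> \<sigma> k l a A B d u :: real and h :: "real \<Rightarrow> real"
  assumes "filtered_prob_space M F"
    and "std_brownian_motion M F W"
    and "\<mu> > 0" and "\<sigma> > 0" and "k > 0" and "l > 0"
    and "holding_cost \<mu> \<sigma> h a"
    and "g_AB \<mu> \<sigma> h a A B d = - k"
    and "g_AB \<mu> \<sigma> h a A B u = l"
    and "(g_AB \<mu> \<sigma> h a A B has_real_derivative 0) (at d)"
    and "(g_AB \<mu> \<sigma> h a A B has_real_derivative 0) (at u)"
  shows "\<forall>x::real.
           feasible M F (control_band_policy \<mu> \<sigma> W d u x) \<and>
           (\<forall>\<phi>. feasible M F \<phi> \<longrightarrow>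
              average_cost M W \<mu> \<sigma> h k l x (control_band_policy \<mu> \<sigma> W d u x)
                \<le> average_cost M W \<mu> \<sigma> h k l x \<phi>)"
proof -
  obtain V V1 V2 L K where V: "relative_value \<mu> \<sigma> k l d u (\<mu> * A) h V V1 V2 L K"
    using relative_value_exists[OF assms(7,3-6,8-11)] by blast
  have P: "prob_space M" using assms(1) unfolding filtered_prob_space_def by blast
  have C: "controlled_brownian \<mu> \<sigma> k l d u (\<mu> * A) h V V1 V2 L K M F W"
    using V P assms(1,2)
    by (simp add: controlled_brownian_def brownian_def brownian_axioms_def)
  show ?thesis
  proof (intro allI conjI impI)
    fix x
    interpret B: band_policy \<mu> \<sigma> k l d u "\<mu> * A" h V V1 V2 L K M F W x
      using C by (simp add: band_policy_def)
    show "feasible M F (control_band_policy \<mu> \<sigma> W d u x)" by (rule B.band_feasible)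
    fix \<phi> assume "feasible M F \<phi>"
    then interpret L: feasible_policy \<mu> \<sigma> k l d u "\<mu> * A" h V V1 V2 L K M F W x \<phi>
      using C by (simp add: feasible_policy_def feasible_policy_axioms_def)
    show "average_cost M W \<mu> \<sigma> h k l x (control_band_policy \<mu> \<sigma> W d u x)
        \<le> average_cost M W \<mu> \<sigma> h k l x \<phi>"
      using B.band_average_cost_le L.average_cost_lower by (rule order_trans)
  qed
qed

end
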